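(* Assume (A1)--(A2) and (B1)--(B2). Then the value function $V(t,x)=\inf_{u\in\mathcal U[t,T]}J(t,x,u)$ is a viscosity solution of (HJB).
   Context: **Spaces.** Fix $T>0$, $\tau>0$, $d\ge1$ and a metric space $U$. $H=L^2([-\tau,0];\mathbb R^d)$ with inner product $(\cdot,\cdot)_H$ and norm $|\cdot|_H$. $\mathcal D$ is the Banach space of bounded right-continuous functions $[-\tau,0]\to\mathbb R^d$ with norm $|\omega|_{\mathcal D}=\sup_\theta|\omega(\theta)|$; $\mathcal D^*$ is its dual. $\mathcal U[t,T]$ is the set of measurable $u:[t,T]\to U$. **Assumptions on the state equation.** (A1) $F:[0,T]\times\mathbb R^d\times\mathbb R\times U\to\mathbb R^d$ is measurable and there is $L>0$ with $|F(t,x,u)|\le L(1+|x|)$ and $|F(t,x,u)-F(s,y,u)|\le L(|s-t|+|x-y|)$ for all $t,s\in[0,T]$, $x,y\in\mathbb R^d\times\mathbb R$, $u\in U$. (A2) $a\in W^{1,2}([-\tau,0];\mathbb R^d)$ with $a(-\tau)=0$, $b\in W^{1,2}([0,T];\mathbb R^{d\times d})$, and there is $L>0$ with $|b(s)-b(t)|\le L|s-t|$ for all $s,t\in[0,T]$. **State equation.** For $t\in[0,T]$, $x\in\mathcal D$, $u\in\mathcal U[t,T]$, $X^u(\cdot)=X^u(\cdot,t,x)$ is the unique solution, continuous on $[t,T]$, of $$X^u(s)=x(0)+\int_t^sF(\sigma,X^u(\sigma),(a,X^u_\sigma)_H,u(\sigma))\,d\sigma+\int_t^sb(\sigma)X^u(\sigma-\tau)\,d\sigma,\quad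 s\in[t,T],$$ where $X^u(s)=x(s-t)$ for $t-\tau\le s<t$ and $X^u_s(\theta)=X^u(s+\theta)$, $\theta\in[-\tau,0]$. **Cost and value function.** (B1) $q:[0,T]\times\mathbb R^d\times U\to\mathbb R$ and $\phi:\mathbb R^d\to\mathbb R$ are measurable and there is $L>0$ with $|q(t,x,u)|+|\phi(x)|\le L(1+|x|)$ for all $t,x,u$. (B2) There are $L>0$ and a local modulus of continuity $\rho$ (a continuous function $[0,\infty)^2\to[0,\infty)$, nondecreasing in each argument, with $\rho(0,r)=0$ for all $r$) such that $|q(t,x,u)-q(s,y,u)|+|\phi(x)-\phi(y)|\le L|x-y|+\rho(|s-t|,|x|\vee|y|)$ for all $t,s\in[0,T]$, $x,y\in\mathbb R^d$, $u\in U$. The cost is $J(t,x,u)=\int_t^Tq(\sigma,X^u(\sigma,t,x),u(\sigma))\,d\sigma+\phi(X^u(T,t,x))$, and the value function is $V(t,x)=\inf_{u\in\mathcal U[t,T]}J(t,x,u)$ for $(t,x)\in[0,T]\times\mathcal D$. **Operator $\mathcal S$ and test functions.** For $x\in\mathcal D$ let $\widehat x(s)=x(s)$ for $s\in[-\tau,0)$, $\widehat x(s)=x(0)$ for $s\ge0$, and $\widehat x_h(\theta)=\widehat x(h+\theta)$, $\theta\in[-\tau,0]$. For Borel $f:\mathcal D\to\mathbb R$, $\mathcal S(f)(x)=\lim_{h\to0^+}\frac1h[f(\widehat x_h)-f(x)]$; $\widehat D(\mathcal S)$ is the set of $f$ for which this limit exists for all $x\in\mathcal D$. $D(\mathcal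 S)$ is the set of $g:[0,T]\times\mathcal D\to\mathbb R$ with $g(t,\cdot)\in\widehat D(\mathcal S)$ for all $t$, and $\mathcal S(g)(t,x)=\mathcal S(g(t,\cdot))(x)$. $\Phi$ is the set of $\varphi\in C^1([0,T]\times\mathcal D)\cap D(\mathcal S)$ for which there is $\varphi_0\in C^1([0,T]\times\mathbb R^d\times H)$ with $\varphi(t,x)=\varphi_0(t,x(0),x)$ for all $(t,x)\in[0,T]\times\mathcal D$. $\nabla_x\varphi(t,x)\in\mathcal D^*$ is the derivative in $x\in\mathcal D$, and $\varphi_t$ the time derivative. **HJB equation.** (HJB): $\frac{\partial}{\partial t}V(t,x)+\mathcal S(V)(t,x)+\mathbf H(t,x,\nabla_xV(t,x))=0$ for $t\in[0,T]$, $x\in\mathcal D$, with $V(T,x)=\phi(x(0))$, where for $(t,x,p)\in[0,T]\times\mathcal D\times\mathcal D^*$ $$\mathbf H(t,x,p)=\inf_{u\in U}\big[\langle[F(t,x(0),(a,x)_H,u)+b(t)x(-\tau)]1_0,\,p\rangle+q(t,x(0),u)\big],$$ $1_0:[-\tau,0]\to\mathbb R$ is the indicator function of $\{0\}$, and $\langle\cdot,\cdot\rangle$ is the duality pairing of $\mathcal D$ and $\mathcal D^*$. **Viscosity solutions.** For open $Q\subset\mathbb R^d$, $\mathcal D_{\bar Q}=\{\omega\in\mathcal D:\omega(\theta)\in\bar Q\ \forall\theta\in[-\tau,0]\}$. For $0\le t\le\bar t\le T$ and $\omega,\bar\omega\in\mathcal D$, $(t,\omega)\otimes(\bar t,\bar\omega)=(\bar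 t,\tilde\omega)$ with $\tilde\omega(\theta)=\bar\omega(\theta)$ if $t-\bar t\le\theta\le0$ and $\tilde\omega(\theta)=\omega(\bar t-t+\theta)$ if $-\tau\le\theta<t-\bar t$. $w\in C([0,T]\times\mathcal D)$ is a viscosity subsolution (resp. supersolution) of (HJB) if $w(T,x)\le\phi(x(0))$ (resp. $\ge$) for all $x$, and for every bounded open $Q\subset\mathbb R^d$, every $\varphi\in\Phi$ and every $(s,z)\in[0,T)\times\mathcal D_{\bar Q}$ with $z(0)\in Q$: whenever $(w-\varphi)(s,z)=\sup_{(t,x)\in[s,T]\times\mathcal D_{\bar Q}}(w-\varphi)((s,z)\otimes(t,x))$ (resp. $(w+\varphi)(s,z)=\inf_{(t,x)\in[s,T]\times\mathcal D_{\bar Q}}(w+\varphi)((s,z)\otimes(t,x))$), one has $\varphi_t(s,z)+\mathcal S(\varphi)(s,z)+\mathbf H(s,z,\nabla_x\varphi(s,z))\ge0$ (resp. $-\varphi_t(s,z)-\mathcal S(\varphi)(s,z)+\mathbf H(s,z,-\nabla_x\varphi(s,z))\le0$). A viscosity solution is both a viscosity subsolution and a viscosity supersolution. *)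

theory Defs
  imports "HOL-Analysis.Analysis" "HOL-Library.Function_Algebras"
begin

section \<open>Functions on seminormed spaces\<close>

text \<open>
  The spaces of paths depend on the real parameter \<open>\<tau>\<close>, so they cannot be types. A (semi)normed
  space is therefore given by a carrier \<open>E\<close>, a linear subspace of a type of class
  \<^class>\<open>real_vector\<close>, and a seminorm \<open>N\<close> on \<open>E\<close>. Functions into a real vector space are made a
  real vector space pointwise.
\<close>

instantiation "fun" :: (type, real_vector) real_vector
begin

definition scaleR_fun :: "real \<Rightarrow> ('a \<Rightarrow> 'b) \<Rightarrow> 'a \<Rightarrow> 'b" where
  "scaleR_fun c f = (\<lambda>x. c *\<^sub>R f x)"

instance
  by standard (auto simp: scaleR_fun_def fun_eq_iff scaleR_add_right scaleR_add_left)

end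

definition dual_space :: "'a::real_vector set \<Rightarrow> ('a \<Rightarrow> real) \<Rightarrow> ('a \<Rightarrow> real) set" where
  "dual_space E N = {p. (\<forall>x\<in>E. \<forall>y\<in>E. p (x + y) = p x + p y) \<and>
                        (\<forall>c. \<forall>x\<in>E. p (c *\<^sub>R x) = c * p x) \<and>
                        (\<exists>K. \<forall>x\<in>E. \<bar>p x\<bar> \<le> K * N x)}"

definition dual_norm :: "'a::real_vector set \<Rightarrow> ('a \<Rightarrow> real) \<Rightarrow> ('a \<Rightarrow> real) \<Rightarrow> real" where
  "dual_norm E N p = (SUP y\<in>{y\<in>E. N y \<le> 1}. \<bar>p y\<bar>)"

definition open_in_space :: "'a::real_vector set \<Rightarrow> ('a \<Rightarrow> real) \<Rightarrow> 'a set \<Rightarrow> bool" where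
  "open_in_space E N S \<longleftrightarrow> S \<subseteq> E \<and> (\<forall>x\<in>S. \<exists>e>0. \<forall>y\<in>E. N (y - x) < e \<longrightarrow> y \<in> S)"

definition borel_in_space :: "'a::real_vector set \<Rightarrow> ('a \<Rightarrow> real) \<Rightarrow> 'a measure" where
  "borel_in_space E N = sigma E {S. open_in_space E N S}"

text \<open>
  Joint continuity on \<open>[0,T] \<times> E\<close> of a function with values in a space with distance \<open>\<delta>\<close>. If \<open>\<delta>\<close>
  separates points, such a function takes equal values at points of \<open>E\<close> at seminorm distance \<open>0\<close>;
  hence for \<open>L\<^sup>2\<close> it is a function of equivalence classes.
\<close>

definition continuous_wrt ::
  "('b \<Rightarrow> 'b \<Rightarrow> real) \<Rightarrow> real \<Rightarrow> 'a::real_vector set \<Rightarrow> ('a \<Rightarrow> real) \<Rightarrow> (real \<Rightarrow> 'a \<Rightarrow> 'b) \<Rightarrow> bool" where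
  "continuous_wrt \<delta> T E N g \<longleftrightarrow>
     (\<forall>t\<in>{0..T}. \<forall>x\<in>E. \<forall>e>0. \<exists>d>0. \<forall>s\<in>{0..T}. \<forall>y\<in>E.
        \<bar>s - t\<bar> < d \<and> N (y - x) < d \<longrightarrow> \<delta> (g s y) (g t x) < e)"

definition C0_space ::
  "real \<Rightarrow> 'a::real_vector set \<Rightarrow> ('a \<Rightarrow> real) \<Rightarrow> (real \<Rightarrow> 'a \<Rightarrow> real) set" where
  "C0_space T E N = {g. continuous_wrt dist T E N g}"

definition has_gradient ::
  "'a::real_vector set \<Rightarrow> ('a \<Rightarrow> real) \<Rightarrow> ('a \<Rightarrow> real) \<Rightarrow> ('a \<Rightarrow> real) \<Rightarrow> 'a \<Rightarrow> bool" where
  "has_gradient E N f p x \<longleftrightarrow> p \<in> dual_space E N \<and>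
     (\<forall>e>0. \<exists>d>0. \<forall>y\<in>E. N (y - x) < d \<longrightarrow> \<bar>f y - f x - p (y - x)\<bar> \<le> e * N (y - x))"

text \<open>The Frechet derivative; its values on \<open>E\<close> are uniquely determined where it exists.\<close>

definition gradient ::
  "'a::real_vector set \<Rightarrow> ('a \<Rightarrow> real) \<Rightarrow> ('a \<Rightarrow> real) \<Rightarrow> 'a \<Rightarrow> 'a \<Rightarrow> real" where
  "gradient E N f x = (SOME p. has_gradient E N f p x)"

text \<open>At the end points of \<open>[0,T]\<close> this is the one-sided derivative.\<close>

definition time_deriv :: "real \<Rightarrow> (real \<Rightarrow> 'a \<Rightarrow> real) \<Rightarrow> real \<Rightarrow> 'a \<Rightarrow> real" where
  "time_deriv T g t x = vector_derivative (\<lambda>s. g s x) (at t within {0..T})"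

definition C1_space ::
  "real \<Rightarrow> 'a::real_vector set \<Rightarrow> ('a \<Rightarrow> real) \<Rightarrow> (real \<Rightarrow> 'a \<Rightarrow> real) set" where
  "C1_space T E N =
     {g \<in> C0_space T E N.
        (\<forall>t\<in>{0..T}. \<forall>x\<in>E. (\<lambda>s. g s x) differentiable (at t within {0..T})) \<and>
        (\<forall>t\<in>{0..T}. \<forall>x\<in>E. \<exists>p. has_gradient E N (g t) p x) \<and>
        time_deriv T g \<in> C0_space T E N \<and>
        continuous_wrt (\<lambda>p p'. dual_norm E N (p - p')) T E N (\<lambda>t. gradient E N (g t))}"


section \<open>The spaces \<open>L\<^sup>2\<close>, \<open>W\<^sup>1\<^sup>,\<^sup>2\<close> and \<open>\<D>\<close>\<close>

text \<open>
  Elements of \<open>L\<^sup>2\<close> are represented by functions; functions equal almost everywhere are at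
  seminorm distance \<open>0\<close>.
\<close>

definition L2_space :: "real set \<Rightarrow> (real \<Rightarrow> 'a::euclidean_space) set" where
  "L2_space S = {f \<in> borel_measurable (lebesgue_on S).
                   integrable (lebesgue_on S) (\<lambda>s. (norm (f s))\<^sup>2)}"

definition inner_H :: "real \<Rightarrow> (real \<Rightarrow> real^'d) \<Rightarrow> (real \<Rightarrow> real^'d) \<Rightarrow> real" where
  "inner_H \<tau> f g = (LINT \<theta>|lebesgue_on {-\<tau>..0}. f \<theta> \<bullet> g \<theta>)"

definition norm_H :: "real \<Rightarrow> (real \<Rightarrow> real^'d) \<Rightarrow> real" where
  "norm_H \<tau> f = sqrt (inner_H \<tau> f f)"

text \<open>
  \<open>W\<^sup>1\<^sup>,\<^sup>2([\<alpha>,\<beta>])\<close>, in terms of the absolutely continuous representative: primitives of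
  \<open>L\<^sup>2\<close> functions.
\<close>

definition W12_space :: "real \<Rightarrow> real \<Rightarrow> (real \<Rightarrow> 'a::euclidean_space) set" where
  "W12_space \<alpha> \<beta> =
     {f. \<exists>g\<in>L2_space {\<alpha>..\<beta>}. \<forall>s\<in>{\<alpha>..\<beta>}. f s = f \<alpha> + (LINT r|lebesgue_on {\<alpha>..s}. g r)}"

text \<open>
  A function on \<open>[-\<tau>,0]\<close> is represented by its extension by \<open>0\<close>. The filter at \<open>\<theta> = 0\<close> is trivial,
  so nothing is required there.
\<close>

definition path_space :: "real \<Rightarrow> (real \<Rightarrow> real^'d) set" where
  "path_space \<tau> = {x. bounded (x ` {-\<tau>..0}) \<and>
                     (\<forall>\<theta>\<in>{-\<tau>..0}. continuous (at \<theta> within {\<theta>..0}) x) \<and>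
                     (\<forall>\<theta>. \<theta> \<notin> {-\<tau>..0} \<longrightarrow> x \<theta> = 0)}"

definition sup_norm :: "real \<Rightarrow> (real \<Rightarrow> real^'d) \<Rightarrow> real" where
  "sup_norm \<tau> x = (SUP \<theta>\<in>{-\<tau>..0}. norm (x \<theta>))"

text \<open>The path \<open>v 1\<^sub>0\<close>.\<close>

definition jump_at_0 :: "real^'d \<Rightarrow> real \<Rightarrow> real^'d" where
  "jump_at_0 v = (\<lambda>\<theta>. if \<theta> = 0 then v else 0)"


section \<open>The control problem\<close>

definition condition_A1 ::
  "real \<Rightarrow> (real \<Rightarrow> (real^'d) \<times> real \<Rightarrow> 'u::metric_space \<Rightarrow> real^'d) \<Rightarrow> bool" where
  "condition_A1 T F \<longleftrightarrow>
     (\<lambda>(t, x, u). F t x u) \<in>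
       borel_measurable (restrict_space borel {0..T} \<Otimes>\<^sub>M borel \<Otimes>\<^sub>M borel) \<and>
     (\<exists>L>0. (\<forall>t\<in>{0..T}. \<forall>x u. norm (F t x u) \<le> L * (1 + norm x)) \<and>
            (\<forall>t\<in>{0..T}. \<forall>s\<in>{0..T}. \<forall>x y u.
               norm (F t x u - F s y u) \<le> L * (\<bar>s - t\<bar> + norm (x - y))))"

definition condition_A2 ::
  "real \<Rightarrow> real \<Rightarrow> (real \<Rightarrow> real^'d) \<Rightarrow> (real \<Rightarrow> real^'d^'d) \<Rightarrow> bool" where
  "condition_A2 T \<tau> a b \<longleftrightarrow>
     a \<in> W12_space (-\<tau>) 0 \<and> a (-\<tau>) = 0 \<and> b \<in> W12_space 0 T \<and>
     (\<exists>L>0. \<forall>s\<in>{0..T}. \<forall>t\<in>{0..T}. norm (b s - b t) \<le> L * \<bar>s - t\<bar>)"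

definition condition_B1 ::
  "real \<Rightarrow> (real \<Rightarrow> real^'d \<Rightarrow> 'u::metric_space \<Rightarrow> real) \<Rightarrow> (real^'d \<Rightarrow> real) \<Rightarrow> bool" where
  "condition_B1 T q \<phi> \<longleftrightarrow>
     (\<lambda>(t, x, u). q t x u) \<in>
       borel_measurable (restrict_space borel {0..T} \<Otimes>\<^sub>M borel \<Otimes>\<^sub>M borel) \<and>
     \<phi> \<in> borel_measurable borel \<and>
     (\<exists>L>0. \<forall>t\<in>{0..T}. \<forall>x u. \<bar>q t x u\<bar> + \<bar>\<phi> x\<bar> \<le> L * (1 + norm x))"

definition local_modulus :: "(real \<Rightarrow> real \<Rightarrow> real) \<Rightarrow> bool" where
  "local_modulus \<rho> \<longleftrightarrow>
     continuous_on ({0..} \<times> {0..}) (\<lambda>(h, r). \<rho> h r) \<and>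
     (\<forall>h\<ge>0. \<forall>r\<ge>0. \<rho> h r \<ge> 0) \<and>
     (\<forall>r\<ge>0. mono_on {0..} (\<lambda>h. \<rho> h r)) \<and>
     (\<forall>h\<ge>0. mono_on {0..} (\<lambda>r. \<rho> h r)) \<and>
     (\<forall>r\<ge>0. \<rho> 0 r = 0)"

definition condition_B2 ::
  "real \<Rightarrow> (real \<Rightarrow> real^'d \<Rightarrow> 'u \<Rightarrow> real) \<Rightarrow> (real^'d \<Rightarrow> real) \<Rightarrow> bool" where
  "condition_B2 T q \<phi> \<longleftrightarrow>
     (\<exists>L>0. \<exists>\<rho>. local_modulus \<rho> \<and>
        (\<forall>t\<in>{0..T}. \<forall>s\<in>{0..T}. \<forall>x y u.
           \<bar>q t x u - q s y u\<bar> + \<bar>\<phi> x - \<phi> y\<bar>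
             \<le> L * norm (x - y) + \<rho> \<bar>s - t\<bar> (max (norm x) (norm y))))"

definition controls :: "real \<Rightarrow> real \<Rightarrow> (real \<Rightarrow> 'u::metric_space) set" where
  "controls t T = measurable (lebesgue_on {t..T}) borel"

text \<open>The value \<open>0\<close> outside \<open>[t-\<tau>,T]\<close> is a normalisation that makes the solution unique.\<close>

definition solves_state_eq ::
  "real \<Rightarrow> real \<Rightarrow> (real \<Rightarrow> (real^'d) \<times> real \<Rightarrow> 'u \<Rightarrow> real^'d) \<Rightarrow> (real \<Rightarrow> real^'d) \<Rightarrow>
   (real \<Rightarrow> real^'d^'d) \<Rightarrow> real \<Rightarrow> (real \<Rightarrow> real^'d) \<Rightarrow> (real \<Rightarrow> 'u) \<Rightarrow> (real \<Rightarrow> real^'d) \<Rightarrow> bool" where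
  "solves_state_eq T \<tau> F a b t x u X \<longleftrightarrow>
     continuous_on {t..T} X \<and>
     (\<forall>s\<in>{t-\<tau>..<t}. X s = x (s - t)) \<and>
     (\<forall>s\<in>{t..T}. X s = x 0
        + (LINT \<sigma>|lebesgue_on {t..s}. F \<sigma> (X \<sigma>, inner_H \<tau> a (\<lambda>\<theta>. X (\<sigma> + \<theta>))) (u \<sigma>))
        + (LINT \<sigma>|lebesgue_on {t..s}. b \<sigma> *v X (\<sigma> - \<tau>))) \<and>
     (\<forall>s. s \<notin> {t-\<tau>..T} \<longrightarrow> X s = 0)"

definition state ::
  "real \<Rightarrow> real \<Rightarrow> (real \<Rightarrow> (real^'d) \<times> real \<Rightarrow> 'u \<Rightarrow> real^'d) \<Rightarrow> (real \<Rightarrow> real^'d) \<Rightarrow>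
   (real \<Rightarrow> real^'d^'d) \<Rightarrow> real \<Rightarrow> (real \<Rightarrow> real^'d) \<Rightarrow> (real \<Rightarrow> 'u) \<Rightarrow> real \<Rightarrow> real^'d" where
  "state T \<tau> F a b t x u = (THE X. solves_state_eq T \<tau> F a b t x u X)"

definition cost ::
  "real \<Rightarrow> real \<Rightarrow> (real \<Rightarrow> (real^'d) \<times> real \<Rightarrow> 'u \<Rightarrow> real^'d) \<Rightarrow> (real \<Rightarrow> real^'d) \<Rightarrow>
   (real \<Rightarrow> real^'d^'d) \<Rightarrow> (real \<Rightarrow> real^'d \<Rightarrow> 'u \<Rightarrow> real) \<Rightarrow> (real^'d \<Rightarrow> real) \<Rightarrow>
   real \<Rightarrow> (real \<Rightarrow> real^'d) \<Rightarrow> (real \<Rightarrow> 'u) \<Rightarrow> real" where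
  "cost T \<tau> F a b q \<phi> t x u =
     (let X = state T \<tau> F a b t x u
      in (LINT \<sigma>|lebesgue_on {t..T}. q \<sigma> (X \<sigma>) (u \<sigma>)) + \<phi> (X T))"

definition value_function ::
  "real \<Rightarrow> real \<Rightarrow> (real \<Rightarrow> (real^'d) \<times> real \<Rightarrow> 'u::metric_space \<Rightarrow> real^'d) \<Rightarrow>
   (real \<Rightarrow> real^'d) \<Rightarrow> (real \<Rightarrow> real^'d^'d) \<Rightarrow> (real \<Rightarrow> real^'d \<Rightarrow> 'u \<Rightarrow> real) \<Rightarrow>
   (real^'d \<Rightarrow> real) \<Rightarrow> real \<Rightarrow> (real \<Rightarrow> real^'d) \<Rightarrow> real" where
  "value_function T \<tau> F a b q \<phi> t x = (INF u\<in>controls t T. cost T \<tau> F a b q \<phi> t x u)"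


section \<open>The operator \<open>\<S>\<close> and test functions\<close>

definition frozen_shift :: "real \<Rightarrow> (real \<Rightarrow> real^'d) \<Rightarrow> real \<Rightarrow> real \<Rightarrow> real^'d" where
  "frozen_shift \<tau> x h = (\<lambda>\<theta>. if \<theta> \<notin> {-\<tau>..0} then 0 else if h + \<theta> < 0 then x (h + \<theta>) else x 0)"

definition S_quotient ::
  "real \<Rightarrow> ((real \<Rightarrow> real^'d) \<Rightarrow> real) \<Rightarrow> (real \<Rightarrow> real^'d) \<Rightarrow> real \<Rightarrow> real" where
  "S_quotient \<tau> f x h = (1 / h) * (f (frozen_shift \<tau> x h) - f x)"

definition S_op :: "real \<Rightarrow> ((real \<Rightarrow> real^'d) \<Rightarrow> real) \<Rightarrow> (real \<Rightarrow> real^'d) \<Rightarrow> real" where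
  "S_op \<tau> f x = Lim (at_right 0) (S_quotient \<tau> f x)"

definition S_dom_hat :: "real \<Rightarrow> ((real \<Rightarrow> real^'d) \<Rightarrow> real) set" where
  "S_dom_hat \<tau> = {f \<in> borel_measurable (borel_in_space (path_space \<tau>) (sup_norm \<tau>)).
                    \<forall>x\<in>path_space \<tau>. \<exists>l. (S_quotient \<tau> f x \<longlongrightarrow> l) (at_right 0)}"

definition S_dom :: "real \<Rightarrow> real \<Rightarrow> (real \<Rightarrow> (real \<Rightarrow> real^'d) \<Rightarrow> real) set" where
  "S_dom T \<tau> = {g. \<forall>t\<in>{0..T}. g t \<in> S_dom_hat \<tau>}"

definition test_functions :: "real \<Rightarrow> real \<Rightarrow> (real \<Rightarrow> (real \<Rightarrow> real^'d) \<Rightarrow> real) set" where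
  "test_functions T \<tau> =
     {\<psi> \<in> C1_space T (path_space \<tau>) (sup_norm \<tau>) \<inter> S_dom T \<tau>.
        \<exists>\<psi>\<^sub>0\<in>C1_space T (UNIV \<times> L2_space {-\<tau>..0}) (\<lambda>(v, f). norm v + norm_H \<tau> f).
          \<forall>t\<in>{0..T}. \<forall>x\<in>path_space \<tau>. \<psi> t x = \<psi>\<^sub>0 t (x 0, x)}"


section \<open>Viscosity solutions\<close>

definition hamiltonian ::
  "real \<Rightarrow> (real \<Rightarrow> (real^'d) \<times> real \<Rightarrow> 'u \<Rightarrow> real^'d) \<Rightarrow> (real \<Rightarrow> real^'d) \<Rightarrow>
   (real \<Rightarrow> real^'d^'d) \<Rightarrow> (real \<Rightarrow> real^'d \<Rightarrow> 'u \<Rightarrow> real) \<Rightarrow>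
   real \<Rightarrow> (real \<Rightarrow> real^'d) \<Rightarrow> ((real \<Rightarrow> real^'d) \<Rightarrow> real) \<Rightarrow> real" where
  "hamiltonian \<tau> F a b q t x p =
     (INF u. p (jump_at_0 (F t (x 0, inner_H \<tau> a x) u + b t *v x (-\<tau>))) + q t (x 0) u)"

definition paths_in :: "real \<Rightarrow> (real^'d) set \<Rightarrow> (real \<Rightarrow> real^'d) set" where
  "paths_in \<tau> S = {\<omega> \<in> path_space \<tau>. \<forall>\<theta>\<in>{-\<tau>..0}. \<omega> \<theta> \<in> S}"

text \<open>The path component of \<open>(t,\<omega>) \<otimes> (t',\<omega>')\<close>; the time component is \<open>t'\<close>.\<close>

definition concat_path ::
  "real \<Rightarrow> real \<Rightarrow> (real \<Rightarrow> real^'d) \<Rightarrow> real \<Rightarrow> (real \<Rightarrow> real^'d) \<Rightarrow> real \<Rightarrow> real^'d" where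
  "concat_path \<tau> t \<omega> t' \<omega>' =
     (\<lambda>\<theta>. if \<theta> \<notin> {-\<tau>..0} then 0 else if t - t' \<le> \<theta> then \<omega>' \<theta> else \<omega> (t' - t + \<theta>))"

text \<open>
  Suprema and infima in the touching conditions are taken in \<^typ>\<open>ereal\<close>, so that an unbounded
  difference does not touch.
\<close>

definition viscosity_subsolution ::
  "real \<Rightarrow> real \<Rightarrow> (real \<Rightarrow> (real^'d) \<times> real \<Rightarrow> 'u \<Rightarrow> real^'d) \<Rightarrow> (real \<Rightarrow> real^'d) \<Rightarrow>
   (real \<Rightarrow> real^'d^'d) \<Rightarrow> (real \<Rightarrow> real^'d \<Rightarrow> 'u \<Rightarrow> real) \<Rightarrow> (real^'d \<Rightarrow> real) \<Rightarrow>
   (real \<Rightarrow> (real \<Rightarrow> real^'d) \<Rightarrow> real) \<Rightarrow> bool" where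
  "viscosity_subsolution T \<tau> F a b q \<phi> w \<longleftrightarrow>
     w \<in> C0_space T (path_space \<tau>) (sup_norm \<tau>) \<and>
     (\<forall>x\<in>path_space \<tau>. w T x \<le> \<phi> (x 0)) \<and>
     (\<forall>Q. \<forall>\<psi>\<in>test_functions T \<tau>. \<forall>s\<in>{0..<T}. \<forall>z\<in>paths_in \<tau> (closure Q).
        bounded Q \<and> open Q \<and> z 0 \<in> Q \<and>
        ereal (w s z - \<psi> s z) =
          (SUP (t, x)\<in>{s..T} \<times> paths_in \<tau> (closure Q).
             ereal (w t (concat_path \<tau> s z t x) - \<psi> t (concat_path \<tau> s z t x))) \<longrightarrow>
        time_deriv T \<psi> s z + S_op \<tau> (\<psi> s) z
          + hamiltonian \<tau> F a b q s z (gradient (path_space \<tau>) (sup_norm \<tau>) (\<psi> s) z) \<ge> 0)"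

definition viscosity_supersolution ::
  "real \<Rightarrow> real \<Rightarrow> (real \<Rightarrow> (real^'d) \<times> real \<Rightarrow> 'u \<Rightarrow> real^'d) \<Rightarrow> (real \<Rightarrow> real^'d) \<Rightarrow>
   (real \<Rightarrow> real^'d^'d) \<Rightarrow> (real \<Rightarrow> real^'d \<Rightarrow> 'u \<Rightarrow> real) \<Rightarrow> (real^'d \<Rightarrow> real) \<Rightarrow>
   (real \<Rightarrow> (real \<Rightarrow> real^'d) \<Rightarrow> real) \<Rightarrow> bool" where
  "viscosity_supersolution T \<tau> F a b q \<phi> w \<longleftrightarrow>
     w \<in> C0_space T (path_space \<tau>) (sup_norm \<tau>) \<and>
     (\<forall>x\<in>path_space \<tau>. w T x \<ge> \<phi> (x 0)) \<and>
     (\<forall>Q. \<forall>\<psi>\<in>test_functions T \<tau>. \<forall>s\<in>{0..<T}. \<forall>z\<in>paths_in \<tau> (closure Q).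
        bounded Q \<and> open Q \<and> z 0 \<in> Q \<and>
        ereal (w s z + \<psi> s z) =
          (INF (t, x)\<in>{s..T} \<times> paths_in \<tau> (closure Q).
             ereal (w t (concat_path \<tau> s z t x) + \<psi> t (concat_path \<tau> s z t x))) \<longrightarrow>
        - time_deriv T \<psi> s z - S_op \<tau> (\<psi> s) z
          + hamiltonian \<tau> F a b q s z (- gradient (path_space \<tau>) (sup_norm \<tau>) (\<psi> s) z) \<le> 0)"

definition viscosity_solution ::
  "real \<Rightarrow> real \<Rightarrow> (real \<Rightarrow> (real^'d) \<times> real \<Rightarrow> 'u \<Rightarrow> real^'d) \<Rightarrow> (real \<Rightarrow> real^'d) \<Rightarrow>
   (real \<Rightarrow> real^'d^'d) \<Rightarrow> (real \<Rightarrow> real^'d \<Rightarrow> 'u \<Rightarrow> real) \<Rightarrow> (real^'d \<Rightarrow> real) \<Rightarrow>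
   (real \<Rightarrow> (real \<Rightarrow> real^'d) \<Rightarrow> real) \<Rightarrow> bool" where
  "viscosity_solution T \<tau> F a b q \<phi> w \<longleftrightarrow>
     viscosity_subsolution T \<tau> F a b q \<phi> w \<and> viscosity_supersolution T \<tau> F a b q \<phi> w"

end

theory Submission
  imports Defs
begin

text \<open>
  The value function is Lipschitz in the path for the weak norm \<open>\<bar>x(0)\<bar> + \<parallel>x\<parallel>\<close> of \<open>\<real>\<^sup>d \<times> L\<^sup>1\<close>, because
  the state equation sees the past only under integrals. Together with the dynamic programming
  principle this gives continuity in time, although the translation of a right-continuous path is
  not continuous in the supremum norm.

  For a test function \<open>\<psi>(t,x) = \<psi>\<^sub>0(t,x(0),x)\<close> and a trajectory \<open>X\<close> starting from \<open>(s,z)\<close>, the segment of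
  \<open>X\<close> at time \<open>s + h\<close> is compared with the frozen shift of \<open>z\<close>. They differ only on \<open>[-h,0]\<close> and by \<open>O(h)\<close>
  there, hence by \<open>O(h\<^bsup>3/2\<^esup>)\<close> in \<open>L\<^sup>2\<close>, so that to first order only the increment \<open>X(s+h) - z(0)\<close> enters
  through the derivative of \<open>\<psi>\<^sub>0\<close>; the frozen shift itself contributes \<open>h \<S>(\<psi>)\<close>. The expansion is uniform
  in the control. Inserted in the dynamic programming inequalities, with a constant control for the
  subsolution property and with an \<open>\<epsilon>h\<close>-optimal control for the supersolution property, it yields
  the two viscosity inequalities as \<open>h \<rightarrow> 0\<close>.
\<close>

subsection \<open>Bounded measurable functions\<close>

definition bdd_meas :: "(real \<Rightarrow> 'a::euclidean_space) \<Rightarrow> real set \<Rightarrow> bool" where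
  "bdd_meas f S \<longleftrightarrow> f \<in> borel_measurable (lebesgue_on S) \<and> bounded (f ` S)"

lemma bdd_measI:
  assumes "f \<in> borel_measurable (lebesgue_on S)" "\<And>s. s \<in> S \<Longrightarrow> norm (f s) \<le> K"
  shows "bdd_meas f S"
  using assms unfolding bdd_meas_def bounded_iff by blast

lemma bdd_meas_bound:
  assumes "bdd_meas f S"
  obtains K where "K > 0" "\<And>s. s \<in> S \<Longrightarrow> norm (f s) \<le> K"
  using assms unfolding bdd_meas_def bounded_pos by auto

lemma bdd_meas_subset:
  assumes "bdd_meas f S" "R \<subseteq> S"
  shows "bdd_meas f R"
  using assms measurable_restrict_mono[of f lebesgue S borel R] bounded_subset[of "f ` S" "f ` R"]
  unfolding bdd_meas_def by blast

lemma bdd_meas_continuous: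
  assumes "continuous_on {a..b} f"
  shows "bdd_meas f {a..b}"
  using assms compact_continuous_image[OF assms compact_Icc] compact_imp_bounded
  unfolding bdd_meas_def
  by (auto intro!: continuous_imp_measurable_on_sets_lebesgue)

lemma bdd_meas_borel:
  assumes "f \<in> borel_measurable borel" "\<And>s. norm (f s) \<le> K"
  shows "bdd_meas f S"
  using assms by (intro bdd_measI[of _ _ K])
    (auto intro!: measurable_restrict_space1 simp: measurable_completion)

lemma bdd_meas_const [simp]: "bdd_meas (\<lambda>_. c) S"
  by (auto intro: bdd_measI)

lemma bdd_meas_add:
  assumes "bdd_meas f S" "bdd_meas g S"
  shows "bdd_meas (\<lambda>s. f s + g s) S"
  using assms unfolding bdd_meas_def by (auto intro: bounded_plus_comp)

lemma bdd_meas_diff: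
  assumes "bdd_meas f S" "bdd_meas g S"
  shows "bdd_meas (\<lambda>s. f s - g s) S"
  using assms unfolding bdd_meas_def by (auto intro: bounded_minus_comp)

lemma bdd_meas_norm:
  assumes "bdd_meas f S"
  shows "bdd_meas (\<lambda>s. norm (f s)) S"
  using assms unfolding bdd_meas_def bounded_iff by auto

lemma bdd_meas_linear:
  assumes "bdd_meas f S" "bounded_linear h"
  shows "bdd_meas (\<lambda>s. h (f s)) S"
proof -
  have "h \<in> borel_measurable borel"
    using assms(2) by (intro borel_measurable_continuous_onI) (rule linear_continuous_on)
  moreover have "bounded ((\<lambda>s. h (f s)) ` S)"
    using bounded_linear_image[OF _ assms(2), of "f ` S"] assms(1)
    unfolding bdd_meas_def image_image by blast
  ultimately show ?thesis
    using assms(1) unfolding bdd_meas_def by (auto intro: measurable_compose)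
qed

lemma bdd_meas_integrable_lebesgue:
  assumes "bdd_meas f {a..b}"
  shows "integrable (lebesgue_on {a..b}) f"
proof -
  interpret finite_measure "lebesgue_on {a..b}"
    by (intro finite_measure_lebesgue_on) auto
  obtain K where "\<And>s. s \<in> {a..b} \<Longrightarrow> norm (f s) \<le> K"
    using assms unfolding bdd_meas_def bounded_iff by blast
  then show ?thesis
    using assms unfolding bdd_meas_def by (auto intro!: integrable_const_bound[of _ K])
qed

lemma bdd_meas_integrable:
  assumes "bdd_meas f {a..b}" "{c..d} \<subseteq> {a..b}"
  shows "f integrable_on {c..d}"
  using bdd_meas_integrable_lebesgue[OF bdd_meas_subset[OF assms]]
    has_integral_integral_lebesgue_on[of "{c..d}" f]
  by auto

text \<open>Controls are only Lebesgue measurable, and the definitions integrate over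
  \<open>lebesgue_on\<close>. This is the passage to the gauge integral, whose rules for
  subintervals, shifts and null sets carry the later estimates.\<close>

lemma bdd_meas_lebesgue_integral:
  assumes "bdd_meas f {a..b}"
  shows "(LINT s|lebesgue_on {a..b}. f s) = integral {a..b} f"
  by (rule lebesgue_integral_eq_integral[OF bdd_meas_integrable_lebesgue[OF assms]]) simp

lemma norm_integral_le_const:
  assumes "bdd_meas f {a..b}" "a \<le> b" "\<And>s. s \<in> {a..b} \<Longrightarrow> norm (f s) \<le> K"
  shows "norm (integral {a..b} f) \<le> K * (b - a)"
proof -
  have "norm (integral {a..b} f) \<le> integral {a..b} (\<lambda>_. K)"
    using assms by (intro integral_norm_bound_integral bdd_meas_integrable[OF assms(1)]) auto
  then show ?thesis
    using assms(2) by (simp add: mult.commute)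
qed

lemma norm_integral_diff_le_const:
  assumes "bdd_meas f {a..b}" "bdd_meas g {a..b}" "a \<le> b"
    and "\<And>s. s \<in> {a..b} \<Longrightarrow> norm (f s - g s) \<le> K"
  shows "norm (integral {a..b} f - integral {a..b} g) \<le> K * (b - a)"
proof -
  have "integral {a..b} f - integral {a..b} g = integral {a..b} (\<lambda>s. f s - g s)"
    by (intro integral_diff[symmetric] bdd_meas_integrable[OF assms(1)]
        bdd_meas_integrable[OF assms(2)]) auto
  then show ?thesis
    using norm_integral_le_const[OF bdd_meas_diff[OF assms(1,2)] assms(3,4)] by simp
qed

lemma integral_norm_le_add:
  assumes f: "bdd_meas f {a..b}" and g: "bdd_meas g {a..b}" and "a \<le> b"
    and le: "\<And>s. s \<in> {a..b} \<Longrightarrow> norm (f s) \<le> c + norm (g s)"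
  shows "integral {a..b} (\<lambda>s. norm (f s)) \<le> (b - a) * c + integral {a..b} (\<lambda>s. norm (g s))"
proof -
  note int = bdd_meas_integrable[OF bdd_meas_norm order_refl]
  have "integral {a..b} (\<lambda>s. norm (f s)) \<le> integral {a..b} (\<lambda>s. c + norm (g s))"
    by (intro integral_le integrable_add int[OF f] int[OF g] integrable_const_ivl le)
  also have "\<dots> = (b - a) * c + integral {a..b} (\<lambda>s. norm (g s))"
    using int[OF g] \<open>a \<le> b\<close> by (subst integral_add) auto
  finally show ?thesis .
qed

text \<open>The primitive is \<open>m / l * exp (l * (r - t))\<close>; its nonnegative value at the
  lower end is dropped. The factor \<open>1 / l\<close> is what a large exponent gains.\<close>

lemma integral_exp_weight_le:
  fixes m :: real
  assumes "l > 0" "m \<ge> 0" "t \<le> s"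
  shows "integral {t..s} (\<lambda>r. m * exp (l * (r - t))) \<le> m / l * exp (l * (s - t))"
proof -
  have "((\<lambda>r. m * exp (l * (r - t))) has_integral
      (m / l * exp (l * (s - t)) - m / l * exp (l * (t - t)))) {t..s}"
    using assms(1,3) by (intro fundamental_theorem_of_calculus)
      (auto intro!: derivative_eq_intros simp flip: has_real_derivative_iff_has_vector_derivative)
  moreover have "m / l \<ge> 0"
    using assms by simp
  ultimately show ?thesis
    by (simp only: integral_unique) simp
qed

text \<open>The exponential weight replaces Gronwall's lemma: the hypothesis is an estimate of the
  Volterra operator in the weighted norm, which is a contraction with factor \<open>1/2\<close>.\<close>

lemma exp_weight_bound:
  fixes f :: "real \<Rightarrow> real"
  assumes cont: "continuous_on {t..T} f" and "t \<le> T" "A \<ge> 0" "l \<ge> 0"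
    and step: "\<And>m s. m \<ge> 0 \<Longrightarrow> (\<And>r. r \<in> {t..T} \<Longrightarrow> f r \<le> m * exp (l * (r - t)))
           \<Longrightarrow> s \<in> {t..T} \<Longrightarrow> f s \<le> A + m / 2 * exp (l * (s - t))"
    and "s \<in> {t..T}"
  shows "f s \<le> 2 * A * exp (l * (s - t))"
proof -
  define g where "g = (\<lambda>s. f s * exp (- l * (s - t)))"
  have "continuous_on {t..T} g"
    unfolding g_def by (intro continuous_intros cont)
  then obtain s0 where s0: "s0 \<in> {t..T}" "\<And>s. s \<in> {t..T} \<Longrightarrow> g s \<le> g s0"
    using continuous_attains_sup[of "{t..T}" g] \<open>t \<le> T\<close> by auto
  \<comment> \<open>\<open>m\<close> is the least nonnegative constant admissible in the premise of
    \<open>step\<close>. Feeding it back at the maximum point \<open>s0\<close> gives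
    \<open>m \<le> A + m / 2\<close>, so that the half is absorbed.\<close>
  define m where "m = max (g s0) 0"
  have f_g: "f r = g r * exp (l * (r - t))" for r
    unfolding g_def by (simp add: mult.assoc flip: exp_add)
  have "f r \<le> m * exp (l * (r - t))" if "r \<in> {t..T}" for r
    unfolding f_g using s0(2)[OF that] by (simp add: m_def)
  then have *: "f s \<le> A + m / 2 * exp (l * (s - t))" if "s \<in> {t..T}" for s
    using step[of m s] that by (simp add: m_def)
  have "g s0 \<le> A + m / 2"
  proof -
    have "g s0 = f s0 * exp (- l * (s0 - t))"
      by (simp add: g_def)
    also have "\<dots> \<le> (A + m / 2 * exp (l * (s0 - t))) * exp (- l * (s0 - t))"
      using *[OF s0(1)] by (intro mult_right_mono) auto
    also have "\<dots> = A * exp (- l * (s0 - t)) + m / 2"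
      by (simp add: distrib_right mult.assoc flip: exp_add)
    also have "A * exp (- l * (s0 - t)) \<le> A * 1"
      using assms s0(1) by (intro mult_left_mono) auto
    finally show ?thesis by simp
  qed
  then have "m \<le> 2 * A"
    using \<open>A \<ge> 0\<close> unfolding m_def by (simp add: max_def split: if_splits)
  then have "g s \<le> 2 * A"
    using s0(2)[OF assms(6)] unfolding m_def by simp
  then show ?thesis
    unfolding f_g by simp
qed

lemma bounded_bilinear_matrix_vector_mult:
  "bounded_bilinear (\<lambda>(A::real^'n^'m) x. A *v x)"
  unfolding bilinear_conv_bounded_bilinear[symmetric] bilinear_def
  by (intro conjI allI linearI)
    (simp_all only: matrix_vector_mult_add_rdistrib matrix_vector_right_distrib
      matrix_vector_mult_scaleR scaleR_matrix_vector_assoc)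

subsection \<open>Right-continuous paths\<close>

lemma path_space_bounded:
  assumes "x \<in> path_space \<tau>"
  obtains K where "K \<ge> 0" "\<And>\<theta>. norm (x \<theta>) \<le> K"
proof -
  obtain K where K: "\<And>\<theta>. \<theta> \<in> {-\<tau>..0} \<Longrightarrow> norm (x \<theta>) \<le> K"
    using assms unfolding path_space_def bounded_iff by blast
  have "norm (x \<theta>) \<le> max K 0" for \<theta>
  proof (cases "\<theta> \<in> {-\<tau>..0}")
    case True
    then show ?thesis using K[of \<theta>] by simp
  next
    case False
    then have "x \<theta> = 0" using assms unfolding path_space_def by blast
    then show ?thesis by simp
  qed
  then show ?thesis
    by (intro that[of "max K 0"]) auto
qed

lemma norm_le_sup_norm:
  assumes "x \<in> path_space \<tau>" "\<theta> \<in> {-\<tau>..0}"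
  shows "norm (x \<theta>) \<le> sup_norm \<tau> x"
proof -
  obtain K where "\<And>\<theta>. norm (x \<theta>) \<le> K"
    using path_space_bounded[OF assms(1)] by metis
  then have "bdd_above ((\<lambda>\<theta>. norm (x \<theta>)) ` {-\<tau>..0})"
    by (intro bdd_aboveI2[of _ _ K]) simp
  then show ?thesis
    unfolding sup_norm_def by (rule cSUP_upper[OF assms(2)])
qed

text \<open>A right-continuous path is the pointwise limit of its values at grid points to the
  right. Each approximant factors through the floor function, on whose countable discrete range
  every function is measurable.\<close>

lemma path_space_borel_measurable:
  fixes x :: "real \<Rightarrow> real^'d"
  assumes "x \<in> path_space \<tau>"
  shows "x \<in> borel_measurable borel"
proof -
  \<comment> \<open>The next grid point of mesh \<open>1 / (n + 1)\<close> after
    \<open>\<theta>\<close>, cut off at \<open>0\<close> so that it stays where right-continuity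
    applies.\<close>
  define g where "g = (\<lambda>n \<theta>. min 0 ((of_int \<lfloor>real (Suc n) * \<theta>\<rfloor> + 1) / real (Suc n)))"
  define f where "f = (\<lambda>n \<theta>. if \<theta> \<in> {-\<tau>..0} then x (g n \<theta>) else 0)"
  have meas: "f n \<in> borel_measurable borel" for n
  proof -
    have "(\<lambda>\<theta>. \<lfloor>real (Suc n) * \<theta>\<rfloor>) \<in> measurable borel (count_space UNIV)"
      by simp
    moreover have "(\<lambda>k. x (min 0 ((of_int k + 1) / real (Suc n)))) \<in>
        measurable (count_space UNIV) borel"
      by simp
    ultimately have "(\<lambda>\<theta>. x (g n \<theta>)) \<in> borel_measurable borel"
      unfolding g_def by (rule measurable_compose)
    then show ?thesis
      unfolding f_def by (intro measurable_If_set) auto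
  qed
  have lim: "(\<lambda>n. f n \<theta>) \<longlonglongrightarrow> x \<theta>" for \<theta>
  proof (cases "\<theta> \<in> {-\<tau>..0}")
    case True
    have bnds: "\<theta> \<le> g n \<theta>" "g n \<theta> \<le> \<theta> + 1 / real (Suc n)" "g n \<theta> \<le> 0" for n
    proof -
      have 1: "\<theta> * real (Suc n) \<le> of_int \<lfloor>real (Suc n) * \<theta>\<rfloor> + 1"
        "of_int \<lfloor>real (Suc n) * \<theta>\<rfloor> + 1 \<le> \<theta> * real (Suc n) + 1"
        using floor_correct[of "real (Suc n) * \<theta>"] mult.commute[of \<theta> "real (Suc n)"] by linarith+
      have "\<theta> \<le> (of_int \<lfloor>real (Suc n) * \<theta>\<rfloor> + 1) / real (Suc n)"
        using 1(1) by (subst pos_le_divide_eq) auto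
      moreover have "(of_int \<lfloor>real (Suc n) * \<theta>\<rfloor> + 1) / real (Suc n) \<le> \<theta> + 1 / real (Suc n)"
        using 1(2) by (subst pos_divide_le_eq) (auto simp: distrib_right)
      ultimately show "\<theta> \<le> g n \<theta>" "g n \<theta> \<le> \<theta> + 1 / real (Suc n)" "g n \<theta> \<le> 0"
        using True unfolding g_def by auto
    qed
    have "(\<lambda>n. \<theta> + 1 / real (Suc n)) \<longlonglongrightarrow> \<theta> + 0"
      by (intro tendsto_intros LIMSEQ_Suc lim_1_over_n)
    then have "(\<lambda>n. g n \<theta>) \<longlonglongrightarrow> \<theta>"
      using bnds by (rule_tac tendsto_sandwich[of "\<lambda>_. \<theta>" _ _ "\<lambda>n. \<theta> + 1 / real (Suc n)"]) auto
    moreover have "continuous (at \<theta> within {\<theta>..0}) x"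
      using assms True unfolding path_space_def by blast
    ultimately have "(x \<circ> (\<lambda>n. g n \<theta>)) \<longlonglongrightarrow> x \<theta>"
      unfolding continuous_within_sequentially
      by (elim allE[of _ "\<lambda>n. g n \<theta>"] impE) (use bnds in auto)
    then show ?thesis
      using True by (simp add: f_def o_def)
  next
    case False
    then have "x \<theta> = 0" using assms unfolding path_space_def by blast
    moreover have "f n \<theta> = 0" for n using False by (simp only: f_def if_False)
    ultimately show ?thesis by simp
  qed
  show ?thesis
    by (rule borel_measurable_LIMSEQ_metric[of f]) (use meas lim in auto)
qed

lemma path_space_bdd_meas:
  assumes "x \<in> path_space \<tau>"
  shows "bdd_meas x S"
  using path_space_bounded[OF assms] path_space_borel_measurable[OF assms] bdd_meas_borel
  by metis

lemma path_space_diff_bdd_meas: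
  assumes "x \<in> path_space \<tau>" "y \<in> path_space \<tau>"
  shows "bdd_meas (\<lambda>s. x s - y s) S"
  using assms by (intro bdd_meas_diff path_space_bdd_meas)

lemma path_space_diff:
  assumes "x \<in> path_space \<tau>" "y \<in> path_space \<tau>"
  shows "x - y \<in> path_space \<tau>"
  using assms unfolding path_space_def by (auto simp: fun_diff_def intro!: bounded_minus_comp continuous_diff)

text \<open>The segment of \<open>X\<close> at time \<open>t\<close>, normalised to \<open>0\<close>
  outside \<open>{-\<tau>..0}\<close> as \<open>path_space\<close> demands, so that equality of
  segments is equality of functions.\<close>

definition history :: "real \<Rightarrow> (real \<Rightarrow> real^'d) \<Rightarrow> real \<Rightarrow> real \<Rightarrow> real^'d" where
  "history \<tau> X t = (\<lambda>\<theta>. if \<theta> \<in> {-\<tau>..0} then X (t + \<theta>) else 0)"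

text \<open>The delicate time is \<open>t\<close>, where the past and the solution need not meet
  continuously. Right-continuity looks only at later times, and on those \<open>X\<close> is
  continuous.\<close>

lemma history_path_space:
  assumes x: "x \<in> path_space \<tau>" and contX: "continuous_on {t..T} X"
    and pre: "\<And>r. r \<in> {t-\<tau>..<t} \<Longrightarrow> X r = x (r - t)" and s: "t \<le> s" "s \<le> T"
  shows "history \<tau> X s \<in> path_space \<tau>"
proof -
  have right_cont: "\<exists>d>0. \<forall>r'\<in>{r..T}. r' < r + d \<longrightarrow> dist (X r') (X r) < e"
    if r: "r \<in> {t-\<tau>..T}" and "e > 0" for r e
  proof (cases "r < t")
    case True
    have "continuous (at (r - t) within {r-t..0}) x"
      using x r True unfolding path_space_def by auto
    then obtain d where d: "d > 0"
      "\<And>r'. r' \<in> {r-t..0} \<Longrightarrow> dist r' (r - t) < d \<Longrightarrow> dist (x r') (x (r - t)) < e"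
      using \<open>e > 0\<close> unfolding continuous_within_eps_delta by blast
    \<comment> \<open>The bound \<open>t - r\<close> keeps \<open>r'\<close> before
      \<open>t\<close>, where \<open>X\<close> is still the prescribed past.\<close>
    have "dist (X r') (X r) < e" if "r' \<in> {r..T}" "r' < r + min d (t - r)" for r'
      using d(2)[of "r' - t"] that r True pre by (simp add: dist_real_def)
    then show ?thesis
      using d(1) True by (intro exI[of _ "min d (t - r)"]) auto
  next
    case False
    then have "continuous (at r within {t..T}) X"
      using contX r unfolding continuous_on_eq_continuous_within by auto
    then obtain d where "d > 0" "\<And>r'. r' \<in> {t..T} \<Longrightarrow> dist r' r < d \<Longrightarrow> dist (X r') (X r) < e"
      using \<open>e > 0\<close> unfolding continuous_within_eps_delta by blast
    then show ?thesis
      using False by (intro exI[of _ d]) (auto simp: dist_real_def)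
  qed
  have "continuous (at \<theta> within {\<theta>..0}) (history \<tau> X s)" if \<theta>: "\<theta> \<in> {-\<tau>..0}" for \<theta>
    unfolding continuous_within_eps_delta
  proof (intro allI impI)
    fix e :: real assume "e > 0"
    then obtain d where d: "d > 0" "\<And>r'. r' \<in> {s+\<theta>..T} \<Longrightarrow> r' < s + \<theta> + d \<Longrightarrow> dist (X r') (X (s + \<theta>)) < e"
      using right_cont[of "s + \<theta>" e] \<theta> s by auto
    show "\<exists>d>0. \<forall>\<theta>'\<in>{\<theta>..0}. dist \<theta>' \<theta> < d \<longrightarrow> dist (history \<tau> X s \<theta>') (history \<tau> X s \<theta>) < e"
      using d \<theta> s by (intro exI[of _ d]) (auto simp: history_def dist_real_def)
  qed
  moreover have "bounded (history \<tau> X s ` {-\<tau>..0})"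
  proof -
    obtain K where K: "\<And>\<theta>. norm (x \<theta>) \<le> K"
      using path_space_bounded[OF x] by metis
    obtain K' where K': "\<And>r. r \<in> {t..T} \<Longrightarrow> norm (X r) \<le> K'"
      using bdd_meas_bound[OF bdd_meas_continuous[OF contX]] by metis
    have "norm (history \<tau> X s \<theta>) \<le> max K K'" if "\<theta> \<in> {-\<tau>..0}" for \<theta>
      using that s K[of "s + \<theta> - t"] K'[of "s + \<theta>"] pre[of "s + \<theta>"]
      by (cases "s + \<theta> < t") (auto simp: history_def)
    then show ?thesis
      unfolding bounded_iff by blast
  qed
  ultimately show ?thesis
    unfolding path_space_def by (auto simp: history_def)
qed

lemma frozen_shift_eq_history:
  "frozen_shift \<tau> x h = history \<tau> (\<lambda>r. if r < 0 then x r else x 0) h"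
  by (auto simp: frozen_shift_def history_def)

lemma frozen_shift_path_space:
  assumes "x \<in> path_space \<tau>" "h \<ge> 0"
  shows "frozen_shift \<tau> x h \<in> path_space \<tau>"
  unfolding frozen_shift_eq_history using assms
  by (intro history_path_space[of x \<tau> 0 h]) (auto intro: continuous_on_eq[OF continuous_on_const])

text \<open>The shifted path is evaluated at \<open>min (h + \<theta>) 0\<close>, which is never to
  the left of \<open>\<theta>\<close>. The convergence is not uniform in \<open>\<theta>\<close>
  when \<open>x\<close> jumps: shortly before a jump the shift already shows the later
  value.\<close>

lemma frozen_shift_tendsto:
  assumes x: "x \<in> path_space \<tau>" and \<theta>: "\<theta> \<in> {-\<tau>..0}"
  shows "((\<lambda>h. frozen_shift \<tau> x h \<theta>) \<longlongrightarrow> x \<theta>) (at_right 0)"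
  unfolding tendsto_iff
proof (intro allI impI)
  fix e :: real assume "e > 0"
  have "continuous (at \<theta> within {\<theta>..0}) x"
    using x \<theta> unfolding path_space_def by blast
  then obtain d where d: "d > 0" "\<And>r. r \<in> {\<theta>..0} \<Longrightarrow> dist r \<theta> < d \<Longrightarrow> dist (x r) (x \<theta>) < e"
    using \<open>e > 0\<close> unfolding continuous_within_eps_delta by blast
  have "dist (frozen_shift \<tau> x h \<theta>) (x \<theta>) < e" if "0 < h" "h < d" for h
  proof -
    define r where "r = min (h + \<theta>) 0"
    have "frozen_shift \<tau> x h \<theta> = x r"
      using \<theta> by (auto simp: frozen_shift_def r_def)
    moreover have "r \<in> {\<theta>..0}" "dist r \<theta> < d"
      using that \<theta> by (auto simp: r_def dist_real_def)
    ultimately show ?thesis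
      using d(2) by simp
  qed
  then show "\<forall>\<^sub>F h in at_right 0. dist (frozen_shift \<tau> x h \<theta>) (x \<theta>) < e"
    unfolding eventually_at_right_field using d(1) by blast
qed

text \<open>Dominated convergence, with the majorant \<open>(2 * K) ^ k\<close>. The case
  \<open>k = 1\<close> serves the value function and the drift, \<open>k = 2\<close> the norm of
  \<open>H\<close> seen by test functions.\<close>

lemma frozen_shift_integral_tendsto:
  fixes k :: nat
  assumes x: "x \<in> path_space \<tau>" and k: "k > 0"
  shows "((\<lambda>h. integral {-\<tau>..0} (\<lambda>\<theta>. norm (frozen_shift \<tau> x h \<theta> - x \<theta>) ^ k)) \<longlongrightarrow> 0) (at_right 0)"
  unfolding tendsto_at_iff_sequentially
proof (intro allI impI)
  fix h :: "nat \<Rightarrow> real" assume h: "\<forall>i. h i \<in> {0<..} - {0}" "h \<longlonglongrightarrow> 0"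
  obtain K where K: "\<And>\<theta>. norm (x \<theta>) \<le> K"
    using path_space_bounded[OF x] by metis
  define f where "f = (\<lambda>n \<theta>. norm (frozen_shift \<tau> x (h n) \<theta> - x \<theta>) ^ k)"
  have f_le: "norm (f n \<theta>) \<le> (2 * K) ^ k" for n \<theta>
  proof -
    have "norm (frozen_shift \<tau> x (h n) \<theta>) \<le> K"
      using K order_trans[OF norm_ge_zero K] by (auto simp: frozen_shift_def)
    then have "norm (frozen_shift \<tau> x (h n) \<theta> - x \<theta>) \<le> 2 * K"
      using K[of \<theta>] norm_triangle_ineq4[of "frozen_shift \<tau> x (h n) \<theta>" "x \<theta>"] by simp
    then show ?thesis
      unfolding f_def real_norm_def power_abs abs_norm_cancel by (rule power_mono) simp
  qed
  have f_int: "f n integrable_on {-\<tau>..0}" for n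
  proof -
    have "frozen_shift \<tau> x (h n) \<in> path_space \<tau>"
      using h(1) by (intro frozen_shift_path_space[OF x]) (auto simp: less_imp_le)
    then have "bdd_meas (\<lambda>\<theta>. norm (frozen_shift \<tau> x (h n) \<theta> - x \<theta>)) {-\<tau>..0}"
      by (intro bdd_meas_norm bdd_meas_diff path_space_bdd_meas[OF x]
          path_space_bdd_meas)
    then have "f n \<in> borel_measurable (lebesgue_on {-\<tau>..0})"
      unfolding bdd_meas_def f_def by (auto intro: borel_measurable_power)
    then have "bdd_meas (f n) {-\<tau>..0}"
      by (rule bdd_measI) (rule f_le)
    then show ?thesis
      by (rule bdd_meas_integrable) simp
  qed
  have "(\<lambda>n. integral {-\<tau>..0} (f n)) \<longlonglongrightarrow> integral {-\<tau>..0} (\<lambda>_. 0)"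
  proof (rule dominated_convergence(2)[OF f_int _ f_le])
    show "(\<lambda>_. (2 * K) ^ k) integrable_on {-\<tau>..0}"
      by (rule integrable_const_ivl)
    fix \<theta> assume "\<theta> \<in> {-\<tau>..0}"
    then have "((\<lambda>r. frozen_shift \<tau> x r \<theta>) \<circ> h) \<longlonglongrightarrow> x \<theta>"
      using frozen_shift_tendsto[OF x] h unfolding tendsto_at_iff_sequentially by blast
    then have "(\<lambda>n. frozen_shift \<tau> x (h n) \<theta>) \<longlonglongrightarrow> x \<theta>"
      by (simp add: o_def)
    then have "(\<lambda>n. norm (frozen_shift \<tau> x (h n) \<theta> - x \<theta>) ^ k) \<longlonglongrightarrow> norm (x \<theta> - x \<theta>) ^ k"
      by (intro tendsto_intros)
    moreover have "norm (x \<theta> - x \<theta>) ^ k = 0"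
      using k by simp
    ultimately show "(\<lambda>n. f n \<theta>) \<longlonglongrightarrow> 0"
      by (simp only: f_def)
  qed
  then show "((\<lambda>h. integral {-\<tau>..0} (\<lambda>\<theta>. norm (frozen_shift \<tau> x h \<theta> - x \<theta>) ^ k)) \<circ> h) \<longlonglongrightarrow> 0"
    by (simp add: f_def o_def)
qed

subsection \<open>Differential calculus on seminormed spaces\<close>

text \<open>Treats in one calculus the supremum norm on paths and the seminorm of
  \<open>\<real>\<^sup>d \<times> L\<^sup>2\<close> on representatives, where nonzero vectors may be
  null.\<close>

locale seminormed_space =
  fixes E :: "'a::real_vector set" and N :: "'a \<Rightarrow> real"
  assumes subspace: "subspace E"
    and triangle: "\<And>x y. x \<in> E \<Longrightarrow> y \<in> E \<Longrightarrow> N (x + y) \<le> N x + N y"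
    and scale: "\<And>c x. x \<in> E \<Longrightarrow> N (c *\<^sub>R x) = \<bar>c\<bar> * N x"
begin

lemma N_zero: "N 0 = 0"
  using scale[of 0 0] subspace_0[OF subspace] by simp

lemma N_nonneg:
  assumes "x \<in> E"
  shows "N x \<ge> 0"
proof -
  have "- 1 *\<^sub>R x \<in> E"
    using subspace assms by (rule subspace_scale)
  then have "N (x + - 1 *\<^sub>R x) \<le> N x + N (- 1 *\<^sub>R x)"
    by (intro triangle assms)
  then show ?thesis
    using scale[OF assms, of "-1"] N_zero by simp
qed

lemma N_convex_combination:
  assumes "x \<in> E" "y \<in> E" "y' \<in> E" "l \<in> {0..1}" "N (y - x) < d" "N (y' - x) < d"
  shows "N (y + l *\<^sub>R (y' - y) - x) < d"
proof -
  have yx: "y - x \<in> E" "y' - x \<in> E"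
    using assms subspace by (auto intro: subspace_diff)
  have "y + l *\<^sub>R (y' - y) - x = (1 - l) *\<^sub>R (y - x) + l *\<^sub>R (y' - x)"
    by (simp add: algebra_simps)
  then have "N (y + l *\<^sub>R (y' - y) - x) \<le> (1 - l) * N (y - x) + l * N (y' - x)"
    using triangle[of "(1 - l) *\<^sub>R (y - x)" "l *\<^sub>R (y' - x)"] yx assms(4)
    by (simp add: subspace_scale[OF subspace] scale)
  also have "\<dots> < d"
    using convex_bound_lt[OF assms(5,6), of "1 - l" l] assms(4) by simp
  finally show ?thesis .
qed

lemma dual_space_diff:
  assumes "p \<in> dual_space E N" "p' \<in> dual_space E N"
  shows "p - p' \<in> dual_space E N"
proof -
  obtain K K' where "\<forall>x\<in>E. \<bar>p x\<bar> \<le> K * N x" "\<forall>x\<in>E. \<bar>p' x\<bar> \<le> K' * N x"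
    using assms unfolding dual_space_def by blast
  then have "\<forall>x\<in>E. \<bar>p x - p' x\<bar> \<le> (K + K') * N x"
    by (auto simp: distrib_right intro: order_trans[OF abs_triangle_ineq4 add_mono])
  then have "\<exists>K. \<forall>x\<in>E. \<bar>p x - p' x\<bar> \<le> K * N x"
    by blast
  moreover have "\<forall>x\<in>E. \<forall>y\<in>E. p (x + y) - p' (x + y) = (p x - p' x) + (p y - p' y)"
    "\<forall>c. \<forall>x\<in>E. p (c *\<^sub>R x) - p' (c *\<^sub>R x) = c * (p x - p' x)"
    using assms unfolding dual_space_def by (auto simp: right_diff_distrib)
  ultimately show ?thesis
    unfolding dual_space_def minus_apply by blast
qed

text \<open>The supremum in \<open>dual_norm\<close> is a real one, so it bounds something only
  after the set has been shown bounded above. Null vectors cannot be normalised, but boundedness of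
  \<open>p\<close> makes it vanish on them.\<close>

lemma abs_le_dual_norm:
  assumes p: "p \<in> dual_space E N" and y: "y \<in> E"
  shows "\<bar>p y\<bar> \<le> dual_norm E N p * N y"
proof -
  obtain K where K: "\<And>x. x \<in> E \<Longrightarrow> \<bar>p x\<bar> \<le> K * N x"
    using p unfolding dual_space_def by blast
  show ?thesis
  proof (cases "N y = 0")
    case True
    then show ?thesis using K[OF y] by simp
  next
    case False
    then have Ny: "N y > 0" using N_nonneg[OF y] by simp
    define v where "v = (1 / N y) *\<^sub>R y"
    have v: "v \<in> E" "N v = 1"
      unfolding v_def using y Ny by (auto simp: subspace_scale[OF subspace] scale)
    have "bdd_above ((\<lambda>y. \<bar>p y\<bar>) ` {y \<in> E. N y \<le> 1})"
    proof (rule bdd_aboveI2)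
      fix w assume w: "w \<in> {y \<in> E. N y \<le> 1}"
      then have "\<bar>p w\<bar> \<le> \<bar>K\<bar> * N w"
        using K[of w] mult_right_mono[OF abs_ge_self[of K] N_nonneg[of w]] by auto
      also have "\<dots> \<le> \<bar>K\<bar> * 1"
        using w by (intro mult_left_mono) auto
      finally show "\<bar>p w\<bar> \<le> \<bar>K\<bar>" by simp
    qed
    then have "\<bar>p v\<bar> \<le> dual_norm E N p"
      unfolding dual_norm_def using v by (intro cSUP_upper) auto
    moreover have "p v = (1 / N y) * p y"
      using p y unfolding v_def dual_space_def by blast
    ultimately show ?thesis
      using Ny by (simp add: abs_mult divide_simps)
  qed
qed

text \<open>Restriction to a line leads to functions of one real variable, for which the mean value
  theorem and the uniqueness of derivatives are at hand.\<close>

lemma has_gradient_line: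
  assumes grad: "has_gradient E N f p (y + l *\<^sub>R w)" and w: "w \<in> E" and y: "y \<in> E"
  shows "((\<lambda>l. f (y + l *\<^sub>R w)) has_derivative (\<lambda>m. m * p w)) (at l within S)"
  unfolding has_derivative_within_alt
proof (intro conjI allI impI)
  show "bounded_linear (\<lambda>m. m * p w)"
    by (rule bounded_linear_mult_left)
  fix e :: real assume "e > 0"
  \<comment> \<open>The summand \<open>1\<close> keeps \<open>c\<close> positive when
    \<open>w\<close> is a null vector.\<close>
  define c where "c = N w + 1"
  have c: "c > 0" "N w \<le> c"
    using N_nonneg[OF w] unfolding c_def by auto
  obtain d where d: "d > 0"
    "\<And>y'. y' \<in> E \<Longrightarrow> N (y' - (y + l *\<^sub>R w)) < d \<Longrightarrow>
      \<bar>f y' - f (y + l *\<^sub>R w) - p (y' - (y + l *\<^sub>R w))\<bar> \<le> e / c * N (y' - (y + l *\<^sub>R w))"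
    using grad \<open>e > 0\<close> c(1) unfolding has_gradient_def by (metis divide_pos_pos)
  have "norm (f (y + m *\<^sub>R w) - f (y + l *\<^sub>R w) - (m - l) * p w) \<le> e * norm (m - l)"
    if "norm (m - l) < d / c" for m
  proof -
    have diff: "y + m *\<^sub>R w - (y + l *\<^sub>R w) = (m - l) *\<^sub>R w"
      by (simp add: algebra_simps)
    have "N ((m - l) *\<^sub>R w) = \<bar>m - l\<bar> * N w"
      by (rule scale[OF w])
    also have le: "\<dots> \<le> \<bar>m - l\<bar> * c"
      using c by (intro mult_left_mono) auto
    also have "\<dots> < d"
      using that c by (simp add: pos_less_divide_eq)
    finally have "N ((m - l) *\<^sub>R w) < d" .
    moreover have "y + m *\<^sub>R w \<in> E"
      using y w subspace by (auto intro: subspace_add subspace_scale)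
    ultimately have "\<bar>f (y + m *\<^sub>R w) - f (y + l *\<^sub>R w) - p ((m - l) *\<^sub>R w)\<bar> \<le> e / c * N ((m - l) *\<^sub>R w)"
      using d(2)[of "y + m *\<^sub>R w"] unfolding diff by blast
    also have "\<dots> \<le> e / c * (\<bar>m - l\<bar> * c)"
      using le \<open>e > 0\<close> c(1) scale[OF w] by (intro mult_left_mono) auto
    also have "\<dots> = e * \<bar>m - l\<bar>"
      using c by simp
    also have "p ((m - l) *\<^sub>R w) = (m - l) * p w"
      using grad w unfolding has_gradient_def dual_space_def by blast
    finally show ?thesis by simp
  qed
  then show "\<exists>d>0. \<forall>m\<in>S. norm (m - l) < d \<longrightarrow>
      norm (f (y + m *\<^sub>R w) - f (y + l *\<^sub>R w) - (m - l) * p w) \<le> e * norm (m - l)"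
    using d(1) c(1) by (intro exI[of _ "d / c"]) auto
qed

lemma C1_space_has_gradient:
  assumes "g \<in> C1_space T E N" "t \<in> {0..T}" "x \<in> E"
  shows "has_gradient E N (g t) (gradient E N (g t) x) x"
proof -
  have "\<exists>p. has_gradient E N (g t) p x"
    using assms unfolding C1_space_def by blast
  then show ?thesis
    unfolding gradient_def by (rule someI_ex)
qed

lemma C1_space_gradient_dual:
  assumes "g \<in> C1_space T E N" "t \<in> {0..T}" "x \<in> E"
  shows "gradient E N (g t) x \<in> dual_space E N"
  using C1_space_has_gradient[OF assms] unfolding has_gradient_def by blast

text \<open>Mean value theorem on the segment from \<open>y\<close> to \<open>y'\<close>, along
  which the gradient is \<open>e\<close>-close in the dual norm to the gradient at \<open>x\<close>.
  Balls are convex, so the segment stays near \<open>x\<close>.\<close>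

lemma C1_space_strict_gradient:
  assumes g: "g \<in> C1_space T E N" and t: "t \<in> {0..T}" and x: "x \<in> E" and "e > 0"
  obtains d where "d > 0"
    "\<And>s y y'. s \<in> {0..T} \<Longrightarrow> y \<in> E \<Longrightarrow> y' \<in> E \<Longrightarrow> \<bar>s - t\<bar> < d \<Longrightarrow> N (y - x) < d \<Longrightarrow> N (y' - x) < d \<Longrightarrow>
      \<bar>g s y' - g s y - gradient E N (g t) x (y' - y)\<bar> \<le> e * N (y' - y)"
proof -
  define p where "p = gradient E N (g t) x"
  obtain d where d: "d > 0"
    "\<And>s y. s \<in> {0..T} \<Longrightarrow> y \<in> E \<Longrightarrow> \<bar>s - t\<bar> < d \<Longrightarrow> N (y - x) < d \<Longrightarrow>
      dual_norm E N (gradient E N (g s) y - p) < e"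
    using g t x \<open>e > 0\<close> unfolding C1_space_def continuous_wrt_def p_def by blast
  show ?thesis
  proof (rule that[OF d(1)])
    fix s y y'
    assume s: "s \<in> {0..T}" and y: "y \<in> E" and y': "y' \<in> E" and st: "\<bar>s - t\<bar> < d"
      and yx: "N (y - x) < d" and y'x: "N (y' - x) < d"
    define w where "w = y' - y"
    define z where "z = (\<lambda>l. y + l *\<^sub>R w)"
    have w: "w \<in> E"
      unfolding w_def using y' y subspace by (rule_tac subspace_diff)
    have z: "z l \<in> E" for l
      unfolding z_def using y w subspace by (auto intro: subspace_add subspace_scale)
    have "\<exists>l\<in>{0<..<1::real}. g s (z 1) - g s (z 0) = (1 - 0) * gradient E N (g s) (z l) w"
    proof (rule mvt_simple)
      show "((\<lambda>l. g s (z l)) has_derivative (\<lambda>m. m * gradient E N (g s) (z l) w)) (at l within {0..1})"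
        if "0 \<le> l" "l \<le> 1" for l
        using has_gradient_line[OF C1_space_has_gradient[OF g s z[unfolded z_def]] w y]
        unfolding z_def .
    qed simp
    then obtain l where l: "l \<in> {0<..<1}" "g s y' - g s y = gradient E N (g s) (z l) w"
      unfolding z_def w_def by auto
    have "N (z l - x) < d"
      unfolding z_def w_def using l by (intro N_convex_combination x y y' yx y'x) auto
    then have "dual_norm E N (gradient E N (g s) (z l) - p) < e"
      by (intro d(2) s z st)
    moreover have "\<bar>(gradient E N (g s) (z l) - p) w\<bar> \<le> dual_norm E N (gradient E N (g s) (z l) - p) * N w"
      unfolding p_def
      by (intro abs_le_dual_norm dual_space_diff C1_space_gradient_dual[OF g] s t z x w)
    moreover have "dual_norm E N (gradient E N (g s) (z l) - p) * N w \<le> e * N w"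
      using calculation(1) N_nonneg[OF w] by (intro mult_right_mono) auto
    ultimately have "\<bar>gradient E N (g s) (z l) w - p w\<bar> \<le> e * N w"
      by simp
    then show "\<bar>g s y' - g s y - gradient E N (g t) x (y' - y)\<bar> \<le> e * N (y' - y)"
      unfolding l(2) p_def w_def .
  qed
qed

text \<open>Mean value theorem in time at a fixed \<open>y\<close>. The time increment can thus be
  taken at a displaced path, and the joint continuity of the time derivative pays for the
  displacement.\<close>

lemma C1_space_strict_time_deriv:
  assumes g: "g \<in> C1_space T E N" and t: "t \<in> {0..T}" and x: "x \<in> E" and "e > 0"
  obtains d where "d > 0"
    "\<And>s y. s \<in> {t<..T} \<Longrightarrow> y \<in> E \<Longrightarrow> s - t < d \<Longrightarrow> N (y - x) < d \<Longrightarrow>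
      \<bar>g s y - g t y - (s - t) * time_deriv T g t x\<bar> \<le> e * (s - t)"
proof -
  obtain d where d: "d > 0"
    "\<And>s y. s \<in> {0..T} \<Longrightarrow> y \<in> E \<Longrightarrow> \<bar>s - t\<bar> < d \<Longrightarrow> N (y - x) < d \<Longrightarrow>
      dist (time_deriv T g s y) (time_deriv T g t x) < e"
  proof -
    have "continuous_wrt dist T E N (time_deriv T g)"
      using g unfolding C1_space_def C0_space_def by blast
    then show ?thesis
      using that t x \<open>e > 0\<close> unfolding continuous_wrt_def by blast
  qed
  show ?thesis
  proof (rule that[OF d(1)])
    fix s y
    assume s: "s \<in> {t<..T}" and y: "y \<in> E" and st: "s - t < d" and yx: "N (y - x) < d"
    have "\<exists>r\<in>{t<..<s}. g s y - g t y = (s - t) * time_deriv T g r y"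
    proof (rule mvt_simple)
      fix r assume r: "t \<le> r" "r \<le> s"
      then have "(\<lambda>s. g s y) differentiable (at r within {0..T})"
        using g y s t unfolding C1_space_def by auto
      then have "((\<lambda>s. g s y) has_vector_derivative time_deriv T g r y) (at r within {0..T})"
        unfolding time_deriv_def by (simp add: vector_derivative_works)
      then have "((\<lambda>s. g s y) has_vector_derivative time_deriv T g r y) (at r within {t..s})"
        by (rule has_vector_derivative_within_subset) (use s t in auto)
      then show "((\<lambda>s. g s y) has_derivative (\<lambda>h. h * time_deriv T g r y)) (at r within {t..s})"
        unfolding has_vector_derivative_def by simp
    qed (use s in auto)
    then obtain r where r: "r \<in> {t<..<s}" "g s y - g t y = (s - t) * time_deriv T g r y"
      by blast
    have "dist (time_deriv T g r y) (time_deriv T g t x) < e"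
      using r s t st by (intro d(2) y yx) auto
    then have "(s - t) * \<bar>time_deriv T g r y - time_deriv T g t x\<bar> \<le> (s - t) * e"
      using s by (intro mult_left_mono) (auto simp: dist_real_def)
    then show "\<bar>g s y - g t y - (s - t) * time_deriv T g t x\<bar> \<le> e * (s - t)"
      unfolding r(2) right_diff_distrib[symmetric] abs_mult using s by (simp add: mult.commute)
  qed
qed

end

subsection \<open>The space \<open>\<real>\<^sup>d \<times> L\<^sup>2\<close>\<close>

definition norm_RH :: "real \<Rightarrow> (real^'d) \<times> (real \<Rightarrow> real^'d) \<Rightarrow> real" where
  "norm_RH \<tau> = (\<lambda>(v, f). norm v + norm_H \<tau> f)"

lemma inner_H_self: "inner_H \<tau> f f = (LINT \<theta>|lebesgue_on {-\<tau>..0}. (norm (f \<theta>))\<^sup>2)"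
  unfolding inner_H_def by (simp add: power2_norm_eq_inner)

lemma inner_H_self_nonneg: "inner_H \<tau> f f \<ge> 0"
  unfolding inner_H_self by simp

lemma L2_space_add:
  assumes f: "f \<in> L2_space S" and g: "g \<in> L2_space S"
  shows "f + g \<in> L2_space S"
proof -
  have "f \<in> borel_measurable (lebesgue_on S)" "g \<in> borel_measurable (lebesgue_on S)"
    using f g unfolding L2_space_def by blast+
  then have meas [measurable]: "f + g \<in> borel_measurable (lebesgue_on S)"
    unfolding plus_fun_def by (rule borel_measurable_add)
  have "integrable (lebesgue_on S) (\<lambda>s. 2 * (norm (f s))\<^sup>2 + 2 * (norm (g s))\<^sup>2)"
    using f g unfolding L2_space_def by auto
  moreover have "(\<lambda>s. (norm ((f + g) s))\<^sup>2) \<in> borel_measurable (lebesgue_on S)"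
    by measurable
  moreover have "norm ((norm ((f + g) s))\<^sup>2) \<le> norm (2 * (norm (f s))\<^sup>2 + 2 * (norm (g s))\<^sup>2)" for s
  proof -
    have "(norm ((f + g) s))\<^sup>2 \<le> (norm (f s) + norm (g s))\<^sup>2"
      by (intro power_mono) (auto intro: norm_triangle_ineq)
    also have "\<dots> \<le> 2 * (norm (f s))\<^sup>2 + 2 * (norm (g s))\<^sup>2"
      using zero_le_power2[of "norm (f s) - norm (g s)"] by (simp add: power2_eq_square algebra_simps)
    finally show ?thesis by simp
  qed
  ultimately have "integrable (lebesgue_on S) (\<lambda>s. (norm ((f + g) s))\<^sup>2)"
    by (rule Bochner_Integration.integrable_bound[OF _ _ AE_I2])
  then show ?thesis
    using meas unfolding L2_space_def by blast
qed

lemma L2_space_scaleR: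
  assumes "f \<in> L2_space S"
  shows "c *\<^sub>R f \<in> L2_space S"
proof -
  have "(\<lambda>s. c *\<^sub>R f s) \<in> borel_measurable (lebesgue_on S)"
    using assms unfolding L2_space_def by (intro borel_measurable_scaleR) auto
  moreover have "integrable (lebesgue_on S) (\<lambda>s. c\<^sup>2 * (norm (f s))\<^sup>2)"
    using assms unfolding L2_space_def by (intro integrable_mult_right) blast
  ultimately show ?thesis
    unfolding L2_space_def scaleR_fun_def by (simp add: power_mult_distrib)
qed

lemma norm_H_scaleR: "norm_H \<tau> (c *\<^sub>R f) = \<bar>c\<bar> * norm_H \<tau> f"
proof -
  have "inner_H \<tau> (c *\<^sub>R f) (c *\<^sub>R f) = c\<^sup>2 * inner_H \<tau> f f"
    unfolding inner_H_self scaleR_fun_def norm_scaleR power_mult_distrib power2_abs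
    by (rule integral_mult_right_zero)
  then show ?thesis
    unfolding norm_H_def by (simp add: real_sqrt_mult)
qed

text \<open>Minkowski's inequality, from \<open>\<bar>v + w\<bar>\<^sup>2 \<le> (1 + b/a) \<bar>v\<bar>\<^sup>2 + (1 + a/b) \<bar>w\<bar>\<^sup>2\<close> with
  \<open>a\<close>, \<open>b\<close> decreasing to the norms of the summands.\<close>

lemma norm_H_triangle:
  assumes f: "f \<in> L2_space {-\<tau>..0}" and g: "g \<in> L2_space {-\<tau>..0}"
  shows "norm_H \<tau> (f + g) \<le> norm_H \<tau> f + norm_H \<tau> g"
proof (rule field_le_epsilon)
  fix e :: real assume "e > 0"
  define a b where "a = norm_H \<tau> f + e / 2" and "b = norm_H \<tau> g + e / 2"
  have nn: "norm_H \<tau> h \<ge> 0" for h :: "real \<Rightarrow> real^'a"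
    unfolding norm_H_def by (simp add: inner_H_self_nonneg)
  then have pos: "a > 0" "b > 0"
    unfolding a_def b_def using \<open>e > 0\<close> by (auto intro: add_nonneg_pos)
  have "inner_H \<tau> f f = (norm_H \<tau> f)\<^sup>2" "inner_H \<tau> g g = (norm_H \<tau> g)\<^sup>2"
    unfolding norm_H_def by (simp_all add: inner_H_self_nonneg)
  then have le: "inner_H \<tau> f f \<le> a\<^sup>2" "inner_H \<tau> g g \<le> b\<^sup>2"
    unfolding a_def b_def using nn \<open>e > 0\<close> by (auto intro!: power_mono)
  note int_f = f[unfolded L2_space_def] and int_g = g[unfolded L2_space_def]
  have pw: "(norm ((f + g) \<theta>))\<^sup>2 \<le> (1 + b / a) * (norm (f \<theta>))\<^sup>2 + (1 + a / b) * (norm (g \<theta>))\<^sup>2" for \<theta>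
  proof -
    have "(norm ((f + g) \<theta>))\<^sup>2 \<le> (norm (f \<theta>) + norm (g \<theta>))\<^sup>2"
      by (intro power_mono) (auto intro: norm_triangle_ineq)
    also have "\<dots> = (1 + b / a) * (norm (f \<theta>))\<^sup>2 + (1 + a / b) * (norm (g \<theta>))\<^sup>2
        - (b * norm (f \<theta>) - a * norm (g \<theta>))\<^sup>2 / (a * b)"
      using pos by (simp add: power2_eq_square field_simps)
    also have "\<dots> \<le> (1 + b / a) * (norm (f \<theta>))\<^sup>2 + (1 + a / b) * (norm (g \<theta>))\<^sup>2"
      using pos by simp
    finally show ?thesis .
  qed
  have "inner_H \<tau> (f + g) (f + g)
      \<le> (LINT \<theta>|lebesgue_on {-\<tau>..0}. (1 + b / a) * (norm (f \<theta>))\<^sup>2 + (1 + a / b) * (norm (g \<theta>))\<^sup>2)"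
    unfolding inner_H_self using int_f int_g L2_space_add[OF f g] pw
    by (intro Bochner_Integration.integral_mono) (auto simp: L2_space_def)
  also have "\<dots> = (1 + b / a) * inner_H \<tau> f f + (1 + a / b) * inner_H \<tau> g g"
    unfolding inner_H_self using int_f int_g by (subst Bochner_Integration.integral_add) auto
  also have "\<dots> \<le> (1 + b / a) * a\<^sup>2 + (1 + a / b) * b\<^sup>2"
    using le pos by (intro add_mono mult_left_mono) auto
  also have "\<dots> = (a + b)\<^sup>2"
    using pos by (simp add: power2_eq_square field_simps)
  finally have "norm_H \<tau> (f + g) \<le> a + b"
    unfolding norm_H_def using pos by (intro real_le_lsqrt) auto
  then show "norm_H \<tau> (f + g) \<le> norm_H \<tau> f + norm_H \<tau> g + e"
    unfolding a_def b_def by simp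
qed

lemma seminormed_space_RH:
  "seminormed_space (UNIV \<times> L2_space {-\<tau>..0}) (norm_RH \<tau> :: (real^'d) \<times> (real \<Rightarrow> real^'d) \<Rightarrow> real)"
proof
  have "0 \<in> (L2_space {-\<tau>..0} :: (real \<Rightarrow> real^'d) set)"
    unfolding L2_space_def zero_fun_def by simp
  then show "subspace (UNIV \<times> L2_space {-\<tau>..0} :: ((real^'d) \<times> (real \<Rightarrow> real^'d)) set)"
    unfolding subspace_def by (auto simp: zero_prod_def intro: L2_space_add L2_space_scaleR)
  show "norm_RH \<tau> (x + y) \<le> norm_RH \<tau> x + norm_RH \<tau> y"
    if "x \<in> UNIV \<times> L2_space {-\<tau>..0}" "y \<in> UNIV \<times> L2_space {-\<tau>..0}"
    for x y :: "(real^'d) \<times> (real \<Rightarrow> real^'d)"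
    using that norm_triangle_ineq[of "fst x" "fst y"] norm_H_triangle[of "snd x" \<tau> "snd y"]
    by (auto simp: norm_RH_def split: prod.splits)
  show "norm_RH \<tau> (c *\<^sub>R x) = \<bar>c\<bar> * norm_RH \<tau> x" for c and x :: "(real^'d) \<times> (real \<Rightarrow> real^'d)"
    by (cases x) (simp add: norm_RH_def norm_H_scaleR distrib_left)
qed

lemma norm_H_eq_integral:
  assumes "x \<in> path_space \<tau>"
  shows "norm_H \<tau> x = sqrt (integral {-\<tau>..0} (\<lambda>\<theta>. (norm (x \<theta>))\<^sup>2))"
    and "x \<in> L2_space {-\<tau>..0}"
    and "(\<lambda>\<theta>. (norm (x \<theta>))\<^sup>2) integrable_on {a..b}"
proof -
  obtain K where K: "\<And>\<theta>. norm (x \<theta>) \<le> K"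
    using path_space_bounded[OF assms] by metis
  note x = path_space_bdd_meas[OF assms]
  have bm: "bdd_meas (\<lambda>\<theta>. (norm (x \<theta>))\<^sup>2) S" for S
    using x[of S] K unfolding bdd_meas_def
    by (intro conjI borel_measurable_power borel_measurable_norm) (auto simp: bounded_iff intro!: exI[of _ "K\<^sup>2"] power_mono)
  show "norm_H \<tau> x = sqrt (integral {-\<tau>..0} (\<lambda>\<theta>. (norm (x \<theta>))\<^sup>2))"
    unfolding norm_H_def inner_H_self bdd_meas_lebesgue_integral[OF bm] ..
  show "x \<in> L2_space {-\<tau>..0}"
    unfolding L2_space_def using x[of "{-\<tau>..0}"] bdd_meas_integrable_lebesgue[OF bm, of "-\<tau>" 0]
    by (auto simp: bdd_meas_def)
  show "(\<lambda>\<theta>. (norm (x \<theta>))\<^sup>2) integrable_on {a..b}"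
    by (rule bdd_meas_integrable[OF bm order_refl])
qed

text \<open>The jump sits at the right end, where right-continuity demands nothing; from an earlier
  \<open>\<theta>\<close> the function vanishes up to distance \<open>- \<theta>\<close>.\<close>

lemma jump_at_0_path_space:
  assumes "\<tau> > 0"
  shows "jump_at_0 v \<in> path_space \<tau>"
proof -
  have "continuous (at \<theta> within {\<theta>..0}) (jump_at_0 v)" if "\<theta> \<in> {-\<tau>..0}" for \<theta>
  proof (cases "\<theta> = 0")
    case False
    have "\<forall>\<^sub>F r in at \<theta> within {\<theta>..0}. jump_at_0 v r = 0"
      unfolding eventually_at using False that
      by (intro exI[of _ "- \<theta>"]) (auto simp: jump_at_0_def dist_real_def)
    then show ?thesis
      unfolding continuous_within using False
      by (simp add: jump_at_0_def tendsto_eventually)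
  qed (auto simp: continuous_within_eps_delta)
  moreover have "bounded (jump_at_0 v ` {-\<tau>..0})"
    by (rule finite_imp_bounded, rule finite_subset[of _ "{0, v}"]) (auto simp: jump_at_0_def)
  ultimately show ?thesis
    unfolding path_space_def using assms by (auto simp: jump_at_0_def)
qed

text \<open>This is why only the \<open>\<real>\<^sup>d\<close> component of a test function reacts
  to the direction \<open>jump_at_0 v\<close>.\<close>

lemma norm_H_jump_at_0:
  assumes "\<tau> > 0"
  shows "norm_H \<tau> (jump_at_0 v) = 0"
proof -
  have "integral {-\<tau>..0} (\<lambda>\<theta>. (norm (jump_at_0 v \<theta>))\<^sup>2) = integral {-\<tau>..0} (\<lambda>\<theta>. 0 :: real)"
    by (rule integral_spike[of "{0}"]) (auto simp: jump_at_0_def)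
  then show ?thesis
    unfolding norm_H_eq_integral(1)[OF jump_at_0_path_space[OF assms]] by simp
qed

lemma seminormed_space_path_space:
  assumes "\<tau> > 0"
  shows "seminormed_space (path_space \<tau>) (sup_norm \<tau> :: (real \<Rightarrow> real^'d) \<Rightarrow> real)"
proof
  show sub: "subspace (path_space \<tau> :: (real \<Rightarrow> real^'d) set)"
    unfolding subspace_def path_space_def scaleR_fun_def plus_fun_def zero_fun_def
    by (auto simp: image_constant_conv intro!: continuous_add continuous_scaleR bounded_plus_comp bounded_scaleR_comp)
  have sup_le: "sup_norm \<tau> x \<le> C" if "\<And>\<theta>. \<theta> \<in> {-\<tau>..0} \<Longrightarrow> norm (x \<theta>) \<le> C" for x :: "real \<Rightarrow> real^'d" and C
    unfolding sup_norm_def using assms that by (intro cSUP_least) auto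
  show "sup_norm \<tau> (x + y) \<le> sup_norm \<tau> x + sup_norm \<tau> y"
    if "x \<in> path_space \<tau>" "y \<in> path_space \<tau>" for x y :: "real \<Rightarrow> real^'d"
    using that by (intro sup_le) (auto intro!: norm_triangle_mono norm_le_sup_norm)
  show "sup_norm \<tau> (c *\<^sub>R x) = \<bar>c\<bar> * sup_norm \<tau> x" if x: "x \<in> path_space \<tau>" for c and x :: "real \<Rightarrow> real^'d"
  proof -
    have le: "sup_norm \<tau> (c *\<^sub>R x) \<le> \<bar>c\<bar> * sup_norm \<tau> x"
      if "x \<in> path_space \<tau>" for c and x :: "real \<Rightarrow> real^'d"
      using that by (intro sup_le) (auto simp: scaleR_fun_def intro!: mult_left_mono norm_le_sup_norm)
    show ?thesis
    proof (cases "c = 0")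
      case True
      then show ?thesis
        using assms by (simp add: sup_norm_def scaleR_fun_def)
    next
      case False
      \<comment> \<open>The reverse inequality is the proved one for the factor \<open>1 / c\<close>
        and the path \<open>c *\<^sub>R x\<close>.\<close>
      have "sup_norm \<tau> ((1 / c) *\<^sub>R (c *\<^sub>R x)) \<le> \<bar>1 / c\<bar> * sup_norm \<tau> (c *\<^sub>R x)"
        by (intro le subspace_scale[OF sub] x)
      then show ?thesis
        using le[OF x, of c] False by (simp add: field_simps)
    qed
  qed
qed

subsection \<open>Trajectories of the state equation\<close>

text \<open>One constant \<open>L\<close> serves all coefficients: growth and Lipschitz constant of
  \<open>F\<close>, a bound of \<open>a\<close>, an operator bound of \<open>b\<close>. The Sobolev
  conditions are turned into continuity and bounds when the locale is interpreted.\<close>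

locale delay_system =
  fixes T \<tau> L :: real
    and F :: "real \<Rightarrow> (real^'d) \<times> real \<Rightarrow> 'u::metric_space \<Rightarrow> real^'d"
    and a :: "real \<Rightarrow> real^'d"
    and b :: "real \<Rightarrow> real^'d^'d"
  assumes T_pos: "T > 0" and tau_pos: "\<tau> > 0" and L_pos: "L > 0"
    and F_measurable: "(\<lambda>(t, x, u). F t x u) \<in>
       borel_measurable (restrict_space borel {0..T} \<Otimes>\<^sub>M borel \<Otimes>\<^sub>M borel)"
    and F_growth: "\<And>t x u. t \<in> {0..T} \<Longrightarrow> norm (F t x u) \<le> L * (1 + norm x)"
    and F_lipschitz: "\<And>t s x y u. t \<in> {0..T} \<Longrightarrow> s \<in> {0..T} \<Longrightarrow>
       norm (F t x u - F s y u) \<le> L * (\<bar>s - t\<bar> + norm (x - y))"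
    and a_continuous: "continuous_on {-\<tau>..0} a"
    and a_bound: "\<And>\<theta>. \<theta> \<in> {-\<tau>..0} \<Longrightarrow> norm (a \<theta>) \<le> L"
    and b_continuous: "continuous_on {0..T} b"
    and b_bound: "\<And>t y. t \<in> {0..T} \<Longrightarrow> norm (b t *v y) \<le> L * norm y"
begin

section \<open>Measurability and boundedness of the drift\<close>

definition drift :: "(real \<Rightarrow> 'u) \<Rightarrow> (real \<Rightarrow> real^'d) \<Rightarrow> real \<Rightarrow> real^'d" where
  "drift u X \<sigma> = F \<sigma> (X \<sigma>, inner_H \<tau> a (\<lambda>\<theta>. X (\<sigma> + \<theta>))) (u \<sigma>) + b \<sigma> *v X (\<sigma> - \<tau>)"

text \<open>Since \<open>a\<close> is bounded, the distributed delay is Lipschitz for the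
  \<open>L\<^sup>1\<close> norm, whereas Cauchy-Schwarz in \<open>H\<close> would give the
  \<open>L\<^sup>2\<close> norm. This is one source of the weak norm in the stability
  estimate.\<close>

lemma inner_H_diff_le:
  assumes "bdd_meas f {-\<tau>..0}" "bdd_meas g {-\<tau>..0}"
  shows "\<bar>inner_H \<tau> a f - inner_H \<tau> a g\<bar> \<le> L * integral {-\<tau>..0} (\<lambda>\<theta>. norm (f \<theta> - g \<theta>))"
proof -
  have bm: "bdd_meas (\<lambda>\<theta>. a \<theta> \<bullet> h \<theta>) {-\<tau>..0}" if h: "bdd_meas h {-\<tau>..0}" for h
  proof -
    obtain K where K: "\<And>\<theta>. \<theta> \<in> {-\<tau>..0} \<Longrightarrow> norm (h \<theta>) \<le> K"
      using bdd_meas_bound[OF h] by blast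
    show ?thesis
    proof (rule bdd_measI[of _ _ "L * K"])
      show "(\<lambda>\<theta>. a \<theta> \<bullet> h \<theta>) \<in> borel_measurable (lebesgue_on {-\<tau>..0})"
        using h bdd_meas_continuous[OF a_continuous]
        unfolding bdd_meas_def by (auto intro: borel_measurable_inner)
      show "norm (a \<theta> \<bullet> h \<theta>) \<le> L * K" if "\<theta> \<in> {-\<tau>..0}" for \<theta>
      proof -
        have "norm (a \<theta> \<bullet> h \<theta>) \<le> norm (a \<theta>) * norm (h \<theta>)"
          by (simp add: Cauchy_Schwarz_ineq2)
        also have "\<dots> \<le> L * K"
          using a_bound[OF that] K[OF that] L_pos by (intro mult_mono) auto
        finally show ?thesis .
      qed
    qed
  qed
  have int: "(\<lambda>\<theta>. a \<theta> \<bullet> f \<theta>) integrable_on {-\<tau>..0}" "(\<lambda>\<theta>. a \<theta> \<bullet> g \<theta>) integrable_on {-\<tau>..0}"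
    using bm[OF assms(1)] bm[OF assms(2)] by (auto intro: bdd_meas_integrable)
  have "inner_H \<tau> a f - inner_H \<tau> a g = integral {-\<tau>..0} (\<lambda>\<theta>. a \<theta> \<bullet> f \<theta> - a \<theta> \<bullet> g \<theta>)"
    unfolding inner_H_def bdd_meas_lebesgue_integral[OF bm[OF assms(1)]]
      bdd_meas_lebesgue_integral[OF bm[OF assms(2)]]
    using int by (simp add: integral_diff)
  moreover have "norm (integral {-\<tau>..0} (\<lambda>\<theta>. a \<theta> \<bullet> f \<theta> - a \<theta> \<bullet> g \<theta>))
      \<le> integral {-\<tau>..0} (\<lambda>\<theta>. L * norm (f \<theta> - g \<theta>))"
  proof (rule integral_norm_bound_integral)
    show "(\<lambda>\<theta>. a \<theta> \<bullet> f \<theta> - a \<theta> \<bullet> g \<theta>) integrable_on {-\<tau>..0}"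
      using int by (intro integrable_diff)
    show "(\<lambda>\<theta>. L * norm (f \<theta> - g \<theta>)) integrable_on {-\<tau>..0}"
      using bdd_meas_integrable[OF bdd_meas_norm[OF bdd_meas_diff[OF assms]] order_refl]
      by (rule integrable_on_mult_right)
    show "norm (a \<theta> \<bullet> f \<theta> - a \<theta> \<bullet> g \<theta>) \<le> L * norm (f \<theta> - g \<theta>)" if "\<theta> \<in> {-\<tau>..0}" for \<theta>
    proof -
      have "norm (a \<theta> \<bullet> f \<theta> - a \<theta> \<bullet> g \<theta>) \<le> norm (a \<theta>) * norm (f \<theta> - g \<theta>)"
        unfolding inner_diff_right[symmetric] by (simp add: Cauchy_Schwarz_ineq2)
      also have "\<dots> \<le> L * norm (f \<theta> - g \<theta>)"
        using a_bound[OF that] by (intro mult_right_mono) auto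
      finally show ?thesis .
    qed
  qed
  ultimately show ?thesis
    by simp
qed

lemma inner_H_le:
  assumes "bdd_meas f {-\<tau>..0}"
  shows "\<bar>inner_H \<tau> a f\<bar> \<le> L * integral {-\<tau>..0} (\<lambda>\<theta>. norm (f \<theta>))"
  using inner_H_diff_le[OF assms, of "\<lambda>_. 0"] by (simp add: inner_H_def)

lemma segment_borel:
  fixes X :: "real \<Rightarrow> 'a::euclidean_space"
  assumes [measurable]: "X \<in> borel_measurable borel"
  shows "(\<lambda>\<theta>. X (\<sigma> + \<theta>)) \<in> borel_measurable borel"
  by measurable

lemma segment_bdd_meas:
  fixes X :: "real \<Rightarrow> 'a::euclidean_space"
  assumes "X \<in> borel_measurable borel" "bounded (range X)"
  shows "bdd_meas (\<lambda>\<theta>. X (\<sigma> + \<theta>)) S"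
proof -
  obtain K where "\<And>s. norm (X s) \<le> K"
    using assms(2) unfolding bounded_iff by auto
  then show ?thesis
    using segment_borel[OF assms(1)] by (intro bdd_meas_borel) auto
qed

text \<open>Measurability of a parameter integral comes from the Fubini theory of
  \<open>lborel\<close>. Hence \<open>a\<close> is cut off to a Borel function \<open>a'\<close> on
  the line and the completion is removed, which leaves the integral of a Borel function
  unchanged.\<close>

lemma inner_H_segment_borel:
  assumes [measurable]: "X \<in> borel_measurable borel"
  shows "(\<lambda>\<sigma>. inner_H \<tau> a (\<lambda>\<theta>. X (\<sigma> + \<theta>))) \<in> borel_measurable borel"
proof -
  define a' where "a' = (\<lambda>\<theta>. indicator {-\<tau>..0} \<theta> *\<^sub>R a \<theta>)"
  have [measurable]: "a' \<in> borel_measurable borel"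
    unfolding a'_def by (rule borel_measurable_continuous_on_indicator[OF _ a_continuous]) simp
  have "inner_H \<tau> a (\<lambda>\<theta>. X (\<sigma> + \<theta>)) = (LINT \<theta>|lborel. a' \<theta> \<bullet> X (\<sigma> + \<theta>))" for \<sigma>
  proof -
    have "inner_H \<tau> a (\<lambda>\<theta>. X (\<sigma> + \<theta>)) = (LINT \<theta>|lebesgue. a' \<theta> \<bullet> X (\<sigma> + \<theta>))"
      unfolding inner_H_def a'_def by (simp add: integral_restrict_space)
    also have "\<dots> = (LINT \<theta>|lborel. a' \<theta> \<bullet> X (\<sigma> + \<theta>))"
      by (rule integral_completion) measurable
    finally show ?thesis .
  qed
  moreover have "(\<lambda>\<sigma>. LINT \<theta>|lborel. a' \<theta> \<bullet> X (\<sigma> + \<theta>)) \<in> borel_measurable borel"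
    by (rule lborel.borel_measurable_lebesgue_integral) measurable
  ultimately show ?thesis
    by simp
qed

lemma borel_measurable_lebesgue_on:
  fixes f :: "real \<Rightarrow> 'a::euclidean_space"
  assumes "f \<in> borel_measurable borel"
  shows "f \<in> borel_measurable (lebesgue_on S)"
  using assms by (intro measurable_restrict_space1) (simp add: measurable_completion)

lemma drift_F_bdd_meas:
  assumes X: "X \<in> borel_measurable borel" "bounded (range X)"
    and u: "u \<in> controls t T" and t: "0 \<le> t"
  shows "bdd_meas (\<lambda>\<sigma>. F \<sigma> (X \<sigma>, inner_H \<tau> a (\<lambda>\<theta>. X (\<sigma> + \<theta>))) (u \<sigma>)) {t..T}"
proof -
  obtain K where K: "\<And>s. norm (X s) \<le> K"
    using X(2) unfolding bounded_iff by auto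
  have sub: "{t..T} \<subseteq> {0..T}" using t by auto
  show ?thesis
  \<comment> \<open>\<open>K\<close> bounds \<open>X\<close>, and \<open>L * (K * \<tau>)\<close>
    bounds the distributed delay; the linear growth of \<open>F\<close> is applied to their
    sum.\<close>
  proof (rule bdd_measI[of _ _ "L * (1 + (K + L * (K * \<tau>)))"])
    have 1: "(\<lambda>\<sigma>. \<sigma>) \<in> measurable (lebesgue_on {t..T}) (restrict_space borel {0..T})"
      using sub by (intro measurable_restrict_space2 borel_measurable_lebesgue_on) auto
    have "(\<lambda>\<sigma>. (X \<sigma>, inner_H \<tau> a (\<lambda>\<theta>. X (\<sigma> + \<theta>)))) \<in> borel_measurable borel"
      using X(1) inner_H_segment_borel[OF X(1)] by (rule borel_measurable_Pair)
    then have 2: "(\<lambda>\<sigma>. (X \<sigma>, inner_H \<tau> a (\<lambda>\<theta>. X (\<sigma> + \<theta>)))) \<in> borel_measurable (lebesgue_on {t..T})"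
      by (rule borel_measurable_lebesgue_on)
    have 3: "u \<in> measurable (lebesgue_on {t..T}) borel"
      using u unfolding controls_def .
    have "(\<lambda>\<sigma>. (\<lambda>(t, x, u). F t x u) (\<sigma>, (X \<sigma>, inner_H \<tau> a (\<lambda>\<theta>. X (\<sigma> + \<theta>))), u \<sigma>))
        \<in> borel_measurable (lebesgue_on {t..T})"
      by (rule measurable_compose[OF _ F_measurable]) (intro measurable_Pair 1 2 3)
    then show "(\<lambda>\<sigma>. F \<sigma> (X \<sigma>, inner_H \<tau> a (\<lambda>\<theta>. X (\<sigma> + \<theta>))) (u \<sigma>))
        \<in> borel_measurable (lebesgue_on {t..T})"
      by simp
    fix \<sigma> assume \<sigma>: "\<sigma> \<in> {t..T}"
    have "\<bar>inner_H \<tau> a (\<lambda>\<theta>. X (\<sigma> + \<theta>))\<bar> \<le> L * integral {-\<tau>..0} (\<lambda>\<theta>. norm (X (\<sigma> + \<theta>)))"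
      by (intro inner_H_le segment_bdd_meas X)
    moreover have "norm (integral {-\<tau>..0} (\<lambda>\<theta>. norm (X (\<sigma> + \<theta>)))) \<le> K * (0 - (-\<tau>))"
      using K tau_pos
      by (intro norm_integral_le_const bdd_meas_norm segment_bdd_meas X) auto
    ultimately have "\<bar>inner_H \<tau> a (\<lambda>\<theta>. X (\<sigma> + \<theta>))\<bar> \<le> L * (K * \<tau>)"
      using L_pos by (smt (verit) mult_left_mono real_norm_def)
    then have "norm (X \<sigma>, inner_H \<tau> a (\<lambda>\<theta>. X (\<sigma> + \<theta>))) \<le> K + L * (K * \<tau>)"
      using K[of \<sigma>] norm_Pair_le[of "X \<sigma>"] by (smt (verit) real_norm_def)
    then show "norm (F \<sigma> (X \<sigma>, inner_H \<tau> a (\<lambda>\<theta>. X (\<sigma> + \<theta>))) (u \<sigma>)) \<le> L * (1 + (K + L * (K * \<tau>)))"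
      using F_growth[of \<sigma>] \<sigma> sub L_pos by (smt (verit) mult_left_mono subsetD)
  qed
qed

lemma drift_delay_bdd_meas:
  assumes X: "X \<in> borel_measurable borel" "bounded (range X)" and t: "0 \<le> t"
  shows "bdd_meas (\<lambda>\<sigma>. b \<sigma> *v X (\<sigma> - \<tau>)) {t..T}"
proof -
  obtain K where K: "\<And>s. norm (X s) \<le> K"
    using X(2) unfolding bounded_iff by auto
  have sub: "{t..T} \<subseteq> {0..T}" using t by auto
  show ?thesis
  proof (rule bdd_measI[of _ _ "L * K"])
    show "(\<lambda>\<sigma>. b \<sigma> *v X (\<sigma> - \<tau>)) \<in> borel_measurable (lebesgue_on {t..T})"
    proof (rule borel_measurable_continuous_Pair[where H = "(*v)"])
      show "b \<in> borel_measurable (lebesgue_on {t..T})"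
        using continuous_on_subset[OF b_continuous sub]
        by (intro continuous_imp_measurable_on_sets_lebesgue) auto
      show "(\<lambda>\<sigma>. X (\<sigma> - \<tau>)) \<in> borel_measurable (lebesgue_on {t..T})"
        using segment_borel[OF X(1), of "- \<tau>"]
        by (intro borel_measurable_lebesgue_on) (simp add: add.commute)
      show "continuous_on UNIV (\<lambda>x::(real^'d^'d) \<times> (real^'d). fst x *v snd x)"
        by (intro bounded_bilinear.continuous_on[OF bounded_bilinear_matrix_vector_mult]
            continuous_intros)
    qed
    fix \<sigma> assume "\<sigma> \<in> {t..T}"
    then show "norm (b \<sigma> *v X (\<sigma> - \<tau>)) \<le> L * K"
      using b_bound[of \<sigma> "X (\<sigma> - \<tau>)"] K[of "\<sigma> - \<tau>"] sub L_pos
      by (smt (verit) mult_left_mono subsetD)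
  qed
qed

lemma drift_bdd_meas:
  assumes "X \<in> borel_measurable borel" "bounded (range X)" "u \<in> controls t T" "0 \<le> t"
  shows "bdd_meas (drift u X) {t..T}"
  using bdd_meas_add[OF drift_F_bdd_meas[OF assms]
      drift_delay_bdd_meas[OF assms(1,2,4)]]
  unfolding drift_def .

text \<open>\<open>solves_state_eq\<close> with its two integrals merged into one gauge integral.
  Estimates and concatenations are done in this form.\<close>

definition trajectory :: "real \<Rightarrow> (real \<Rightarrow> real^'d) \<Rightarrow> (real \<Rightarrow> 'u) \<Rightarrow> (real \<Rightarrow> real^'d) \<Rightarrow> bool" where
  "trajectory t x u X \<longleftrightarrow> continuous_on {t..T} X \<and>
     (\<forall>s\<in>{t-\<tau>..<t}. X s = x (s - t)) \<and>
     (\<forall>s\<in>{t..T}. X s = x 0 + integral {t..s} (drift u X)) \<and>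
     (\<forall>s. s \<notin> {t-\<tau>..T} \<longrightarrow> X s = 0)"

text \<open>Glues the past \<open>x\<close> to a candidate \<open>Y\<close> for the future.
  Trajectories are fixed by this gluing and so inherit Borel measurability; in the existence proof
  the unknown is \<open>Y\<close> alone.\<close>

definition extend_path :: "real \<Rightarrow> (real \<Rightarrow> real^'d) \<Rightarrow> (real \<Rightarrow> real^'d) \<Rightarrow> real \<Rightarrow> real^'d" where
  "extend_path t x Y s = (if s \<in> {t-\<tau>..<t} then x (s - t) else if s \<in> {t..T} then Y s else 0)"

lemma extend_path_regular:
  assumes x: "x \<in> path_space \<tau>" and Y: "continuous_on {t..T} Y"
  shows "extend_path t x Y \<in> borel_measurable borel" "bounded (range (extend_path t x Y))"
proof -
  have [measurable]: "x \<in> borel_measurable borel"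
    by (rule path_space_borel_measurable[OF x])
  have "(\<lambda>s. x (s - t)) \<in> borel_measurable borel"
    by measurable
  moreover have "(\<lambda>s. indicator {t..T} s *\<^sub>R Y s) \<in> borel_measurable borel"
    by (rule borel_measurable_continuous_on_indicator[OF _ Y]) simp
  ultimately have "(\<lambda>s. if s \<in> {t-\<tau>..<t} then x (s - t) else indicator {t..T} s *\<^sub>R Y s)
      \<in> borel_measurable borel"
    by (intro measurable_If_set) auto
  also have "(\<lambda>s. if s \<in> {t-\<tau>..<t} then x (s - t) else indicator {t..T} s *\<^sub>R Y s) = extend_path t x Y"
    by (auto simp: extend_path_def fun_eq_iff)
  finally show "extend_path t x Y \<in> borel_measurable borel" .
  obtain K where "\<And>\<theta>. norm (x \<theta>) \<le> K"
    using path_space_bounded[OF x] by metis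
  moreover obtain K' where "\<And>s. s \<in> {t..T} \<Longrightarrow> norm (Y s) \<le> K'"
    using compact_imp_bounded[OF compact_continuous_image[OF Y compact_Icc]]
    unfolding bounded_iff by blast
  ultimately have "norm (extend_path t x Y s) \<le> max K (max K' 0)" for s
    unfolding extend_path_def by (smt (verit) norm_zero)
  then show "bounded (range (extend_path t x Y))"
    unfolding bounded_iff by auto
qed

lemma trajectory_extend_path:
  assumes "trajectory t x u X"
  shows "extend_path t x X = X"
  using assms unfolding trajectory_def extend_path_def by (auto simp: fun_eq_iff)

lemma trajectory_regular:
  assumes "x \<in> path_space \<tau>" "trajectory t x u X"
  shows "X \<in> borel_measurable borel" "bounded (range X)"
  using extend_path_regular[OF assms(1), of t X, unfolded trajectory_extend_path[OF assms(2)]] assms(2)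
  unfolding trajectory_def by blast+

text \<open>Merging the two integrals needs integrability, hence regularity of \<open>X\<close>.
  Either side forces \<open>extend_path t x X = X\<close> with \<open>X\<close> continuous on
  \<open>{t..T}\<close>, and this already makes \<open>X\<close> bounded and Borel.\<close>

lemma solves_state_eq_iff_trajectory:
  assumes x: "x \<in> path_space \<tau>" and u: "u \<in> controls t T" and t: "0 \<le> t"
  shows "solves_state_eq T \<tau> F a b t x u X \<longleftrightarrow> trajectory t x u X"
proof -
  have eq: "(LINT \<sigma>|lebesgue_on {t..s}. F \<sigma> (X \<sigma>, inner_H \<tau> a (\<lambda>\<theta>. X (\<sigma> + \<theta>))) (u \<sigma>))
        + (LINT \<sigma>|lebesgue_on {t..s}. b \<sigma> *v X (\<sigma> - \<tau>)) = integral {t..s} (drift u X)"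
    if X: "extend_path t x X = X" "continuous_on {t..T} X" and s: "s \<in> {t..T}" for s
  proof -
    have reg: "X \<in> borel_measurable borel" "bounded (range X)"
      using extend_path_regular[OF x X(2)] X(1) by auto
    have 1: "bdd_meas (\<lambda>\<sigma>. F \<sigma> (X \<sigma>, inner_H \<tau> a (\<lambda>\<theta>. X (\<sigma> + \<theta>))) (u \<sigma>)) {t..s}"
      using s by (intro bdd_meas_subset[OF drift_F_bdd_meas[OF reg u t]]) auto
    have 2: "bdd_meas (\<lambda>\<sigma>. b \<sigma> *v X (\<sigma> - \<tau>)) {t..s}"
      using s by (intro bdd_meas_subset[OF drift_delay_bdd_meas[OF reg t]]) auto
    show ?thesis
      unfolding bdd_meas_lebesgue_integral[OF 1] bdd_meas_lebesgue_integral[OF 2]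
        drift_def
      by (rule integral_add[symmetric]; rule bdd_meas_integrable[OF _ order_refl])
        (fact 1 2)+
  qed
  have iff: "solves_state_eq T \<tau> F a b t x u X \<longleftrightarrow> trajectory t x u X"
    if X: "extend_path t x X = X" "continuous_on {t..T} X"
  proof -
    have "(\<forall>s\<in>{t..T}. X s = x 0
          + (LINT \<sigma>|lebesgue_on {t..s}. F \<sigma> (X \<sigma>, inner_H \<tau> a (\<lambda>\<theta>. X (\<sigma> + \<theta>))) (u \<sigma>))
          + (LINT \<sigma>|lebesgue_on {t..s}. b \<sigma> *v X (\<sigma> - \<tau>)))
        \<longleftrightarrow> (\<forall>s\<in>{t..T}. X s = x 0 + integral {t..s} (drift u X))"
      by (intro ball_cong refl) (simp only: add.assoc eq[OF X])
    then show ?thesis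
      unfolding solves_state_eq_def trajectory_def by blast
  qed
  have "extend_path t x X = X" if "solves_state_eq T \<tau> F a b t x u X"
  proof
    show "extend_path t x X s = X s" for s
      using that unfolding solves_state_eq_def extend_path_def by (cases "s < t"; cases "s \<in> {t..T}") auto
  qed
  then show ?thesis
    using iff trajectory_extend_path unfolding solves_state_eq_def trajectory_def by blast
qed

text \<open>\<open>kappa\<close> and \<open>rate\<close> are chosen so that the drift, integrated from the initial time, is
  Lipschitz with constant \<open>1/2\<close> for the norm with weight \<open>exp (- rate * (s - t))\<close>.\<close>

definition kappa :: real where "kappa = 3 * L + L\<^sup>2 + L\<^sup>2 * T"

definition rate :: real where "rate = 2 * kappa + 1"

lemma kappa_pos: "kappa > 0"
  unfolding kappa_def using L_pos T_pos by (intro add_pos_pos) auto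

lemma rate_ge: "rate \<ge> 1" "kappa \<le> rate / 2"
  unfolding rate_def using kappa_pos by auto

text \<open>The window is enlarged to \<open>{t-\<tau>..s}\<close> and split at \<open>t\<close>:
  the past contributes at most \<open>d\<close>, and the integral of the weight gains the factor
  \<open>1 / rate\<close>.\<close>

lemma window_integral_le:
  assumes D: "bdd_meas D {t-\<tau>..T}" "\<And>r. 0 \<le> D r"
    and d: "integral {t-\<tau>..t} D \<le> d"
    and m: "m \<ge> 0" "\<And>r. r \<in> {t..T} \<Longrightarrow> D r \<le> m * exp (rate * (r - t))"
    and "t - \<tau> \<le> \<alpha>" "\<beta> \<le> s" "s \<in> {t..T}"
  shows "integral {\<alpha>..\<beta>} D \<le> d + m / rate * exp (rate * (s - t))"
proof -
  have int: "D integrable_on {\<alpha>'..\<beta>'}" if "{\<alpha>'..\<beta>'} \<subseteq> {t-\<tau>..T}" for \<alpha>' \<beta>'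
    by (rule bdd_meas_integrable[OF D(1) that])
  have "integral {\<alpha>..\<beta>} D \<le> integral {t-\<tau>..s} D"
    using assms by (intro integral_subset_le int) auto
  also have "\<dots> = integral {t-\<tau>..t} D + integral {t..s} D"
    using assms tau_pos by (intro Henstock_Kurzweil_Integration.integral_combine[symmetric] int) auto
  also have "integral {t..s} D \<le> integral {t..s} (\<lambda>r. m * exp (rate * (r - t)))"
    using assms tau_pos by (intro integral_le int) (auto intro!: integrable_continuous_real continuous_intros)
  also have "\<dots> \<le> m / rate * exp (rate * (s - t))"
    using assms rate_ge by (intro integral_exp_weight_le) auto
  finally show ?thesis
    using d by simp
qed

text \<open>The common estimate behind contraction, stability and growth. \<open>D\<close> stands
  for the norm of a difference or of one solution, and \<open>C\<close> for the inhomogeneity, which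
  is \<open>0\<close> for differences and \<open>L\<close> for the growth bound.\<close>

lemma delay_integral_le:
  assumes D: "bdd_meas D {t-\<tau>..T}" "\<And>r. 0 \<le> D r"
    and d: "integral {t-\<tau>..t} D \<le> d"
    and m: "m \<ge> 0" "\<And>r. r \<in> {t..T} \<Longrightarrow> D r \<le> m * exp (rate * (r - t))"
    and s: "s \<in> {t..T}" and t: "0 \<le> t"
    and f: "f integrable_on {t..s}"
    and f_le: "\<And>\<sigma>. \<sigma> \<in> {t..s} \<Longrightarrow> f \<sigma> \<le> C + L * D \<sigma> + L\<^sup>2 * integral {\<sigma>-\<tau>..\<sigma>} D + L * D (\<sigma> - \<tau>)"
  shows "integral {t..s} f \<le> C * (s - t) + kappa * d + m / 2 * exp (rate * (s - t))"
proof -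
  define e where "e = (\<lambda>\<sigma>. exp (rate * (\<sigma> - t)))"
  have int: "D integrable_on {\<alpha>'..\<beta>'}" if "{\<alpha>'..\<beta>'} \<subseteq> {t-\<tau>..T}" for \<alpha>' \<beta>'
    by (rule bdd_meas_integrable[OF D(1) that])
  have d_nonneg: "d \<ge> 0"
    using d integral_nonneg[OF int[of "t-\<tau>" t]] D(2) s by force
  have int1: "D integrable_on {t..s}"
    using s tau_pos by (intro int) auto
  have int2: "(\<lambda>\<sigma>. D (\<sigma> - \<tau>)) integrable_on {t..s}"
    using integrable_shift_real_ivl[OF int[of "t-\<tau>" "s-\<tau>"], of "-\<tau>"] s tau_pos by simp
  have int3: "(\<lambda>\<sigma>. m / rate * e \<sigma>) integrable_on {t..s}"
    unfolding e_def by (intro integrable_continuous_real continuous_intros)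
  have "integral {t..s} f \<le> integral {t..s} (\<lambda>\<sigma>. (C + L\<^sup>2 * d) + (L * D \<sigma> + (L\<^sup>2 * (m / rate * e \<sigma>) + L * D (\<sigma> - \<tau>))))"
  proof (rule integral_le[OF f])
    show "(\<lambda>\<sigma>. (C + L\<^sup>2 * d) + (L * D \<sigma> + (L\<^sup>2 * (m / rate * e \<sigma>) + L * D (\<sigma> - \<tau>)))) integrable_on {t..s}"
      by (intro integrable_add integrable_on_mult_right int1 int2 int3) auto
    fix \<sigma> assume \<sigma>: "\<sigma> \<in> {t..s}"
    have "integral {\<sigma>-\<tau>..\<sigma>} D \<le> d + m / rate * e \<sigma>"
      unfolding e_def by (rule window_integral_le[OF D d m]) (use \<sigma> s in auto)
    then have "L\<^sup>2 * integral {\<sigma>-\<tau>..\<sigma>} D \<le> L\<^sup>2 * (d + m / rate * e \<sigma>)"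
      by (intro mult_left_mono) auto
    then show "f \<sigma> \<le> (C + L\<^sup>2 * d) + (L * D \<sigma> + (L\<^sup>2 * (m / rate * e \<sigma>) + L * D (\<sigma> - \<tau>)))"
      using f_le[OF \<sigma>] by (simp add: distrib_left)
  qed
  also have "\<dots> = (C + L\<^sup>2 * d) * (s - t) + (L * integral {t..s} D
      + (L\<^sup>2 * integral {t..s} (\<lambda>\<sigma>. m / rate * e \<sigma>) + L * integral {t..s} (\<lambda>\<sigma>. D (\<sigma> - \<tau>))))"
  proof (intro integral_unique has_integral_add has_integral_mult_right integrable_integral int1 int2 int3)
    show "((\<lambda>_. C + L\<^sup>2 * d) has_integral (C + L\<^sup>2 * d) * (s - t)) {t..s}"
      using has_integral_const_real[of "C + L\<^sup>2 * d" t s] s by (simp add: mult.commute)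
  qed
  also have "\<dots> \<le> (C * (s - t) + L\<^sup>2 * d * T) + (L * (m / rate * e s)
      + (L\<^sup>2 * (m / rate * e s) + L * (d + m / rate * e s)))"
  proof (intro add_mono mult_left_mono)
    have "L\<^sup>2 * d * (s - t) \<le> L\<^sup>2 * d * T"
      using s t d_nonneg by (intro mult_left_mono) auto
    then show "(C + L\<^sup>2 * d) * (s - t) \<le> C * (s - t) + L\<^sup>2 * d * T"
      by (simp add: distrib_right)
    have "integral {t..s} D \<le> integral {t..s} (\<lambda>r. m * e r)"
      using s m(2) unfolding e_def
      by (intro integral_le int1) (auto intro!: integrable_continuous_real continuous_intros)
    also have "\<dots> \<le> m / rate * e s"
      unfolding e_def using s m rate_ge by (intro integral_exp_weight_le) auto
    finally show "integral {t..s} D \<le> m / rate * e s" .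
    have "integral {t..s} (\<lambda>\<sigma>. m / rate * e \<sigma>) \<le> m / rate / rate * e s"
      unfolding e_def using s m rate_ge by (intro integral_exp_weight_le) auto
    \<comment> \<open>The window term has been integrated twice and carries the square of
      \<open>1 / rate\<close>; one factor is enough because \<open>rate \<ge> 1\<close>.\<close>
    also have "\<dots> \<le> m / rate * e s"
    proof (rule mult_right_mono)
      show "m / rate / rate \<le> m / rate"
        using divide_left_mono[of 1 rate "m / rate"] m rate_ge by simp
    qed (simp add: e_def)
    finally show "integral {t..s} (\<lambda>\<sigma>. m / rate * e \<sigma>) \<le> m / rate * e s" .
    have "integral {t..s} (\<lambda>\<sigma>. D (\<sigma> - \<tau>)) = integral {t-\<tau>..s-\<tau>} D"
      using integral_shift_real_ivl[of "t-\<tau>" "-\<tau>" "s-\<tau>" D] by simp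
    also have "\<dots> \<le> d + m / rate * e s"
      unfolding e_def by (rule window_integral_le[OF D d m]) (use s tau_pos in auto)
    finally show "integral {t..s} (\<lambda>\<sigma>. D (\<sigma> - \<tau>)) \<le> d + m / rate * e s" .
  qed (use L_pos in auto)
  \<comment> \<open>The origin of \<open>kappa\<close>: it is the sum of the coefficient
    \<open>L\<^sup>2 * T + L\<close> of the past and the coefficient
    \<open>2 * L + L\<^sup>2\<close> of what lies after \<open>t\<close>.\<close>
  also have "\<dots> = C * (s - t) + (L\<^sup>2 * T + L) * d + (2 * L + L\<^sup>2) * (m / rate * e s)"
    by (simp add: algebra_simps)
  also have "\<dots> \<le> C * (s - t) + kappa * d + kappa * (m / rate * e s)"
    using L_pos T_pos d_nonneg m(1) rate_ge
    by (intro add_mono mult_right_mono order_refl) (auto simp: kappa_def e_def)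
  also have "kappa * (m / rate * e s) \<le> m / 2 * e s"
  proof -
    have "kappa / rate \<le> 1 / 2"
      using rate_ge by (simp add: divide_simps)
    then have "kappa / rate * (m * e s) \<le> 1 / 2 * (m * e s)"
      using m(1) by (intro mult_right_mono) (auto simp: e_def)
    then show ?thesis by simp
  qed
  finally show ?thesis
    by (simp add: e_def)
qed

section \<open>Lipschitz and growth estimates of the drift\<close>

lemma segment_norm_integral:
  fixes D :: "real \<Rightarrow> real"
  shows "integral {-\<tau>..0} (\<lambda>\<theta>. D (\<sigma> + \<theta>)) = integral {\<sigma>-\<tau>..\<sigma>} D"
  using integral_shift_real_ivl[of "\<sigma>-\<tau>" \<sigma> \<sigma> D] by (simp add: add.commute)

text \<open>Two times are allowed so that the same bound gives the Lipschitz estimate of the drift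
  (\<open>\<sigma> = s\<close>) and the distance to the drift frozen at an initial time. The control
  value is the same on both sides and leaves no trace in the bound.\<close>

lemma F_state_diff_le:
  assumes "bdd_meas f {-\<tau>..0}" "bdd_meas g {-\<tau>..0}" "\<sigma> \<in> {0..T}" "s \<in> {0..T}"
  shows "norm (F \<sigma> (v, inner_H \<tau> a f) w - F s (v', inner_H \<tau> a g) w)
    \<le> L * \<bar>\<sigma> - s\<bar> + L * norm (v - v') + L\<^sup>2 * integral {-\<tau>..0} (\<lambda>\<theta>. norm (f \<theta> - g \<theta>))"
proof -
  have "norm (F \<sigma> (v, inner_H \<tau> a f) w - F s (v', inner_H \<tau> a g) w)
      \<le> L * (\<bar>s - \<sigma>\<bar> + norm ((v, inner_H \<tau> a f) - (v', inner_H \<tau> a g)))"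
    by (rule F_lipschitz[OF assms(3,4)])
  also have "norm ((v, inner_H \<tau> a f) - (v', inner_H \<tau> a g)) \<le> norm (v - v') + \<bar>inner_H \<tau> a f - inner_H \<tau> a g\<bar>"
    using norm_Pair_le[of "v - v'" "inner_H \<tau> a f - inner_H \<tau> a g"] by simp
  also have "\<dots> \<le> norm (v - v') + L * integral {-\<tau>..0} (\<lambda>\<theta>. norm (f \<theta> - g \<theta>))"
    using inner_H_diff_le[OF assms(1,2)] by simp
  finally show ?thesis
    using L_pos by (simp add: algebra_simps power2_eq_square abs_minus_commute)
qed

lemma drift_diff_le:
  assumes X: "X \<in> borel_measurable borel" "bounded (range X)"
    and Y: "Y \<in> borel_measurable borel" "bounded (range Y)" and \<sigma>: "\<sigma> \<in> {0..T}"
  defines "D \<equiv> \<lambda>r. norm (X r - Y r)"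
  shows "norm (drift u X \<sigma> - drift u Y \<sigma>)
    \<le> L * D \<sigma> + L\<^sup>2 * integral {\<sigma>-\<tau>..\<sigma>} D + L * D (\<sigma> - \<tau>)"
proof -
  have "norm (drift u X \<sigma> - drift u Y \<sigma>)
      \<le> norm (F \<sigma> (X \<sigma>, inner_H \<tau> a (\<lambda>\<theta>. X (\<sigma> + \<theta>))) (u \<sigma>)
            - F \<sigma> (Y \<sigma>, inner_H \<tau> a (\<lambda>\<theta>. Y (\<sigma> + \<theta>))) (u \<sigma>))
        + norm (b \<sigma> *v (X (\<sigma> - \<tau>) - Y (\<sigma> - \<tau>)))"
    unfolding drift_def matrix_vector_mult_diff_distrib add_diff_add by (rule norm_triangle_ineq)
  also have "\<dots> \<le> (L * \<bar>\<sigma> - \<sigma>\<bar> + L * norm (X \<sigma> - Y \<sigma>)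
        + L\<^sup>2 * integral {-\<tau>..0} (\<lambda>\<theta>. norm (X (\<sigma> + \<theta>) - Y (\<sigma> + \<theta>))))
      + L * norm (X (\<sigma> - \<tau>) - Y (\<sigma> - \<tau>))"
    by (intro add_mono F_state_diff_le b_bound segment_bdd_meas X Y \<sigma>)
  finally show ?thesis
    using segment_norm_integral[of D \<sigma>] by (simp add: D_def)
qed

text \<open>Comparison with the zero path, whose drift is at most \<open>L\<close> by the growth
  condition.\<close>

lemma drift_le:
  assumes X: "X \<in> borel_measurable borel" "bounded (range X)" and \<sigma>: "\<sigma> \<in> {0..T}"
  defines "D \<equiv> \<lambda>r. norm (X r)"
  shows "norm (drift u X \<sigma>) \<le> L + L * D \<sigma> + L\<^sup>2 * integral {\<sigma>-\<tau>..\<sigma>} D + L * D (\<sigma> - \<tau>)"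
proof -
  have "norm (drift u (\<lambda>_. 0) \<sigma>) \<le> L"
    using F_growth[OF \<sigma>, of "(0, 0)" "u \<sigma>"] by (simp add: drift_def inner_H_def)
  moreover have "norm (drift u X \<sigma> - drift u (\<lambda>_. 0) \<sigma>)
      \<le> L * D \<sigma> + L\<^sup>2 * integral {\<sigma>-\<tau>..\<sigma>} D + L * D (\<sigma> - \<tau>)"
    using drift_diff_le[OF X, of "\<lambda>_. 0" \<sigma> u] \<sigma> by (simp add: D_def)
  ultimately show ?thesis
    using norm_triangle_sub[of "drift u X \<sigma>" "drift u (\<lambda>_. 0) \<sigma>"] by simp
qed

text \<open>Used for two solutions in the stability estimate, and with \<open>d = 0\<close> for the
  contraction in the existence proof, where both functions share their past.\<close>

lemma drift_integral_diff_le: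
  assumes X: "X \<in> borel_measurable borel" "bounded (range X)"
    and Y: "Y \<in> borel_measurable borel" "bounded (range Y)"
    and u: "u \<in> controls t T" and t: "0 \<le> t"
    and d: "integral {t-\<tau>..t} (\<lambda>r. norm (X r - Y r)) \<le> d"
    and m: "m \<ge> 0" "\<And>r. r \<in> {t..T} \<Longrightarrow> norm (X r - Y r) \<le> m * exp (rate * (r - t))"
    and s: "s \<in> {t..T}"
  shows "norm (integral {t..s} (drift u X) - integral {t..s} (drift u Y))
    \<le> kappa * d + m / 2 * exp (rate * (s - t))"
proof -
  define f where "f = (\<lambda>\<sigma>. norm (drift u X \<sigma> - drift u Y \<sigma>))"
  note drift_bm = drift_bdd_meas[OF X u t] drift_bdd_meas[OF Y u t]
  note int = bdd_meas_integrable[OF drift_bm(1), of t s]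
    bdd_meas_integrable[OF drift_bm(2), of t s]
  have f_int: "f integrable_on {t..s}"
    unfolding f_def using s
    by (intro bdd_meas_integrable[OF bdd_meas_norm[OF bdd_meas_diff[OF drift_bm]]]) auto
  have D_bm: "bdd_meas (\<lambda>r. norm (X r - Y r)) S" for S
    using segment_bdd_meas[OF X, of 0 S] segment_bdd_meas[OF Y, of 0 S]
    by (intro bdd_meas_norm bdd_meas_diff) auto
  have "norm (integral {t..s} (drift u X) - integral {t..s} (drift u Y))
      = norm (integral {t..s} (\<lambda>\<sigma>. drift u X \<sigma> - drift u Y \<sigma>))"
    using int s by (subst integral_diff) auto
  also have "\<dots> \<le> integral {t..s} f"
    using int s f_int by (intro integral_norm_bound_integral integrable_diff) (auto simp: f_def)
  also have "\<dots> \<le> 0 * (s - t) + kappa * d + m / 2 * exp (rate * (s - t))"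
  proof (rule delay_integral_le[OF D_bm _ d m s t f_int])
    show "f \<sigma> \<le> 0 + L * norm (X \<sigma> - Y \<sigma>) + L\<^sup>2 * integral {\<sigma>-\<tau>..\<sigma>} (\<lambda>r. norm (X r - Y r))
        + L * norm (X (\<sigma> - \<tau>) - Y (\<sigma> - \<tau>))" if "\<sigma> \<in> {t..s}" for \<sigma>
      using drift_diff_le[OF X Y, of \<sigma> u] that s t by (simp add: f_def)
  qed auto
  finally show ?thesis by simp
qed

section \<open>Stability, uniqueness and a priori bounds\<close>

lemma trajectory_history_integral:
  fixes g :: "real^'d \<Rightarrow> real^'d \<Rightarrow> real"
  assumes "trajectory t x u X" "trajectory t y v Y"
  shows "integral {t-\<tau>..t} (\<lambda>r. g (X r) (Y r)) = integral {-\<tau>..0} (\<lambda>\<theta>. g (x \<theta>) (y \<theta>))"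
proof -
  have "integral {t-\<tau>..t} (\<lambda>r. g (X r) (Y r)) = integral {t-\<tau>..t} (\<lambda>r. g (x (r - t)) (y (r - t)))"
    by (rule integral_spike[of "{t}"]) (use assms in \<open>auto simp: trajectory_def\<close>)
  also have "\<dots> = integral {-\<tau>..0} (\<lambda>\<theta>. g (x \<theta>) (y \<theta>))"
    using integral_shift_real_ivl[of "-\<tau>" "-t" 0 "\<lambda>\<theta>. g (x \<theta>) (y \<theta>)"] by simp
  finally show ?thesis .
qed

text \<open>The factor \<open>2\<close> comes from \<open>exp_weight_bound\<close>;
  \<open>1 + kappa\<close> majorises the coefficients \<open>1\<close> of the endpoint and
  \<open>kappa\<close> of the past.\<close>

definition stability :: real where "stability = 2 * (1 + kappa) * exp (rate * T)"

lemma stability_pos: "stability > 0"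
  unfolding stability_def using kappa_pos by simp

text \<open>Even the point delay \<open>X (\<sigma> - \<tau>)\<close> enters through its time
  integral, so the past counts only in \<open>L\<^sup>1\<close>. Both solutions use the same
  control, and the constant is the same for all controls.\<close>

lemma trajectory_stability:
  assumes x: "x \<in> path_space \<tau>" and y: "y \<in> path_space \<tau>"
    and X: "trajectory t x u X" and Y: "trajectory t y u Y"
    and u: "u \<in> controls t T" and t: "0 \<le> t" and s: "s \<in> {t..T}"
  shows "norm (X s - Y s) \<le> stability * (norm (x 0 - y 0) + integral {-\<tau>..0} (\<lambda>\<theta>. norm (x \<theta> - y \<theta>)))"
proof -
  define d where "d = integral {-\<tau>..0} (\<lambda>\<theta>. norm (x \<theta> - y \<theta>))"
  have d_nonneg: "d \<ge> 0"
    unfolding d_def by (intro integral_nonneg bdd_meas_norm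
        bdd_meas_integrable[OF _ order_refl] path_space_diff_bdd_meas[OF x y]) auto
  note regX = trajectory_regular[OF x X] and regY = trajectory_regular[OF y Y]
  have "norm (X s - Y s) \<le> 2 * (norm (x 0 - y 0) + kappa * d) * exp (rate * (s - t))"
  proof (rule exp_weight_bound[of t T "\<lambda>s. norm (X s - Y s)"])
    show "continuous_on {t..T} (\<lambda>s. norm (X s - Y s))"
      using X Y unfolding trajectory_def by (intro continuous_intros) auto
    fix m s assume m: "m \<ge> 0" "\<And>r. r \<in> {t..T} \<Longrightarrow> norm (X r - Y r) \<le> m * exp (rate * (r - t))"
      and s: "s \<in> {t..T}"
    have "X s - Y s = (x 0 - y 0) + (integral {t..s} (drift u X) - integral {t..s} (drift u Y))"
      using X Y s unfolding trajectory_def by simp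
    then have "norm (X s - Y s) \<le> norm (x 0 - y 0) + norm (integral {t..s} (drift u X) - integral {t..s} (drift u Y))"
      using norm_triangle_ineq by simp
    also have "\<dots> \<le> norm (x 0 - y 0) + (kappa * d + m / 2 * exp (rate * (s - t)))"
      using trajectory_history_integral[OF X Y, of "\<lambda>v w. norm (v - w)"]
      by (intro add_left_mono drift_integral_diff_le regX regY u t m s) (simp_all add: d_def)
    finally show "norm (X s - Y s) \<le> norm (x 0 - y 0) + kappa * d + m / 2 * exp (rate * (s - t))"
      by simp
  qed (use s d_nonneg kappa_pos rate_ge in auto)
  also have "\<dots> \<le> 2 * ((1 + kappa) * (norm (x 0 - y 0) + d)) * exp (rate * T)"
    using s t d_nonneg kappa_pos rate_ge
    by (intro mult_mono) (auto simp: distrib_left distrib_right)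
  finally show ?thesis
    unfolding stability_def d_def by (simp only: mult_ac)
qed

lemma trajectory_unique:
  assumes x: "x \<in> path_space \<tau>" and X: "trajectory t x u X" and Y: "trajectory t x u Y"
    and u: "u \<in> controls t T" and t: "0 \<le> t"
  shows "X = Y"
proof
  fix s
  show "X s = Y s"
  proof (cases "s \<in> {t..T}")
    case True
    show ?thesis
      using trajectory_stability[OF x x X Y u t True] by simp
  next
    case False
    then show ?thesis
      using X Y unfolding trajectory_def by (cases "s \<in> {t-\<tau>..<t}") auto
  qed
qed

text \<open>The bound of \<open>exp_weight_bound\<close> for a path bounded by \<open>R\<close>:
  \<open>R\<close> for the endpoint, \<open>L * T\<close> for the inhomogeneity,
  \<open>kappa * (\<tau> * R)\<close> for the past.\<close>

definition growth :: "real \<Rightarrow> real" where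
  "growth R = 2 * (R + L * T + kappa * (\<tau> * R)) * exp (rate * T)"

lemma growth_ge:
  assumes "R \<ge> 0"
  shows "growth R \<ge> R"
proof -
  have "R * 1 \<le> 2 * (R + L * T + kappa * (\<tau> * R)) * exp (rate * T)"
    using assms kappa_pos tau_pos T_pos L_pos rate_ge by (intro mult_mono) auto
  then show ?thesis
    unfolding growth_def by simp
qed

text \<open>Stated for every real \<open>s\<close>, the past included, because delay windows reach
  back before \<open>t\<close>; \<open>growth R \<ge> R\<close> covers that part.\<close>

lemma trajectory_bound:
  assumes x: "x \<in> path_space \<tau>" and X: "trajectory t x u X"
    and u: "u \<in> controls t T" and t: "0 \<le> t" "t \<le> T"
    and R: "\<And>\<theta>. norm (x \<theta>) \<le> R"
  shows "norm (X s) \<le> growth R"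
proof -
  have R0: "R \<ge> 0" using R norm_ge_zero order_trans by blast
  note reg = trajectory_regular[OF x X]
  note drift_bm = drift_bdd_meas[OF reg u t(1)]
  have "norm (X s) \<le> growth R" if s: "s \<in> {t..T}" for s
  proof -
    have "norm (X s) \<le> 2 * (R + L * T + kappa * (\<tau> * R)) * exp (rate * (s - t))"
    proof (rule exp_weight_bound[of t T "\<lambda>s. norm (X s)"])
      show "continuous_on {t..T} (\<lambda>s. norm (X s))"
        using X unfolding trajectory_def by (intro continuous_intros) auto
      fix m s assume m: "m \<ge> 0" "\<And>r. r \<in> {t..T} \<Longrightarrow> norm (X r) \<le> m * exp (rate * (r - t))"
        and s: "s \<in> {t..T}"
      have int: "(drift u X) integrable_on {t..s}" "(\<lambda>\<sigma>. norm (drift u X \<sigma>)) integrable_on {t..s}"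
        using s by (auto intro!: bdd_meas_integrable[OF drift_bm]
            bdd_meas_integrable[OF bdd_meas_norm[OF drift_bm]])
      have D_bm: "bdd_meas (\<lambda>r. norm (X r)) S" for S
        using segment_bdd_meas[OF reg, of 0 S] by (intro bdd_meas_norm) auto
      have "norm (X s) \<le> norm (x 0) + norm (integral {t..s} (drift u X))"
        using X s norm_triangle_ineq unfolding trajectory_def by simp
      also have "norm (integral {t..s} (drift u X)) \<le> integral {t..s} (\<lambda>\<sigma>. norm (drift u X \<sigma>))"
        using int by (intro integral_norm_bound_integral) auto
      also have "\<dots> \<le> L * (s - t) + kappa * (\<tau> * R) + m / 2 * exp (rate * (s - t))"
      proof (rule delay_integral_le[OF D_bm _ _ m s t(1) int(2)])
        have "integral {t-\<tau>..t} (\<lambda>r. norm (X r)) = integral {-\<tau>..0} (\<lambda>\<theta>. norm (x \<theta>))"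
          by (rule trajectory_history_integral[OF X X, of "\<lambda>v w. norm v"])
        also have "\<dots> \<le> \<bar>integral {-\<tau>..0} (\<lambda>\<theta>. norm (x \<theta>))\<bar>"
          by simp
        also have "\<dots> \<le> R * (0 - (-\<tau>))"
          using norm_integral_le_const[OF bdd_meas_norm[OF path_space_bdd_meas[OF x]], of "-\<tau>" 0 R] R tau_pos by simp
        finally show "integral {t-\<tau>..t} (\<lambda>r. norm (X r)) \<le> \<tau> * R" by (simp add: mult.commute)
        show "norm (drift u X \<sigma>) \<le> L + L * norm (X \<sigma>) + L\<^sup>2 * integral {\<sigma>-\<tau>..\<sigma>} (\<lambda>r. norm (X r))
            + L * norm (X (\<sigma> - \<tau>))" if "\<sigma> \<in> {t..s}" for \<sigma>
          using drift_le[OF reg, of \<sigma> u] that s t by simp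
      qed auto
      also have "L * (s - t) \<le> L * T"
        using s t L_pos by (intro mult_left_mono) auto
      finally show "norm (X s) \<le> R + L * T + kappa * (\<tau> * R) + m / 2 * exp (rate * (s - t))"
        using R[of 0] by simp
    qed (use t that R0 kappa_pos rate_ge tau_pos T_pos L_pos in auto)
    also have "\<dots> \<le> growth R"
      unfolding growth_def using t that R0 kappa_pos rate_ge tau_pos T_pos L_pos
      by (intro mult_left_mono) auto
    finally show ?thesis .
  qed
  moreover have "norm (X s) \<le> growth R" if "s \<notin> {t..T}"
  proof (cases "s \<in> {t-\<tau>..<t}")
    case True
    then show ?thesis
      using X R[of "s - t"] growth_ge[OF R0] unfolding trajectory_def by simp
  next
    case False
    then have "X s = 0"
      using X that unfolding trajectory_def by auto
    then show ?thesis
      using growth_ge[OF R0] R0 by simp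
  qed
  ultimately show ?thesis by blast
qed

text \<open>The right-hand side of \<open>drift_le\<close> with every norm replaced by
  \<open>growth R\<close>: a Lipschitz constant in time common to all controls.\<close>

definition speed :: "real \<Rightarrow> real" where
  "speed R = L + L * growth R + L\<^sup>2 * (\<tau> * growth R) + L * growth R"

lemma drift_trajectory_bound:
  assumes x: "x \<in> path_space \<tau>" and X: "trajectory t x u X"
    and u: "u \<in> controls t T" and t: "0 \<le> t" "t \<le> T"
    and R: "\<And>\<theta>. norm (x \<theta>) \<le> R" and \<sigma>: "\<sigma> \<in> {0..T}"
  shows "norm (drift u X \<sigma>) \<le> speed R"
proof -
  note reg = trajectory_regular[OF x X]
  note bound = trajectory_bound[OF x X u t R]
  have "bdd_meas (\<lambda>r. norm (X r)) {\<sigma>-\<tau>..\<sigma>}"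
    using segment_bdd_meas[OF reg, of 0] by (intro bdd_meas_norm) auto
  then have "norm (integral {\<sigma>-\<tau>..\<sigma>} (\<lambda>r. norm (X r))) \<le> growth R * (\<sigma> - (\<sigma> - \<tau>))"
    using tau_pos bound by (intro norm_integral_le_const) auto
  then have "integral {\<sigma>-\<tau>..\<sigma>} (\<lambda>r. norm (X r)) \<le> \<tau> * growth R"
    by (simp add: mult.commute)
  then have "L + L * norm (X \<sigma>) + L\<^sup>2 * integral {\<sigma>-\<tau>..\<sigma>} (\<lambda>r. norm (X r)) + L * norm (X (\<sigma> - \<tau>)) \<le> speed R"
    unfolding speed_def using L_pos by (intro add_mono mult_left_mono bound) auto
  then show ?thesis
    using drift_le[OF reg \<sigma>, of u] by simp
qed

lemma trajectory_lipschitz: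
  assumes x: "x \<in> path_space \<tau>" and X: "trajectory t x u X"
    and u: "u \<in> controls t T" and t: "0 \<le> t" "t \<le> T"
    and R: "\<And>\<theta>. norm (x \<theta>) \<le> R" and s: "t \<le> r" "r \<le> s" "s \<le> T"
  shows "norm (X s - X r) \<le> speed R * (s - r)"
proof -
  note reg = trajectory_regular[OF x X]
  note drift_bm = drift_bdd_meas[OF reg u t(1)]
  have int: "drift u X integrable_on {t..s}"
    using s by (intro bdd_meas_integrable[OF drift_bm]) auto
  have "integral {t..r} (drift u X) + integral {r..s} (drift u X) = integral {t..s} (drift u X)"
    using s int by (intro Henstock_Kurzweil_Integration.integral_combine) auto
  then have "X s - X r = integral {r..s} (drift u X)"
    using X s unfolding trajectory_def by (auto simp: algebra_simps)
  also have "norm \<dots> \<le> speed R * (s - r)"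
    using s t by (intro norm_integral_le_const bdd_meas_subset[OF drift_bm]
        drift_trajectory_bound[OF x X u t R]) auto
  finally show ?thesis .
qed

text \<open>Causality of the equation, on which cutting and gluing of trajectories rest.\<close>

lemma drift_cong:
  assumes "\<And>r. r \<in> {\<sigma>-\<tau>..\<sigma>} \<Longrightarrow> X r = Y r" "u \<sigma> = v \<sigma>"
  shows "drift u X \<sigma> = drift v Y \<sigma>"
proof -
  have "inner_H \<tau> a (\<lambda>\<theta>. X (\<sigma> + \<theta>)) = inner_H \<tau> a (\<lambda>\<theta>. Y (\<sigma> + \<theta>))"
    unfolding inner_H_def using assms(1) by (intro Bochner_Integration.integral_cong) auto
  then show ?thesis
    unfolding drift_def using assms tau_pos by simp
qed

text \<open>Banach's fixed point theorem. The unknown \<open>Y\<close> is the solution divided by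
  the weight \<open>w\<close>, so that the plain supremum distance of bounded continuous functions
  becomes the weighted one in which the integral operator contracts by \<open>1 / 2\<close>.\<close>

lemma trajectory_exists:
  assumes x: "x \<in> path_space \<tau>" and u: "u \<in> controls t T" and t: "0 \<le> t" "t \<le> T"
  shows "\<exists>X. trajectory t x u X"
proof -
  define w where "w = (\<lambda>r. exp (rate * (r - t)))"
  \<comment> \<open>Clamps time to \<open>{t..T}\<close>, which turns a function on the interval
    into a bounded continuous function on the line.\<close>
  define c where "c = (\<lambda>s. max t (min T s))"
  define E where "E = (\<lambda>Y::real \<Rightarrow>\<^sub>C (real^'d). extend_path t x (\<lambda>r. w r *\<^sub>R apply_bcontfun Y r))"
  define G where "G = (\<lambda>Y s. (1 / w (c s)) *\<^sub>R (x 0 + integral {t..c s} (drift u (E Y))))"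
  define \<Phi> where "\<Phi> = (\<lambda>Y. Bcontfun (G Y))"
  have w_pos: "w r > 0" for r unfolding w_def by simp
  have c: "c s \<in> {t..T}" for s using t unfolding c_def by auto
  have wY: "continuous_on {t..T} (\<lambda>r. w r *\<^sub>R apply_bcontfun Y r)" for Y :: "real \<Rightarrow>\<^sub>C (real^'d)"
    unfolding w_def by (intro continuous_intros continuous_on_subset[OF continuous_on_apply_bcontfun]) auto
  have reg: "E Y \<in> borel_measurable borel" "bounded (range (E Y))" for Y
    unfolding E_def by (rule extend_path_regular[OF x wY])+
  have G_bcont: "G Y \<in> bcontfun" for Y
  proof -
    define g where "g = (\<lambda>r. (1 / w r) *\<^sub>R (x 0 + integral {t..r} (drift u (E Y))))"
    have "drift u (E Y) integrable_on {t..T}"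
      by (rule bdd_meas_integrable[OF drift_bdd_meas[OF reg u t(1)] order_refl])
    from indefinite_integral_continuous_1[OF this] have g: "continuous_on {t..T} g"
      unfolding g_def w_def by (intro continuous_intros) auto
    have G: "G Y = g \<circ> c"
      by (auto simp: G_def g_def)
    have "continuous_on UNIV c"
      unfolding c_def by (intro continuous_intros)
    then have "continuous_on UNIV (G Y)"
      unfolding G using c by (intro continuous_on_compose continuous_on_subset[OF g]) auto
    moreover have "bounded (range (G Y))"
      using c by (intro bounded_subset[OF compact_imp_bounded[OF compact_continuous_image[OF g compact_Icc]]])
        (auto simp: G)
    ultimately show ?thesis by (simp add: bcontfun_def)
  qed
  then have \<Phi>: "apply_bcontfun (\<Phi> Y) = G Y" for Y
    unfolding \<Phi>_def by (rule Bcontfun_inverse)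
  have "dist (\<Phi> Y) (\<Phi> Z) \<le> 1 / 2 * dist Y Z" for Y Z
  proof (rule dist_bound)
    fix s
    have "norm (integral {t..c s} (drift u (E Y)) - integral {t..c s} (drift u (E Z)))
        \<le> kappa * 0 + dist Y Z / 2 * exp (rate * (c s - t))"
    proof (rule drift_integral_diff_le[OF reg reg u t(1) _ _ _ c])
      \<comment> \<open>The two extensions share the past before \<open>t\<close>; at
        \<open>t\<close> itself they already take the values of the unknowns, hence the exceptional
        point.\<close>
      have "integral {t-\<tau>..t} (\<lambda>r. norm (E Y r - E Z r)) = integral {t-\<tau>..t} (\<lambda>r. 0)"
        by (rule integral_spike[of "{t}"]) (auto simp: E_def extend_path_def)
      then show "integral {t-\<tau>..t} (\<lambda>r. norm (E Y r - E Z r)) \<le> 0" by simp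
      show "norm (E Y r - E Z r) \<le> dist Y Z * exp (rate * (r - t))" if "r \<in> {t..T}" for r
      proof -
        have "E Y r - E Z r = w r *\<^sub>R (apply_bcontfun Y r - apply_bcontfun Z r)"
          using that by (simp add: E_def extend_path_def scaleR_diff_right)
        then have "norm (E Y r - E Z r) = dist (apply_bcontfun Y r) (apply_bcontfun Z r) * w r"
          using w_pos[of r] by (simp add: dist_norm)
        also have "\<dots> \<le> dist Y Z * w r"
          using w_pos[of r] by (intro mult_right_mono dist_bounded) auto
        finally show ?thesis by (simp add: w_def)
      qed
    qed simp
    then have "norm (integral {t..c s} (drift u (E Y)) - integral {t..c s} (drift u (E Z))) / w (c s)
        \<le> 1 / 2 * dist Y Z"
      using w_pos[of "c s"] by (simp add: w_def divide_simps)
    then show "dist (apply_bcontfun (\<Phi> Y) s) (apply_bcontfun (\<Phi> Z) s) \<le> 1 / 2 * dist Y Z"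
      unfolding \<Phi> G_def using w_pos[of "c s"] by (simp add: dist_norm flip: scaleR_diff_right)
  qed
  then obtain Y where "\<Phi> Y = Y"
    using banach_fix_type[of "1/2" \<Phi>] by auto
  then have Y: "apply_bcontfun Y = G Y"
    using \<Phi>[of Y] by simp
  have E_eq: "E Y s = x 0 + integral {t..s} (drift u (E Y))" if s: "s \<in> {t..T}" for s
  proof -
    have "c s = s" using s unfolding c_def by auto
    have "E Y s = w s *\<^sub>R G Y s"
      using s by (simp add: E_def extend_path_def flip: Y)
    then show ?thesis
      using w_pos[of s] \<open>c s = s\<close> by (simp add: G_def)
  qed
  have "continuous_on {t..T} (E Y)"
    by (rule continuous_on_eq[OF wY[of Y]]) (auto simp: E_def extend_path_def)
  then have "trajectory t x u (E Y)"
    unfolding trajectory_def using E_eq t tau_pos by (auto simp: E_def extend_path_def)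
  then show ?thesis by blast
qed

lemma state_trajectory:
  assumes x: "x \<in> path_space \<tau>" and u: "u \<in> controls t T" and t: "0 \<le> t" "t \<le> T"
  shows "trajectory t x u (state T \<tau> F a b t x u)"
    and "trajectory t x u X \<Longrightarrow> state T \<tau> F a b t x u = X"
proof -
  obtain Y where Y: "trajectory t x u Y"
    using trajectory_exists[OF assms] by blast
  have state: "state T \<tau> F a b t x u = (THE X. trajectory t x u X)"
    unfolding state_def solves_state_eq_iff_trajectory[OF x u t(1)] ..
  show eq: "state T \<tau> F a b t x u = X" if "trajectory t x u X" for X
    unfolding state by (rule the_equality, rule that, rule trajectory_unique[OF x _ that u t(1)])
  show "trajectory t x u (state T \<tau> F a b t x u)"
    unfolding eq[OF Y] by (rule Y)
qed

section \<open>Concatenation of trajectories and the flow property\<close>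

lemma history_trajectory_path_space:
  assumes x: "x \<in> path_space \<tau>" and X: "trajectory t x u X" and s: "t \<le> s" "s \<le> T"
  shows "history \<tau> X s \<in> path_space \<tau>"
  using X unfolding trajectory_def by (intro history_path_space[OF x _ _ s]) auto

lemma controls_restrict:
  assumes "u \<in> controls t T" "t \<le> s"
  shows "u \<in> controls s T"
  using assms(1) unfolding controls_def by (rule measurable_restrict_mono) (use assms(2) in auto)

lemma controls_concat:
  assumes u: "u \<in> controls t T" and v: "v \<in> controls s T" and "t \<le> s"
  shows "(\<lambda>r. if r < s then u r else v r) \<in> controls t T"
proof -
  have "{r \<in> space (lebesgue_on {t..T}). r < s} \<in> sets (lebesgue_on {t..T})"
    by (auto simp: sets_restrict_space_iff)
  moreover have "u \<in> measurable (restrict_space (lebesgue_on {t..T}) {r. r < s}) borel"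
    using u unfolding controls_def by (rule measurable_restrict_space1)
  moreover have "v \<in> measurable (restrict_space (lebesgue_on {t..T}) {r. \<not> r < s}) borel"
  proof -
    have "{t..T} \<inter> {r. \<not> r < s} = {s..T}" using \<open>t \<le> s\<close> by auto
    then show ?thesis
      using v unfolding controls_def by (simp add: restrict_restrict_space)
  qed
  ultimately show ?thesis
    unfolding controls_def by (subst measurable_If_restrict_space_iff) auto
qed

text \<open>The continuation starts from the whole segment of \<open>X\<close> at \<open>s\<close>,
  so \<open>Y\<close> reproduces \<open>X\<close> on \<open>{s-\<tau>..s}\<close>. From
  \<open>s\<close> on the glued path therefore agrees with \<open>Y\<close> on every delay window,
  and before \<open>s\<close> it agrees with \<open>X\<close>.\<close>

lemma trajectory_concat:
  assumes x: "x \<in> path_space \<tau>" and X: "trajectory t x u X" and u: "u \<in> controls t T"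
    and v: "v \<in> controls s T" and Y: "trajectory s (history \<tau> X s) v Y"
    and t: "0 \<le> t" "t \<le> s" "s \<le> T"
  shows "trajectory t x (\<lambda>r. if r < s then u r else v r) (\<lambda>r. if r < s then X r else Y r)"
proof -
  define w where "w = (\<lambda>r. if r < s then u r else v r)"
  define Z where "Z = (\<lambda>r. if r < s then X r else Y r)"
  have Ys: "Y s = X s"
    using Y t tau_pos unfolding trajectory_def by (auto simp: history_def)
  have ZX: "Z r = X r" if "r \<le> s" for r
    using that Ys unfolding Z_def by auto
  have ZY: "Z r = Y r" if "r \<ge> s - \<tau>" for r
  proof (cases "r < s")
    case True
    then have "Y r = history \<tau> X s (r - s)"
      using that Y unfolding trajectory_def by simp
    then show ?thesis
      using True that by (simp add: Z_def history_def)
  qed (simp add: Z_def)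
  have contX: "continuous_on {t..T} X" and contY: "continuous_on {s..T} Y"
    using X Y unfolding trajectory_def by blast+
  have "continuous_on {t..s} Z"
    by (rule continuous_on_eq[OF continuous_on_subset[OF contX]]) (use t ZX in auto)
  moreover have "continuous_on {s..T} Z"
    by (rule continuous_on_eq[OF contY]) (use tau_pos ZY in auto)
  moreover have "{t..s} \<union> {s..T} = {t..T}"
    using t by auto
  ultimately have cont: "continuous_on {t..T} Z"
    using continuous_on_closed_Un[of "{t..s}" "{s..T}" Z] by auto
  note reg_X = trajectory_regular[OF x X]
  note reg_Y = trajectory_regular[OF history_trajectory_path_space[OF x X t(2,3)] Y]
  have int1: "(drift w Z has_integral integral {t..r} (drift u X)) {t..r}" if r: "t \<le> r" "r \<le> s" for r
  \<comment> \<open>At \<open>s\<close> the glued control already takes the value of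
    \<open>v\<close>, so the drifts may differ at this one point.\<close>
  proof (rule has_integral_spike[of "{s}"])
    show "(drift u X has_integral integral {t..r} (drift u X)) {t..r}"
      using r t by (intro integrable_integral bdd_meas_integrable[OF drift_bdd_meas[OF reg_X u t(1)]]) auto
    show "drift w Z \<sigma> = drift u X \<sigma>" if "\<sigma> \<in> {t..r} - {s}" for \<sigma>
      using that r by (intro drift_cong ZX) (auto simp: w_def)
  qed simp
  have int2: "(drift w Z has_integral integral {s..r} (drift v Y)) {s..r}" if r: "s \<le> r" "r \<le> T" for r
  proof (rule has_integral_eq)
    show "(drift v Y has_integral integral {s..r} (drift v Y)) {s..r}"
      using r t by (intro integrable_integral bdd_meas_integrable[OF drift_bdd_meas[OF reg_Y v]]) auto
    show "drift v Y \<sigma> = drift w Z \<sigma>" if "\<sigma> \<in> {s..r}" for \<sigma>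
      using that r by (intro drift_cong ZY[symmetric]) (auto simp: w_def)
  qed
  have eq: "Z r = x 0 + integral {t..r} (drift w Z)" if r: "r \<in> {t..T}" for r
  proof (cases "r \<le> s")
    case True
    then have "integral {t..r} (drift w Z) = integral {t..r} (drift u X)"
      using int1[of r] r by (intro integral_unique) auto
    then show ?thesis
      using X ZX[OF True] r unfolding trajectory_def by auto
  next
    case False
    then have "integral {t..r} (drift w Z) = integral {t..s} (drift u X) + integral {s..r} (drift v Y)"
      using int1[of s] int2[of r] r t
      by (intro integral_unique has_integral_combine[of t s r]) auto
    moreover have "X s = x 0 + integral {t..s} (drift u X)"
      using X t unfolding trajectory_def by auto
    moreover have "Y r = history \<tau> X s 0 + integral {s..r} (drift v Y)"
      using Y r False t unfolding trajectory_def by auto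
    ultimately show ?thesis
      using ZY[of r] False tau_pos by (simp add: history_def)
  qed
  have "Z r = x (r - t)" if "r \<in> {t-\<tau>..<t}" for r
    using X that t unfolding trajectory_def Z_def by auto
  moreover have "Z r = 0" if "r \<notin> {t-\<tau>..T}" for r
  proof (cases "r < s")
    case True
    then show ?thesis
      using X that unfolding trajectory_def Z_def by simp
  next
    case False
    then have "r \<notin> {s-\<tau>..T}"
      using that t tau_pos by auto
    then show ?thesis
      using Y False unfolding trajectory_def Z_def by simp
  qed
  ultimately have "trajectory t x w Z"
    unfolding trajectory_def using cont eq by blast
  then show ?thesis
    unfolding w_def Z_def .
qed

text \<open>Concatenation of a control with itself, followed by uniqueness.\<close>

lemma trajectory_flow:
  assumes x: "x \<in> path_space \<tau>" and X: "trajectory t x u X" and u: "u \<in> controls t T"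
    and t: "0 \<le> t" "t \<le> s" "s \<le> T" and Y: "trajectory s (history \<tau> X s) u Y"
    and r: "r \<ge> s"
  shows "Y r = X r"
proof -
  have "trajectory t x (\<lambda>r. if r < s then u r else u r) (\<lambda>r. if r < s then X r else Y r)"
    by (rule trajectory_concat[OF x X u controls_restrict[OF u t(2)] Y t])
  then have "X = (\<lambda>r. if r < s then X r else Y r)"
    by (intro trajectory_unique[OF x X _ u t(1)]) simp
  then show ?thesis
    using r by (metis not_less)
qed

end

subsection \<open>The value function\<close>

locale control_problem = delay_system T \<tau> L F a b
  for T \<tau> L :: real
    and F :: "real \<Rightarrow> (real^'d) \<times> real \<Rightarrow> 'u::metric_space \<Rightarrow> real^'d"
    and a :: "real \<Rightarrow> real^'d"
    and b :: "real \<Rightarrow> real^'d^'d" +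
  fixes q :: "real \<Rightarrow> real^'d \<Rightarrow> 'u \<Rightarrow> real"
    and \<phi> :: "real^'d \<Rightarrow> real"
    and \<rho> :: "real \<Rightarrow> real \<Rightarrow> real"
  assumes q_measurable: "(\<lambda>(t, x, u). q t x u) \<in>
       borel_measurable (restrict_space borel {0..T} \<Otimes>\<^sub>M borel \<Otimes>\<^sub>M borel)"
    and q_growth: "\<And>t x u. t \<in> {0..T} \<Longrightarrow> \<bar>q t x u\<bar> \<le> L * (1 + norm x)"
    and phi_growth: "\<And>x. \<bar>\<phi> x\<bar> \<le> L * (1 + norm x)"
    and q_lipschitz: "\<And>t s x y u. t \<in> {0..T} \<Longrightarrow> s \<in> {0..T} \<Longrightarrow>
       \<bar>q t x u - q s y u\<bar> \<le> L * norm (x - y) + \<rho> \<bar>s - t\<bar> (max (norm x) (norm y))"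
    and phi_lipschitz: "\<And>x y. \<bar>\<phi> x - \<phi> y\<bar> \<le> L * norm (x - y)"
    and rho: "local_modulus \<rho>"
begin

abbreviation J :: "real \<Rightarrow> (real \<Rightarrow> real^'d) \<Rightarrow> (real \<Rightarrow> 'u) \<Rightarrow> real" where
  "J \<equiv> cost T \<tau> F a b q \<phi>"

abbreviation V :: "real \<Rightarrow> (real \<Rightarrow> real^'d) \<Rightarrow> real" where
  "V \<equiv> value_function T \<tau> F a b q \<phi>"

definition running :: "(real \<Rightarrow> 'u) \<Rightarrow> (real \<Rightarrow> real^'d) \<Rightarrow> real \<Rightarrow> real" where
  "running u X \<sigma> = q \<sigma> (X \<sigma>) (u \<sigma>)"

lemma running_bdd_meas:
  assumes X: "X \<in> borel_measurable borel" "\<And>s. norm (X s) \<le> K"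
    and u: "u \<in> controls t T" and t: "0 \<le> t"
  shows "bdd_meas (running u X) {t..T}"
proof (rule bdd_measI[of _ _ "L * (1 + K)"])
  have 1: "(\<lambda>\<sigma>. \<sigma>) \<in> measurable (lebesgue_on {t..T}) (restrict_space borel {0..T})"
    using t by (intro measurable_restrict_space2 borel_measurable_lebesgue_on) auto
  have 2: "X \<in> borel_measurable (lebesgue_on {t..T})"
    using X(1) by (rule borel_measurable_lebesgue_on)
  have 3: "u \<in> measurable (lebesgue_on {t..T}) borel"
    using u unfolding controls_def .
  have "(\<lambda>\<sigma>. (\<lambda>(t, x, u). q t x u) (\<sigma>, X \<sigma>, u \<sigma>)) \<in> borel_measurable (lebesgue_on {t..T})"
    by (rule measurable_compose[OF _ q_measurable]) (intro measurable_Pair 1 2 3)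
  then show "running u X \<in> borel_measurable (lebesgue_on {t..T})"
    unfolding running_def by simp
  show "norm (running u X \<sigma>) \<le> L * (1 + K)" if "\<sigma> \<in> {t..T}" for \<sigma>
    unfolding running_def using q_growth[of \<sigma> "X \<sigma>" "u \<sigma>"] X(2)[of \<sigma>] L_pos that t
    by (smt (verit) atLeastAtMost_iff mult_left_mono real_norm_def)
qed

context
  fixes t x u X
  assumes x: "x \<in> path_space \<tau>" and X: "trajectory t x u X" and u: "u \<in> controls t T"
    and t: "0 \<le> t" "t \<le> T"
begin

lemma trajectory_running_bdd_meas: "bdd_meas (running u X) {t..T}"
proof -
  obtain K where K: "\<And>\<theta>. norm (x \<theta>) \<le> K"
    using path_space_bounded[OF x] by metis
  show ?thesis
    by (rule running_bdd_meas[OF trajectory_regular(1)[OF x X] trajectory_bound[OF x X u t K] u t(1)])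
qed

lemma trajectory_running_bound:
  assumes R: "\<And>\<theta>. norm (x \<theta>) \<le> R" and "t \<le> r" "r \<le> s" "s \<le> T"
  shows "\<bar>integral {r..s} (running u X)\<bar> \<le> L * (1 + growth R) * (s - r)"
proof -
  have "norm (running u X \<sigma>) \<le> L * (1 + growth R)" if "\<sigma> \<in> {r..s}" for \<sigma>
    unfolding running_def
    using q_growth[of \<sigma> "X \<sigma>" "u \<sigma>"] trajectory_bound[OF x X u t R, of \<sigma>] L_pos that t assms
    by (smt (verit) atLeastAtMost_iff mult_left_mono real_norm_def)
  then have "norm (integral {r..s} (running u X)) \<le> L * (1 + growth R) * (s - r)"
    using assms by (intro norm_integral_le_const
        bdd_meas_subset[OF trajectory_running_bdd_meas]) auto
  then show ?thesis by simp
qed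

lemma cost_eq: "J t x u = integral {t..T} (running u X) + \<phi> (X T)"
  unfolding cost_def Let_def state_trajectory(2)[OF x u t X]
  using bdd_meas_lebesgue_integral[OF trajectory_running_bdd_meas]
  by (simp add: running_def[abs_def])

lemma trajectory_cost_bound:
  assumes R: "\<And>\<theta>. norm (x \<theta>) \<le> R"
  shows "\<bar>J t x u\<bar> \<le> L * (1 + growth R) * T + L * (1 + growth R)"
proof -
  have g: "growth R \<ge> 0"
    using trajectory_bound[OF x X u t R] norm_ge_zero order_trans by blast
  have "\<bar>integral {t..T} (running u X)\<bar> \<le> L * (1 + growth R) * (T - t)"
    using t R by (intro trajectory_running_bound) auto
  also have "\<dots> \<le> L * (1 + growth R) * T"
    using t g L_pos by (intro mult_left_mono) auto
  finally have "\<bar>integral {t..T} (running u X)\<bar> \<le> L * (1 + growth R) * T" .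
  moreover have "\<bar>\<phi> (X T)\<bar> \<le> L * (1 + growth R)"
    using phi_growth[of "X T"] trajectory_bound[OF x X u t R, of T] L_pos
    by (smt (verit) mult_left_mono)
  ultimately show ?thesis
    unfolding cost_eq by simp
qed

end

lemma trajectory_cong_control:
  assumes X: "trajectory t x u X" and uv: "\<And>r. r \<in> {t..T} \<Longrightarrow> u r = v r"
  shows "trajectory t x v X"
proof -
  have "integral {t..s} (drift u X) = integral {t..s} (drift v X)" if "s \<in> {t..T}" for s
    using uv that by (intro integral_cong drift_cong) auto
  then show ?thesis
    using X unfolding trajectory_def by simp
qed

text \<open>Controls are total functions; the glued control and its continuation agree only on
  \<open>{s..T}\<close>, and their costs must be identified.\<close>

lemma cost_cong_control:
  assumes x: "x \<in> path_space \<tau>" and u: "u \<in> controls t T" and v: "v \<in> controls t T"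
    and t: "0 \<le> t" "t \<le> T" and uv: "\<And>r. r \<in> {t..T} \<Longrightarrow> u r = v r"
  shows "J t x u = J t x v"
proof -
  obtain X where X: "trajectory t x u X"
    using trajectory_exists[OF x u t] by blast
  have "integral {t..T} (running u X) = integral {t..T} (running v X)"
    using uv by (intro integral_cong) (auto simp: running_def)
  then show ?thesis
    using cost_eq[OF x X u t] cost_eq[OF x trajectory_cong_control[OF X uv] v t] by simp
qed

lemma const_control: "(\<lambda>_. w) \<in> controls t T"
  unfolding controls_def by simp

lemma cost_bound:
  assumes x: "x \<in> path_space \<tau>" and u: "u \<in> controls t T" and t: "0 \<le> t" "t \<le> T"
    and R: "\<And>\<theta>. norm (x \<theta>) \<le> R"
  shows "\<bar>J t x u\<bar> \<le> L * (1 + growth R) * T + L * (1 + growth R)"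
  using trajectory_exists[OF x u t] trajectory_cost_bound[OF x _ u t R] by blast

text \<open>The infimum defining the value is taken in the reals and is a genuine one only with this
  bound.\<close>

lemma cost_bdd_below:
  assumes x: "x \<in> path_space \<tau>" and t: "0 \<le> t" "t \<le> T"
  shows "bdd_below (J t x ` controls t T)"
proof -
  obtain K where K: "\<And>\<theta>. norm (x \<theta>) \<le> K"
    using path_space_bounded[OF x] by metis
  have "- (L * (1 + growth K) * T + L * (1 + growth K)) \<le> J t x u" if "u \<in> controls t T" for u
    using cost_bound[OF x that t K] by simp
  then show ?thesis
    by (rule bdd_belowI2)
qed

lemma value_le:
  assumes "x \<in> path_space \<tau>" "u \<in> controls t T" "0 \<le> t" "t \<le> T"
  shows "V t x \<le> J t x u"
  unfolding value_function_def using assms by (intro cINF_lower cost_bdd_below) auto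

lemma value_near:
  assumes x: "x \<in> path_space \<tau>" and t: "0 \<le> t" "t \<le> T" and "e > 0"
  obtains u where "u \<in> controls t T" "J t x u < V t x + e"
proof -
  have "controls t T \<noteq> ({} :: (real \<Rightarrow> 'u) set)"
    using const_control by blast
  then show ?thesis
    using that cINF_less_iff[OF _ cost_bdd_below[OF x t], of "V t x + e"] \<open>e > 0\<close>
    unfolding value_function_def by auto
qed

section \<open>Dynamic programming principle\<close>

lemma cost_split:
  assumes x: "x \<in> path_space \<tau>" and X: "trajectory t x u X" and u: "u \<in> controls t T"
    and t: "0 \<le> t" "t \<le> s" "s \<le> T"
  shows "J t x u = integral {t..s} (running u X) + J s (history \<tau> X s) u"
proof -
  have tT: "t \<le> T" using t by simp
  have hist: "history \<tau> X s \<in> path_space \<tau>"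
    by (rule history_trajectory_path_space[OF x X t(2,3)])
  have us: "u \<in> controls s T"
    by (rule controls_restrict[OF u t(2)])
  have s: "0 \<le> s" using t by simp
  obtain Y where Y: "trajectory s (history \<tau> X s) u Y"
    using trajectory_exists[OF hist us s t(3)] by blast
  note YX = trajectory_flow[OF x X u t Y]
  have "J s (history \<tau> X s) u = integral {s..T} (running u Y) + \<phi> (Y T)"
    by (rule cost_eq[OF hist Y us s t(3)])
  also have "integral {s..T} (running u Y) = integral {s..T} (running u X)"
    using YX by (intro integral_cong) (auto simp: running_def)
  finally have "J s (history \<tau> X s) u = integral {s..T} (running u X) + \<phi> (X T)"
    using YX[of T] t by simp
  moreover have "integral {t..s} (running u X) + integral {s..T} (running u X) = integral {t..T} (running u X)"
    using t by (intro Henstock_Kurzweil_Integration.integral_combine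
        bdd_meas_integrable[OF trajectory_running_bdd_meas[OF x X u t(1) tT]]) auto
  ultimately show ?thesis
    using cost_eq[OF x X u t(1) tT] by simp
qed

text \<open>The control \<open>u\<close> is continued after \<open>s\<close> by an
  \<open>e\<close>-optimal control for the segment reached there; the concatenation competes in the
  infimum at \<open>(t, x)\<close>.\<close>

lemma dynamic_programming_le:
  assumes x: "x \<in> path_space \<tau>" and X: "trajectory t x u X" and u: "u \<in> controls t T"
    and t: "0 \<le> t" "t \<le> s" "s \<le> T"
  shows "V t x \<le> integral {t..s} (running u X) + V s (history \<tau> X s)"
proof (rule field_le_epsilon)
  fix e :: real assume "e > 0"
  have hist: "history \<tau> X s \<in> path_space \<tau>"
    by (rule history_trajectory_path_space[OF x X t(2,3)])
  have s: "0 \<le> s" and tT: "t \<le> T" using t by auto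
  obtain v where v: "v \<in> controls s T" "J s (history \<tau> X s) v < V s (history \<tau> X s) + e"
    using value_near[OF hist s t(3) \<open>e > 0\<close>] .
  obtain Y where Y: "trajectory s (history \<tau> X s) v Y"
    using trajectory_exists[OF hist v(1) s t(3)] by blast
  define w where "w = (\<lambda>r. if r < s then u r else v r)"
  define Z where "Z = (\<lambda>r. if r < s then X r else Y r)"
  have w: "w \<in> controls t T"
    unfolding w_def by (rule controls_concat[OF u v(1) t(2)])
  have Z: "trajectory t x w Z"
    unfolding w_def Z_def by (rule trajectory_concat[OF x X u v(1) Y t])
  have "Y s = X s"
    using Y t tau_pos unfolding trajectory_def by (auto simp: history_def)
  then have ZX: "Z r = X r" if "r \<le> s" for r
    using that unfolding Z_def by auto
  have "V t x \<le> J t x w"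
    by (rule value_le[OF x w t(1) tT])
  also have "\<dots> = integral {t..s} (running w Z) + J s (history \<tau> Z s) w"
    by (rule cost_split[OF x Z w t])
  also have "integral {t..s} (running w Z) = integral {t..s} (running u X)"
    by (rule integral_spike[of "{s}"]) (auto simp: running_def w_def ZX)
  also have "history \<tau> Z s = history \<tau> X s"
    by (auto simp: history_def ZX)
  also have "J s (history \<tau> X s) w = J s (history \<tau> X s) v"
    by (rule cost_cong_control[OF hist controls_restrict[OF w t(2)] v(1) s t(3)]) (simp add: w_def)
  finally show "V t x \<le> integral {t..s} (running u X) + V s (history \<tau> X s) + e"
    using v(2) by simp
qed

text \<open>The remainder of an \<open>e\<close>-optimal control is admissible from \<open>s\<close>
  on and costs at least the value there. The pair obtained depends on \<open>s\<close> and
  \<open>e\<close>.\<close>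

lemma dynamic_programming_ge:
  assumes x: "x \<in> path_space \<tau>" and t: "0 \<le> t" "t \<le> s" "s \<le> T" and "e > 0"
  obtains u X where "u \<in> controls t T" "trajectory t x u X"
    "integral {t..s} (running u X) + V s (history \<tau> X s) < V t x + e"
proof -
  have s: "0 \<le> s" and tT: "t \<le> T" using t by auto
  obtain u where u: "u \<in> controls t T" "J t x u < V t x + e"
    using value_near[OF x t(1) tT \<open>e > 0\<close>] .
  obtain X where X: "trajectory t x u X"
    using trajectory_exists[OF x u(1) t(1) tT] by blast
  have "V s (history \<tau> X s) \<le> J s (history \<tau> X s) u"
    by (rule value_le[OF history_trajectory_path_space[OF x X t(2,3)] controls_restrict[OF u(1) t(2)] s t(3)])
  then show ?thesis
    using that[OF u(1) X] u(2) cost_split[OF x X u(1) t] by simp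
qed

section \<open>Terminal value and regularity of the value function\<close>

lemma value_terminal:
  assumes x: "x \<in> path_space \<tau>"
  shows "V T x = \<phi> (x 0)"
proof -
  have "J T x u = \<phi> (x 0)" if u: "u \<in> controls T T" for u
  proof -
    have T: "0 \<le> T" using T_pos by simp
    obtain X where X: "trajectory T x u X"
      using trajectory_exists[OF x u T order_refl] by blast
    then have "X T = x 0"
      unfolding trajectory_def by simp
    then show ?thesis
      using cost_eq[OF x X u T order_refl] by simp
  qed
  then have "J T x ` controls T T = {\<phi> (x 0)}"
    using const_control by (auto simp: image_def)
  then show ?thesis
    unfolding value_function_def by simp
qed

text \<open>Running cost over a horizon of at most \<open>T\<close> plus terminal cost, both
  \<open>L\<close>-Lipschitz in the state, times the stability constant.\<close>

definition value_lip :: real where "value_lip = (L * T + L) * stability"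

lemma value_lip_pos: "value_lip > 0"
  unfolding value_lip_def using L_pos T_pos stability_pos by (simp add: add_pos_pos)

lemma rho_zero: "r \<ge> 0 \<Longrightarrow> \<rho> 0 r = 0"
  using rho unfolding local_modulus_def by simp

lemma cost_lipschitz:
  assumes x: "x \<in> path_space \<tau>" and y: "y \<in> path_space \<tau>"
    and u: "u \<in> controls t T" and t: "0 \<le> t" "t \<le> T"
  shows "\<bar>J t x u - J t y u\<bar> \<le> value_lip * (norm (x 0 - y 0) + integral {-\<tau>..0} (\<lambda>\<theta>. norm (x \<theta> - y \<theta>)))"
proof -
  define D where "D = norm (x 0 - y 0) + integral {-\<tau>..0} (\<lambda>\<theta>. norm (x \<theta> - y \<theta>))"
  obtain X where X: "trajectory t x u X"
    using trajectory_exists[OF x u t] by blast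
  obtain Y where Y: "trajectory t y u Y"
    using trajectory_exists[OF y u t] by blast
  have XY: "norm (X s - Y s) \<le> stability * D" if "s \<in> {t..T}" for s
    unfolding D_def by (rule trajectory_stability[OF x y X Y u t(1) that])
  have D0: "0 \<le> stability * D"
    using order_trans[OF norm_ge_zero XY[of t]] t by simp
  have "norm (integral {t..T} (running u X) - integral {t..T} (running u Y)) \<le> L * (stability * D) * (T - t)"
  proof (rule norm_integral_diff_le_const[OF trajectory_running_bdd_meas[OF x X u t]
        trajectory_running_bdd_meas[OF y Y u t] t(2)])
    fix s assume s: "s \<in> {t..T}"
    then have s0: "s \<in> {0..T}" using t by auto
    \<comment> \<open>Both trajectories are compared at the same time, so the modulus is taken at
      \<open>0\<close> and vanishes.\<close>
    have "\<bar>running u X s - running u Y s\<bar> \<le> L * norm (X s - Y s) + \<rho> \<bar>s - s\<bar> (max (norm (X s)) (norm (Y s)))"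
      unfolding running_def by (rule q_lipschitz[OF s0 s0])
    also have "\<dots> = L * norm (X s - Y s)"
      by (simp add: rho_zero le_max_iff_disj)
    also have "\<dots> \<le> L * (stability * D)"
      using XY[OF s] L_pos by simp
    finally show "norm (running u X s - running u Y s) \<le> L * (stability * D)" by simp
  qed
  also have "\<dots> \<le> L * (stability * D) * T"
    using t D0 L_pos by (intro mult_left_mono) auto
  finally have 1: "\<bar>integral {t..T} (running u X) - integral {t..T} (running u Y)\<bar> \<le> L * (stability * D) * T"
    by simp
  have "\<bar>\<phi> (X T) - \<phi> (Y T)\<bar> \<le> L * norm (X T - Y T)"
    by (rule phi_lipschitz)
  also have "\<dots> \<le> L * (stability * D)"
    using XY[of T] t L_pos by simp
  finally have 2: "\<bar>\<phi> (X T) - \<phi> (Y T)\<bar> \<le> L * (stability * D)" .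
  have "\<bar>J t x u - J t y u\<bar> \<le> L * (stability * D) * T + L * (stability * D)"
    unfolding cost_eq[OF x X u t] cost_eq[OF y Y u t] using 1 2 by linarith
  also have "\<dots> = value_lip * D"
    by (simp add: value_lip_def algebra_simps)
  finally show ?thesis unfolding D_def .
qed

lemma value_lipschitz:
  assumes x: "x \<in> path_space \<tau>" and y: "y \<in> path_space \<tau>" and t: "0 \<le> t" "t \<le> T"
  shows "\<bar>V t x - V t y\<bar> \<le> value_lip * (norm (x 0 - y 0) + integral {-\<tau>..0} (\<lambda>\<theta>. norm (x \<theta> - y \<theta>)))"
proof -
  have "V t x \<le> V t y + value_lip * (norm (x 0 - y 0) + integral {-\<tau>..0} (\<lambda>\<theta>. norm (x \<theta> - y \<theta>)))"
    if x: "x \<in> path_space \<tau>" and y: "y \<in> path_space \<tau>" for x y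
  proof (rule field_le_epsilon)
    fix e :: real assume "e > 0"
    obtain u where u: "u \<in> controls t T" "J t y u < V t y + e"
      using value_near[OF y t \<open>e > 0\<close>] .
    show "V t x \<le> V t y + value_lip * (norm (x 0 - y 0) + integral {-\<tau>..0} (\<lambda>\<theta>. norm (x \<theta> - y \<theta>))) + e"
      using value_le[OF x u(1) t] u(2) cost_lipschitz[OF x y u(1) t] by linarith
  qed
  from this[OF x y] this[OF y x] show ?thesis
    by (simp add: norm_minus_commute abs_le_iff)
qed

text \<open>Older than \<open>s - t\<close>, both segments show the same shifted past; on the recent
  window \<open>X\<close> is compared with its starting value. That the bound is \<open>0\<close>
  off this window later yields the additional factor \<open>sqrt h\<close>.\<close>

lemma history_frozen_shift_diff_le:
  assumes x: "x \<in> path_space \<tau>" and X: "trajectory t x u X"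
    and u: "u \<in> controls t T" and t: "0 \<le> t" "t \<le> s" "s \<le> T"
    and R: "\<And>\<theta>. norm (x \<theta>) \<le> R"
  shows "norm (history \<tau> X s \<theta> - frozen_shift \<tau> x (s - t) \<theta>) \<le> (if s - t + \<theta> < 0 \<or> \<theta> > 0 then 0 else speed R * (s - t))"
proof -
  have tT: "t \<le> T" using t by simp
  have lip: "norm (X r' - X r) \<le> speed R * (r' - r)" if "t \<le> r" "r \<le> r'" "r' \<le> T" for r r'
    by (rule trajectory_lipschitz[OF x X u t(1) tT R that])
  have Xt: "X t = x 0"
    using X tT unfolding trajectory_def by simp
  have speed0: "0 \<le> speed R"
    using drift_trajectory_bound[OF x X u t(1) tT R, of 0] T_pos by (auto intro: order_trans[OF norm_ge_zero])
  show ?thesis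
  proof (cases "\<theta> \<in> {-\<tau>..0}")
    case True
    show ?thesis
    proof (cases "s - t + \<theta> < 0")
      case before: True
      then have "X (s + \<theta>) = x (s + \<theta> - t)"
        using X True t unfolding trajectory_def by auto
      then show ?thesis
        using before True by (simp add: history_def frozen_shift_def algebra_simps)
    next
      case False
      have "norm (X (s + \<theta>) - X t) \<le> speed R * (s + \<theta> - t)"
        using False True t by (intro lip) auto
      also have "\<dots> \<le> speed R * (s - t)"
        using True speed0 by (intro mult_left_mono) auto
      finally show ?thesis
        using True False by (simp add: history_def frozen_shift_def Xt)
    qed
  next
    case False
    then have "history \<tau> X s \<theta> = 0" "frozen_shift \<tau> x (s - t) \<theta> = 0"
      by (simp_all only: history_def frozen_shift_def if_False not_False_eq_True if_True)
    then show ?thesis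
      using speed0 t by simp
  qed
qed

lemma value_shift_diff:
  assumes x: "x \<in> path_space \<tau>" and y: "y \<in> path_space \<tau>" and t: "0 \<le> t" "t \<le> s" "s \<le> T"
    and R: "\<And>\<theta>. norm (x \<theta>) \<le> R"
  shows "\<bar>V t x - V s y\<bar> \<le> L * (1 + growth R) * (s - t)
    + value_lip * (speed R * (s - t) + norm (x 0 - y 0)
      + (\<tau> * (speed R * (s - t)) + integral {-\<tau>..0} (\<lambda>\<theta>. norm (frozen_shift \<tau> x (s - t) \<theta> - y \<theta>))))"
    (is "_ \<le> ?B")
proof -
  have tT: "t \<le> T" and s: "0 \<le> s" using t by auto
  have fs: "frozen_shift \<tau> x (s - t) \<in> path_space \<tau>"
    using t by (intro frozen_shift_path_space x) auto
  \<comment> \<open>Uniform over admissible pairs, so it serves the arbitrary control of one dynamic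
    programming inequality and the near-optimal control of the other.\<close>
  have B: "\<bar>integral {t..s} (running u X) + V s (history \<tau> X s) - V s y\<bar> \<le> ?B"
    if u: "u \<in> controls t T" and X: "trajectory t x u X" for u X
  proof -
    have hist: "history \<tau> X s \<in> path_space \<tau>"
      by (rule history_trajectory_path_space[OF x X t(2,3)])
    note diff = history_frozen_shift_diff_le[OF x X u t R]
    have speed0: "0 \<le> speed R * (s - t)"
      using diff[of 0] t by (auto intro: order_trans[OF norm_ge_zero])
    then have diff': "norm (history \<tau> X s \<theta> - frozen_shift \<tau> x (s - t) \<theta>) \<le> speed R * (s - t)" for \<theta>
      using diff[of \<theta>] by (auto split: if_splits)
    have "integral {-\<tau>..0} (\<lambda>\<theta>. norm (history \<tau> X s \<theta> - y \<theta>)) \<le> (0 - (-\<tau>)) * (speed R * (s - t))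
        + integral {-\<tau>..0} (\<lambda>\<theta>. norm (frozen_shift \<tau> x (s - t) \<theta> - y \<theta>))"
    proof (rule integral_norm_le_add[OF path_space_diff_bdd_meas[OF hist y]
          path_space_diff_bdd_meas[OF fs y]])
      show "norm (history \<tau> X s \<theta> - y \<theta>) \<le> speed R * (s - t) + norm (frozen_shift \<tau> x (s - t) \<theta> - y \<theta>)" for \<theta>
        using diff'[of \<theta>] norm_triangle_ineq[of "history \<tau> X s \<theta> - frozen_shift \<tau> x (s - t) \<theta>"
            "frozen_shift \<tau> x (s - t) \<theta> - y \<theta>"] by simp
    qed (use tau_pos in simp)
    then have int: "integral {-\<tau>..0} (\<lambda>\<theta>. norm (history \<tau> X s \<theta> - y \<theta>)) \<le> \<tau> * (speed R * (s - t))
        + integral {-\<tau>..0} (\<lambda>\<theta>. norm (frozen_shift \<tau> x (s - t) \<theta> - y \<theta>))"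
      by simp
    have "frozen_shift \<tau> x (s - t) 0 = x 0"
      using t tau_pos by (auto simp: frozen_shift_def)
    then have "norm (history \<tau> X s 0 - y 0) \<le> speed R * (s - t) + norm (x 0 - y 0)"
      using diff'[of 0] norm_triangle_ineq[of "history \<tau> X s 0 - x 0" "x 0 - y 0"] by simp
    then have "value_lip * (norm (history \<tau> X s 0 - y 0) + integral {-\<tau>..0} (\<lambda>\<theta>. norm (history \<tau> X s \<theta> - y \<theta>)))
      \<le> value_lip * (speed R * (s - t) + norm (x 0 - y 0)
      + (\<tau> * (speed R * (s - t)) + integral {-\<tau>..0} (\<lambda>\<theta>. norm (frozen_shift \<tau> x (s - t) \<theta> - y \<theta>))))"
      using int value_lip_pos by (intro mult_left_mono add_mono) auto
    then show ?thesis
      using value_lipschitz[OF hist y s t(3)] trajectory_running_bound[OF x X u t(1) tT R order_refl t(2,3)]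
      by linarith
  qed
  obtain u :: "real \<Rightarrow> 'u" where u: "u \<in> controls t T"
    using const_control by blast
  obtain X where X: "trajectory t x u X"
    using trajectory_exists[OF x u t(1) tT] by blast
  have "V t x \<le> V s y + ?B"
    using dynamic_programming_le[OF x X u t] B[OF u X] by linarith
  moreover have "V s y \<le> V t x + ?B"
  proof (rule field_le_epsilon)
    fix e :: real assume "e > 0"
    obtain u X where uX: "u \<in> controls t T" "trajectory t x u X"
      "integral {t..s} (running u X) + V s (history \<tau> X s) < V t x + e"
      using dynamic_programming_ge[OF x t \<open>e > 0\<close>] .
    then show "V s y \<le> V t x + ?B + e"
      using B[OF uX(1,2)] by linarith
  qed
  ultimately show ?thesis
    by linarith
qed

lemma value_continuous: "V \<in> C0_space T (path_space \<tau>) (sup_norm \<tau>)"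
  unfolding C0_space_def continuous_wrt_def mem_Collect_eq
proof (intro ballI allI impI)
  fix t e :: real and x :: "real \<Rightarrow> real^'d"
  assume t: "t \<in> {0..T}" and x: "x \<in> path_space \<tau>" and e: "e > 0"
  obtain K where K: "K \<ge> 0" "\<And>\<theta>. norm (x \<theta>) \<le> K"
    using path_space_bounded[OF x] by metis
  \<comment> \<open>The additional \<open>1\<close> makes \<open>R\<close> a bound for every path
    within distance \<open>d \<le> 1\<close> of \<open>x\<close> as well.\<close>
  define R where "R = K + 1"
  define \<omega> where "\<omega> = (\<lambda>h. integral {-\<tau>..0} (\<lambda>\<theta>. norm (frozen_shift \<tau> x h \<theta> - x \<theta>)))"
  define A where "A = L * (1 + growth R) + value_lip * (speed R + \<tau> * speed R)"
  have R0: "R \<ge> 0" using K unfolding R_def by simp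
  have growth0: "growth R \<ge> 0"
    using growth_ge[OF R0] R0 by simp
  then have "speed R \<ge> 0"
    unfolding speed_def using L_pos tau_pos by simp
  then have A0: "A \<ge> 0"
    unfolding A_def using L_pos tau_pos growth0 value_lip_pos by simp
  have "(\<omega> \<longlongrightarrow> 0) (at_right 0)"
    unfolding \<omega>_def using frozen_shift_integral_tendsto[OF x, of 1] by simp
  then have "\<forall>\<^sub>F h in at_right 0. \<bar>\<omega> h\<bar> < e / (2 * value_lip)"
    using e value_lip_pos by (auto simp: tendsto_iff dist_real_def elim: allE[of _ "e / (2 * value_lip)"])
  then obtain d1 where d1: "d1 > 0" "\<And>h. 0 < h \<Longrightarrow> h < d1 \<Longrightarrow> \<bar>\<omega> h\<bar> < e / (2 * value_lip)"
    unfolding eventually_at_right_field by auto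
  have \<omega>: "value_lip * \<omega> h < e / 2" if "0 \<le> h" "h < d1" for h
  proof (cases "h = 0")
    case True
    have "frozen_shift \<tau> x 0 = x"
      using x unfolding path_space_def by (auto simp: frozen_shift_def fun_eq_iff)
    then show ?thesis
      using True e by (simp add: \<omega>_def)
  next
    case False
    then have "\<omega> h < e / (2 * value_lip)"
      using d1(2)[of h] that by simp
    then show ?thesis
      using value_lip_pos by (simp add: field_simps)
  qed
  \<comment> \<open>\<open>A\<close> is the coefficient of the time lag,
    \<open>value_lip * (1 + \<tau>)\<close> that of the path distance; \<open>1\<close> makes the
    sum positive, so that it can be divided by.\<close>
  define M where "M = A + value_lip * (1 + \<tau>) + 1"
  have M: "M > 0"
    unfolding M_def using A0 value_lip_pos tau_pos by (simp add: add_nonneg_pos)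
  define d where "d = min (min 1 d1) (e / (2 * M))"
  have d: "d > 0" "d \<le> 1" "d \<le> d1" "d \<le> e / (2 * M)"
    unfolding d_def using d1 e M by auto
  have "dist (V s y) (V t x) < e"
    if s: "s \<in> {0..T}" and y: "y \<in> path_space \<tau>" and st: "\<bar>s - t\<bar> < d" and xy: "sup_norm \<tau> (y - x) < d"
    for s and y :: "real \<Rightarrow> real^'d"
  proof -
    have diff: "norm (y \<theta> - x \<theta>) \<le> d" for \<theta>
    proof (cases "\<theta> \<in> {-\<tau>..0}")
      case True
      then show ?thesis
        using norm_le_sup_norm[OF path_space_diff[OF y x]] xy by force
    next
      case False
      then show ?thesis
        using x y d(1) unfolding path_space_def by auto
    qed
    have Rx: "norm (x \<theta>) \<le> R" and Ry: "norm (y \<theta>) \<le> R" for \<theta>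
      using K(2)[of \<theta>] diff[of \<theta>] d(2) norm_triangle_sub[of "y \<theta>" "x \<theta>"] unfolding R_def by auto
    have fs_diff: "norm (frozen_shift \<tau> y h \<theta> - frozen_shift \<tau> x h \<theta>) \<le> d" for h \<theta>
      using diff d(1) by (auto simp: frozen_shift_def)
    have int_le: "integral {-\<tau>..0} (\<lambda>\<theta>. norm (w \<theta> - z \<theta>)) \<le> \<omega> h + \<tau> * d"
      if "w \<in> path_space \<tau>" "z \<in> path_space \<tau>" "h \<ge> 0"
        "\<And>\<theta>. norm (w \<theta> - z \<theta>) \<le> norm (frozen_shift \<tau> x h \<theta> - x \<theta>) + d"
      for w z :: "real \<Rightarrow> real^'d" and h
    proof -
      have "integral {-\<tau>..0} (\<lambda>\<theta>. norm (w \<theta> - z \<theta>)) \<le> (0 - (-\<tau>)) * d + \<omega> h"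
        unfolding \<omega>_def using that(4) tau_pos
        by (intro integral_norm_le_add path_space_diff_bdd_meas[OF that(1,2)]
            path_space_diff_bdd_meas[OF frozen_shift_path_space[OF x that(3)] x]) (auto simp: add.commute)
      then show ?thesis by simp
    qed
    define h where "h = \<bar>s - t\<bar>"
    have h: "h \<ge> 0" "h < d" using st unfolding h_def by auto
    have V_diff: "\<bar>V t1 w - V t2 v\<bar> \<le> A * h + value_lip * (d + (\<omega> h + \<tau> * d))"
      if w: "w \<in> path_space \<tau>" "\<And>\<theta>. norm (w \<theta>) \<le> R" and v: "v \<in> path_space \<tau>"
        and t12: "0 \<le> t1" "t1 \<le> t2" "t2 \<le> T" "h = t2 - t1" and wv: "norm (w 0 - v 0) \<le> d"
        "\<And>\<theta>. norm (frozen_shift \<tau> w h \<theta> - v \<theta>) \<le> norm (frozen_shift \<tau> x h \<theta> - x \<theta>) + d" for t1 t2 w v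
    proof -
      have "value_lip * (speed R * h + norm (w 0 - v 0)
          + (\<tau> * (speed R * h) + integral {-\<tau>..0} (\<lambda>\<theta>. norm (frozen_shift \<tau> w h \<theta> - v \<theta>))))
        \<le> value_lip * (speed R * h + d + (\<tau> * (speed R * h) + (\<omega> h + \<tau> * d)))"
        using value_lip_pos wv(1) int_le[OF frozen_shift_path_space[OF w(1) h(1)] v h(1) wv(2)]
        by (intro mult_left_mono add_mono order_refl) auto
      then show ?thesis
        using value_shift_diff[OF w(1) v t12(1-3) w(2)] unfolding A_def t12(4) by (simp add: algebra_simps)
    qed
    have "\<bar>V s y - V t x\<bar> \<le> A * h + value_lip * (d + (\<omega> h + \<tau> * d))"
    proof (cases "t \<le> s")
      case True
      have "\<bar>V t x - V s y\<bar> \<le> A * h + value_lip * (d + (\<omega> h + \<tau> * d))"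
      proof (rule V_diff[OF x Rx y])
        show "norm (frozen_shift \<tau> x h \<theta> - y \<theta>) \<le> norm (frozen_shift \<tau> x h \<theta> - x \<theta>) + d" for \<theta>
          using diff[of \<theta>] norm_triangle_ineq4[of "frozen_shift \<tau> x h \<theta> - x \<theta>" "y \<theta> - x \<theta>"] by simp
      qed (use True t s diff[of 0] in \<open>auto simp: h_def norm_minus_commute\<close>)
      then show ?thesis
        by (simp only: abs_minus_commute)
    next
      case False
      \<comment> \<open>Now the earlier time belongs to \<open>y\<close>, while
        \<open>\<omega>\<close> controls only the shifts of \<open>x\<close>. Shifting does not
        enlarge the pointwise bound \<open>d\<close>, so \<open>fs_diff\<close> replaces one shift
        by the other.\<close>
      show ?thesis
      proof (rule V_diff[OF y Ry x])
        show "norm (frozen_shift \<tau> y h \<theta> - x \<theta>) \<le> norm (frozen_shift \<tau> x h \<theta> - x \<theta>) + d" for \<theta>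
          using fs_diff[of h \<theta>]
            norm_triangle_ineq[of "frozen_shift \<tau> y h \<theta> - frozen_shift \<tau> x h \<theta>" "frozen_shift \<tau> x h \<theta> - x \<theta>"]
          by simp
      qed (use False t s diff[of 0] in \<open>auto simp: h_def\<close>)
    qed
    also have "\<dots> \<le> A * d + value_lip * (1 + \<tau>) * d + value_lip * \<omega> h"
      using mult_left_mono[of h d A] h A0 by (simp add: algebra_simps)
    also have "value_lip * \<omega> h < e / 2"
      using h d by (intro \<omega>) auto
    also have "A * d + value_lip * (1 + \<tau>) * d \<le> M * d"
      using d(1) unfolding M_def by (simp add: algebra_simps)
    also have "M * d \<le> M * (e / (2 * M))"
      using d(4) M by (intro mult_left_mono) auto
    also have "\<dots> = e / 2"
      using M by simp
    finally show ?thesis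
      by (simp add: dist_real_def)
  qed
  then show "\<exists>d>0. \<forall>s\<in>{0..T}. \<forall>y\<in>path_space \<tau>. \<bar>s - t\<bar> < d \<and> sup_norm \<tau> (y - x) < d \<longrightarrow> dist (V s y) (V t x) < e"
    using d(1) by blast
qed

end

subsection \<open>Test functions along trajectories\<close>

text \<open>Both sides differentiate the same real function along the line
  \<open>z + l *\<^sub>R jump_at_0 v\<close>, once in the space of paths and once in
  \<open>\<real>\<^sup>d \<times> L\<^sup>2\<close>. In the latter the function component of the
  direction is a null vector, on which a bounded functional vanishes.\<close>

lemma gradient_jump_at_0:
  fixes \<psi> :: "real \<Rightarrow> (real \<Rightarrow> real^'d) \<Rightarrow> real"
  assumes \<psi>: "\<psi> \<in> C1_space T (path_space \<tau>) (sup_norm \<tau>)"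
    and \<psi>0: "\<psi>\<^sub>0 \<in> C1_space T (UNIV \<times> L2_space {-\<tau>..0}) (norm_RH \<tau>)"
    and eq: "\<And>t x. t \<in> {0..T} \<Longrightarrow> x \<in> path_space \<tau> \<Longrightarrow> \<psi> t x = \<psi>\<^sub>0 t (x 0, x)"
    and s: "s \<in> {0..T}" and z: "z \<in> path_space \<tau>" and \<tau>: "\<tau> > 0"
  shows "gradient (path_space \<tau>) (sup_norm \<tau>) (\<psi> s) z (jump_at_0 v)
    = gradient (UNIV \<times> L2_space {-\<tau>..0}) (norm_RH \<tau>) (\<psi>\<^sub>0 s) (z 0, z) (v, 0)"
proof -
  define E :: "((real^'d) \<times> (real \<Rightarrow> real^'d)) set" where "E = UNIV \<times> L2_space {-\<tau>..0}"
  define P where "P = gradient (path_space \<tau>) (sup_norm \<tau>) (\<psi> s) z"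
  define p where "p = gradient E (norm_RH \<tau>) (\<psi>\<^sub>0 s) (z 0, z)"
  interpret RH: seminormed_space E "norm_RH \<tau>"
    unfolding E_def by (rule seminormed_space_RH)
  have in_E: "(y, x) \<in> E" if "x \<in> path_space \<tau>" for x y
    unfolding E_def using norm_H_eq_integral(2)[OF that] by simp
  interpret D: seminormed_space "path_space \<tau>" "sup_norm \<tau> :: (real \<Rightarrow> real^'d) \<Rightarrow> real"
    by (rule seminormed_space_path_space[OF \<tau>])
  have jump: "jump_at_0 v \<in> path_space \<tau>"
    by (rule jump_at_0_path_space[OF \<tau>])
  have P: "has_gradient (path_space \<tau>) (sup_norm \<tau>) (\<psi> s) P (z + 0 *\<^sub>R jump_at_0 v)"
    unfolding P_def using D.C1_space_has_gradient[OF \<psi> s z] by simp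
  have p: "has_gradient E (norm_RH \<tau>) (\<psi>\<^sub>0 s) p ((z 0, z) + 0 *\<^sub>R (v, jump_at_0 v))"
    unfolding p_def using RH.C1_space_has_gradient[OF \<psi>0[folded E_def] s in_E[OF z]] by simp
  have "z + l *\<^sub>R jump_at_0 v \<in> path_space \<tau>" for l
    by (intro subspace_add[OF D.subspace] subspace_scale[OF D.subspace] z jump)
  from eq[OF s this] have line: "\<psi>\<^sub>0 s ((z 0, z) + l *\<^sub>R (v, jump_at_0 v)) = \<psi> s (z + l *\<^sub>R jump_at_0 v)" for l
    by (simp add: jump_at_0_def scaleR_fun_def)
  have "(\<lambda>m. m * P (jump_at_0 v)) = (\<lambda>m. m * p (v, jump_at_0 v))"
    by (rule has_derivative_unique[OF D.has_gradient_line[OF P jump z]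
        RH.has_gradient_line[OF p in_E[OF jump] in_E[OF z], unfolded line]])
  from fun_cong[OF this, of 1] have "P (jump_at_0 v) = p (v, jump_at_0 v)"
    by simp
  moreover have "p (v, jump_at_0 v) = p (v, 0)"
  proof -
    have dual: "p \<in> dual_space E (norm_RH \<tau>)"
      using p unfolding has_gradient_def by blast
    have zero: "(v, 0) \<in> E"
      unfolding E_def L2_space_def zero_fun_def by simp
    have "p ((v, 0) + (0, jump_at_0 v)) = p (v, 0) + p (0, jump_at_0 v)"
      using dual zero in_E[OF jump, of 0] unfolding dual_space_def by blast
    moreover have "\<bar>p (0, jump_at_0 v)\<bar> \<le> dual_norm E (norm_RH \<tau>) p * norm_RH \<tau> (0, jump_at_0 v)"
      by (rule RH.abs_le_dual_norm[OF dual in_E[OF jump]])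
    ultimately show ?thesis
      by (simp add: norm_RH_def norm_H_jump_at_0[OF \<tau>])
  qed
  ultimately show ?thesis
    unfolding P_def p_def E_def by simp
qed

lemma time_deriv_cong:
  assumes "\<And>r. r \<in> {0..T} \<Longrightarrow> g r x = f r y" "t \<in> {0..T}"
  shows "time_deriv T g t x = time_deriv T f t y"
  unfolding time_deriv_def using assms by (intro vector_derivative_cong_eq always_eventually) auto

context control_problem begin

text \<open>The velocity inside the Hamiltonian: time and path are frozen at \<open>(s, z)\<close>
  and only the control value varies.\<close>

definition frozen_drift :: "real \<Rightarrow> (real \<Rightarrow> real^'d) \<Rightarrow> 'u \<Rightarrow> real^'d" where
  "frozen_drift s z w = F s (z 0, inner_H \<tau> a z) w + b s *v z (-\<tau>)"

lemma frozen_shift_norm_H_tendsto: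
  assumes z: "z \<in> path_space \<tau>"
  shows "((\<lambda>h. norm_H \<tau> (frozen_shift \<tau> z h - z)) \<longlongrightarrow> 0) (at_right 0)"
proof -
  have "((\<lambda>h. sqrt (integral {-\<tau>..0} (\<lambda>\<theta>. norm (frozen_shift \<tau> z h \<theta> - z \<theta>) ^ 2))) \<longlongrightarrow> sqrt 0) (at_right 0)"
    by (intro tendsto_real_sqrt frozen_shift_integral_tendsto[OF z]) simp
  moreover have "\<forall>\<^sub>F h in at_right 0. sqrt (integral {-\<tau>..0} (\<lambda>\<theta>. norm (frozen_shift \<tau> z h \<theta> - z \<theta>) ^ 2))
      = norm_H \<tau> (frozen_shift \<tau> z h - z)"
    using eventually_at_right_less[of "0::real"]
  proof eventually_elim
    case (elim h)
    then have "frozen_shift \<tau> z h - z \<in> path_space \<tau>"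
      by (intro path_space_diff frozen_shift_path_space z) auto
    from norm_H_eq_integral(1)[OF this] show ?case
      by simp
  qed
  ultimately show ?thesis
    unfolding real_sqrt_zero by (rule Lim_transform_eventually)
qed

lemma norm_H_history_diff_le:
  assumes z: "z \<in> path_space \<tau>" and X: "trajectory s z u X" and u: "u \<in> controls s T"
    and s: "0 \<le> s" and h: "0 < h" "h < \<tau>" "s + h \<le> T" and K: "\<And>\<theta>. norm (z \<theta>) \<le> K"
  shows "norm_H \<tau> (history \<tau> X (s + h) - frozen_shift \<tau> z h) \<le> speed K * h * sqrt h"
proof -
  define f where "f = history \<tau> X (s + h) - frozen_shift \<tau> z h"
  have diff: "norm (f \<theta>) \<le> (if h + \<theta> < 0 \<or> \<theta> > 0 then 0 else speed K * h)" for \<theta>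
    using history_frozen_shift_diff_le[OF z X u s _ h(3) K, of \<theta>] h(1) by (simp add: f_def cong: if_cong)
  have speed0: "0 \<le> speed K * h"
    using diff[of 0] h(1) order_trans[OF norm_ge_zero] by simp
  have f: "f \<in> path_space \<tau>"
    unfolding f_def using h s by (intro path_space_diff frozen_shift_path_space z
        history_trajectory_path_space[OF z X]) auto
  note int = norm_H_eq_integral(3)[OF f]
  have "integral {-\<tau>..0} (\<lambda>\<theta>. (norm (f \<theta>))\<^sup>2)
      = integral {-\<tau>..-h} (\<lambda>\<theta>. (norm (f \<theta>))\<^sup>2) + integral {-h..0} (\<lambda>\<theta>. (norm (f \<theta>))\<^sup>2)"
    using h by (intro Henstock_Kurzweil_Integration.integral_combine[symmetric] int) auto
  also have "integral {-\<tau>..-h} (\<lambda>\<theta>. (norm (f \<theta>))\<^sup>2) = integral {-\<tau>..-h} (\<lambda>_. 0)"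
  \<comment> \<open>At \<open>-h\<close> the pointwise bound is not \<open>0\<close>; hence the
    exceptional point.\<close>
  proof (rule integral_spike[of "{-h}"])
    show "0 = (norm (f \<theta>))\<^sup>2" if "\<theta> \<in> {-\<tau>..-h} - {-h}" for \<theta>
      using diff[of \<theta>] that by auto
  qed simp
  also have "integral {-h..0} (\<lambda>\<theta>. (norm (f \<theta>))\<^sup>2) \<le> integral {-h..0} (\<lambda>_. (speed K * h)\<^sup>2)"
  proof (intro integral_le int)
    show "(norm (f \<theta>))\<^sup>2 \<le> (speed K * h)\<^sup>2" for \<theta>
      using diff[of \<theta>] speed0 by (intro power_mono) (auto split: if_splits)
  qed auto
  also have "\<dots> = (speed K * h)\<^sup>2 * h"
    using h by simp
  finally have "norm_H \<tau> f \<le> sqrt ((speed K * h)\<^sup>2 * h)"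
    unfolding norm_H_eq_integral(1)[OF f] by simp
  then show ?thesis
    using speed0 by (simp add: f_def real_sqrt_mult)
qed

lemma test_function_expansion:
  assumes \<psi>: "\<psi> \<in> test_functions T \<tau>" and s: "s \<in> {0..<T}" and z: "z \<in> path_space \<tau>" and e: "e > 0"
  defines "P \<equiv> \<lambda>v. gradient (path_space \<tau>) (sup_norm \<tau>) (\<psi> s) z (jump_at_0 v)"
  shows "bounded_linear P"
    and "\<forall>\<^sub>F h in at_right 0. \<forall>u X. u \<in> controls s T \<longrightarrow> trajectory s z u X \<longrightarrow>
      \<bar>\<psi> (s + h) (history \<tau> X (s + h)) - \<psi> s z
        - (h * (time_deriv T \<psi> s z + S_op \<tau> (\<psi> s) z) + P (X (s + h) - z 0))\<bar> \<le> e * h"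
proof -
  define E :: "((real^'d) \<times> (real \<Rightarrow> real^'d)) set" where "E = UNIV \<times> L2_space {-\<tau>..0}"
  define N :: "(real^'d) \<times> (real \<Rightarrow> real^'d) \<Rightarrow> real" where "N = norm_RH \<tau>"
  interpret RH: seminormed_space E N
    unfolding E_def N_def by (rule seminormed_space_RH)
  have in_E: "(y, x) \<in> E" if "x \<in> path_space \<tau>" for x y
    unfolding E_def using norm_H_eq_integral(2)[OF that] by simp
  have N: "N (y, x) = norm y + norm_H \<tau> x" for x y
    unfolding N_def norm_RH_def by simp
  have sT: "s \<in> {0..T}" "0 \<le> s" "s \<le> T" using s by auto
  obtain \<psi>\<^sub>0 where \<psi>0: "\<psi>\<^sub>0 \<in> C1_space T E N"
    and eq: "\<And>t x. t \<in> {0..T} \<Longrightarrow> x \<in> path_space \<tau> \<Longrightarrow> \<psi> t x = \<psi>\<^sub>0 t (x 0, x)"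
    using \<psi> unfolding test_functions_def E_def N_def norm_RH_def by blast
  define p where "p = gradient E N (\<psi>\<^sub>0 s) (z 0, z)"
  have p: "p \<in> dual_space E N"
    unfolding p_def by (rule RH.C1_space_gradient_dual[OF \<psi>0 sT(1) in_E[OF z]])
  have p_add: "p (x + y) = p x + p y" if "x \<in> E" "y \<in> E" for x y
    using p that unfolding dual_space_def by blast
  have P_eq: "P v = p (v, 0)" for v
    unfolding P_def p_def E_def N_def using \<psi> \<psi>0 eq sT(1) z tau_pos
    by (intro gradient_jump_at_0[of \<psi> T]) (auto simp: test_functions_def E_def N_def)
  have zero_E: "(v, 0) \<in> E" for v
    unfolding E_def L2_space_def zero_fun_def by simp
  show "bounded_linear P"
    unfolding linear_conv_bounded_linear[symmetric]
  proof (rule linearI)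
    show "P (v + w) = P v + P w" for v w
      unfolding P_eq using p_add[OF zero_E zero_E, of v w] by simp
    show "P (c *\<^sub>R v) = c *\<^sub>R P v" for c v
    proof -
      have "p (c *\<^sub>R (v, 0)) = c * p (v, 0)"
        using p zero_E unfolding dual_space_def by blast
      then show ?thesis
        unfolding P_eq by (simp add: scaleR_fun_def zero_fun_def)
    qed
  qed
  obtain K where K: "K \<ge> 0" "\<And>\<theta>. norm (z \<theta>) \<le> K"
    using path_space_bounded[OF z] by metis
  define M where "M = \<bar>speed K\<bar>"
  define k where "k = \<bar>dual_norm E N p\<bar>"
  define n where "n = (\<lambda>h. norm_H \<tau> (frozen_shift \<tau> z h - z))"
  define S where "S = S_op \<tau> (\<psi> s) z"
  \<comment> \<open>Strict differentiability costs at most \<open>e1 * (2 * M * h)\<close>, because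
    \<open>N (y - y') \<le> 2 * M * h\<close> for \<open>h \<le> 1\<close>; the denominator brings
    this below \<open>e / 4 * h\<close>.\<close>
  define e1 where "e1 = e / (8 * (1 + M))"
  have e1: "e1 > 0" "e1 \<le> e / 8" "2 * M * e1 \<le> e / 4"
  proof -
    have "M \<ge> 0" unfolding M_def by simp
    then show "e1 > 0" "e1 \<le> e / 8" "2 * M * e1 \<le> e / 4"
      unfolding e1_def using e by (auto simp: field_simps)
  qed
  obtain d1 where d1: "d1 > 0"
    "\<And>r y y'. r \<in> {0..T} \<Longrightarrow> y \<in> E \<Longrightarrow> y' \<in> E \<Longrightarrow> \<bar>r - s\<bar> < d1 \<Longrightarrow> N (y - (z 0, z)) < d1 \<Longrightarrow> N (y' - (z 0, z)) < d1 \<Longrightarrow>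
      \<bar>\<psi>\<^sub>0 r y' - \<psi>\<^sub>0 r y - p (y' - y)\<bar> \<le> e1 * N (y' - y)"
    unfolding p_def using RH.C1_space_strict_gradient[OF \<psi>0 sT(1) in_E[OF z] e1(1)] by blast
  obtain d2 where d2: "d2 > 0"
    "\<And>r y. r \<in> {s<..T} \<Longrightarrow> y \<in> E \<Longrightarrow> r - s < d2 \<Longrightarrow> N (y - (z 0, z)) < d2 \<Longrightarrow>
      \<bar>\<psi>\<^sub>0 r y - \<psi>\<^sub>0 s y - (r - s) * time_deriv T \<psi>\<^sub>0 s (z 0, z)\<bar> \<le> e1 * (r - s)"
    using RH.C1_space_strict_time_deriv[OF \<psi>0 sT(1) in_E[OF z] e1(1)] by blast
  have td: "time_deriv T \<psi>\<^sub>0 s (z 0, z) = time_deriv T \<psi> s z"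
    using eq z sT(1) by (intro time_deriv_cong) auto
  have "\<psi> s \<in> S_dom_hat \<tau>"
    using \<psi> sT(1) unfolding test_functions_def S_dom_def by blast
  then obtain l where l: "(S_quotient \<tau> (\<psi> s) z \<longlongrightarrow> l) (at_right 0)"
    using z unfolding S_dom_hat_def by blast
  then have "S = l"
    unfolding S_def S_op_def by (intro tendsto_Lim) simp_all
  then have ev_S: "\<forall>\<^sub>F h in at_right 0. dist (S_quotient \<tau> (\<psi> s) z h) S < e / 4"
    using tendstoD[OF l, of "e / 4"] e by simp
  have n: "(n \<longlongrightarrow> 0) (at_right 0)"
    unfolding n_def by (rule frozen_shift_norm_H_tendsto[OF z])
  have lim: "((\<lambda>h. M * h + M * h * sqrt h + n h) \<longlongrightarrow> M * 0 + M * 0 * sqrt 0 + 0) (at_right 0)"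
    by (intro tendsto_intros n)
  \<comment> \<open>Keeps \<open>y\<close> and \<open>y'\<close> inside the balls around
    \<open>(z 0, z)\<close> on which the two mean value estimates hold.\<close>
  have ev_N: "\<forall>\<^sub>F h in at_right 0. M * h + M * h * sqrt h + n h < min d1 d2"
    by (rule order_tendstoD(2)[OF lim]) (use d1 d2 in auto)
  have lim': "((\<lambda>h. k * M * sqrt h) \<longlongrightarrow> k * M * sqrt 0) (at_right 0)"
    by (intro tendsto_intros)
  have ev_k: "\<forall>\<^sub>F h in at_right 0. k * M * sqrt h < e / 4"
    by (rule order_tendstoD(2)[OF lim']) (use e in auto)
  have ev_h: "\<forall>\<^sub>F h in at_right 0. h < min (min d1 d2) (min (T - s) (min \<tau> 1))"
    by (rule order_tendstoD(2)[OF tendsto_ident_at]) (use d1 d2 s tau_pos in auto)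
  show "\<forall>\<^sub>F h in at_right 0. \<forall>u X. u \<in> controls s T \<longrightarrow> trajectory s z u X \<longrightarrow>
      \<bar>\<psi> (s + h) (history \<tau> X (s + h)) - \<psi> s z
        - (h * (time_deriv T \<psi> s z + S_op \<tau> (\<psi> s) z) + P (X (s + h) - z 0))\<bar> \<le> e * h"
    using eventually_at_right_less[of "0::real"] ev_h ev_k ev_N ev_S
  proof eventually_elim
    case (elim h)
    show ?case
    proof (intro allI impI)
      fix u X assume u: "u \<in> controls s T" and X: "trajectory s z u X"
      have h: "0 < h" "h < \<tau>" "s + h \<le> T" "h \<le> 1" using elim by auto
      define y where "y = (X (s + h), history \<tau> X (s + h))"
      define y' where "y' = (z 0, frozen_shift \<tau> z h)"
      have hist: "history \<tau> X (s + h) \<in> path_space \<tau>"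
        using h by (intro history_trajectory_path_space[OF z X]) auto
      have fs: "frozen_shift \<tau> z h \<in> path_space \<tau>"
        using h by (intro frozen_shift_path_space z) auto
      have y: "y \<in> E" and y': "y' \<in> E"
        unfolding y_def y'_def by (intro in_E hist fs)+
      have Xs: "X s = z 0"
        using X sT unfolding trajectory_def by simp
      have "norm (X (s + h) - X s) \<le> speed K * (s + h - s)"
        using h sT by (intro trajectory_lipschitz[OF z X u sT(2,3) K(2)]) auto
      also have "\<dots> \<le> M * h"
        unfolding M_def using h by (simp add: mult_right_mono)
      finally have dX: "norm (X (s + h) - z 0) \<le> M * h"
        unfolding Xs .
      have "norm_H \<tau> (history \<tau> X (s + h) - frozen_shift \<tau> z h) \<le> speed K * h * sqrt h"
        by (rule norm_H_history_diff_le[OF z X u sT(2) h(1,2,3) K(2)])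
      also have "\<dots> \<le> M * h * sqrt h"
        unfolding M_def using h by (intro mult_right_mono) auto
      finally have dH: "norm_H \<tau> (history \<tau> X (s + h) - frozen_shift \<tau> z h) \<le> M * h * sqrt h" .
      have yy': "N (y - y') \<le> M * h + M * h * sqrt h"
        unfolding y_def y'_def diff_Pair N using dX dH by simp
      have y'z: "N (y' - (z 0, z)) = n h"
        unfolding y'_def diff_Pair N n_def by simp
      have "N ((y - y') + (y' - (z 0, z))) \<le> N (y - y') + N (y' - (z 0, z))"
        using y y' in_E[OF z] RH.subspace by (intro RH.triangle subspace_diff) auto
      moreover have "(y - y') + (y' - w) = y - w" for w by simp
      ultimately have "N (y - (z 0, z)) \<le> N (y - y') + N (y' - (z 0, z))"
        by (simp only:)
      then have yz: "N (y - (z 0, z)) \<le> M * h + M * h * sqrt h + n h"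
        using yy' y'z by linarith
      have M0: "0 \<le> M * h + M * h * sqrt h"
        unfolding M_def using h by simp
      have 1: "\<bar>\<psi>\<^sub>0 (s + h) y - \<psi>\<^sub>0 s y - h * time_deriv T \<psi> s z\<bar> \<le> e1 * h"
        using d2(2)[of "s + h" y] y yz elim h by (simp add: td)
      have 2: "\<bar>\<psi>\<^sub>0 s y - \<psi>\<^sub>0 s y' - p (y - y')\<bar> \<le> e1 * N (y - y')"
        using y y' yz y'z elim M0 d1(1) sT(1) by (intro d1(2)) auto
      also have "\<dots> \<le> e1 * (M * h + M * h * sqrt h)"
        using yy' e1(1) by (intro mult_left_mono) auto
      also have "\<dots> \<le> e1 * (M * h + M * h * 1)"
        using e1(1) h unfolding M_def by (intro mult_left_mono add_left_mono) auto
      also have "\<dots> = 2 * M * e1 * h"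
        by simp
      also have "\<dots> \<le> e / 4 * h"
        using e1(3) h by (intro mult_right_mono) auto
      finally have 2: "\<bar>\<psi>\<^sub>0 s y - \<psi>\<^sub>0 s y' - p (y - y')\<bar> \<le> e / 4 * h" .
      have 3: "\<bar>p (y - y') - P (X (s + h) - z 0)\<bar> \<le> e / 4 * h"
      proof -
        have E': "(0, history \<tau> X (s + h) - frozen_shift \<tau> z h) \<in> E"
          by (intro in_E path_space_diff hist fs)
        have "p (y - y') = P (X (s + h) - z 0) + p (0, history \<tau> X (s + h) - frozen_shift \<tau> z h)"
          unfolding P_eq y_def y'_def diff_Pair using p_add[OF zero_E E', of "X (s + h) - z 0"] by simp
        then have "\<bar>p (y - y') - P (X (s + h) - z 0)\<bar> \<le> k * N (0, history \<tau> X (s + h) - frozen_shift \<tau> z h)"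
          using RH.abs_le_dual_norm[OF p E'] mult_right_mono[OF abs_ge_self[of "dual_norm E N p"] RH.N_nonneg[OF E']]
          unfolding k_def by simp
        also have "\<dots> \<le> k * (M * h * sqrt h)"
          using dH unfolding k_def by (intro mult_left_mono) (auto simp: N)
        also have "\<dots> = (k * M * sqrt h) * h"
          by simp
        also have "\<dots> \<le> e / 4 * h"
          using elim by (intro mult_right_mono) auto
        finally show ?thesis .
      qed
      have 4: "\<bar>\<psi> s (frozen_shift \<tau> z h) - \<psi> s z - h * S\<bar> \<le> e / 4 * h"
      proof -
        have "h * \<bar>S_quotient \<tau> (\<psi> s) z h - S\<bar> \<le> h * (e / 4)"
          using elim h by (intro mult_left_mono) (auto simp: dist_real_def)
        moreover have "h * \<bar>S_quotient \<tau> (\<psi> s) z h - S\<bar> = \<bar>h * S_quotient \<tau> (\<psi> s) z h - h * S\<bar>"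
          using h by (simp add: abs_mult flip: right_diff_distrib)
        moreover have "h * S_quotient \<tau> (\<psi> s) z h = \<psi> s (frozen_shift \<tau> z h) - \<psi> s z"
          using h by (simp add: S_quotient_def)
        ultimately show ?thesis
          by (simp add: mult.commute)
      qed
      have "history \<tau> X (s + h) 0 = X (s + h)"
        using tau_pos by (simp add: history_def)
      then have eq1: "\<psi> (s + h) (history \<tau> X (s + h)) = \<psi>\<^sub>0 (s + h) y"
        using eq[OF _ hist, of "s + h"] h sT unfolding y_def by simp
      have "frozen_shift \<tau> z h 0 = z 0"
        using tau_pos h by (simp add: frozen_shift_def)
      then have eq2: "\<psi> s (frozen_shift \<tau> z h) = \<psi>\<^sub>0 s y'"
        using eq[OF sT(1) fs] unfolding y'_def by simp
      have "e1 * h \<le> e / 8 * h"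
        using e1(2) h by (intro mult_right_mono) auto
      moreover have "e * h \<ge> 0" using e h by simp
      ultimately show "\<bar>\<psi> (s + h) (history \<tau> X (s + h)) - \<psi> s z
          - (h * (time_deriv T \<psi> s z + S_op \<tau> (\<psi> s) z) + P (X (s + h) - z 0))\<bar> \<le> e * h"
        using 1 2 3 4 unfolding eq1 eq2 S_def[symmetric] distrib_left by linarith
    qed
  qed
qed

text \<open>The modulus depends on \<open>(s, z)\<close> alone, because the coefficients are
  compared at equal control values and all trajectories from \<open>z\<close> share the constants
  \<open>speed K\<close> and \<open>growth K\<close>. The value at \<open>0\<close> is included for
  the left end of closed intervals.\<close>

lemma trajectory_modulus:
  assumes z: "z \<in> path_space \<tau>" and s: "s \<in> {0..<T}"
  obtains m where "(m \<longlongrightarrow> 0) (at_right 0)" "m 0 = 0"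
    "\<And>h u X. 0 \<le> h \<Longrightarrow> h < \<tau> \<Longrightarrow> s + h \<le> T \<Longrightarrow> u \<in> controls s T \<Longrightarrow> trajectory s z u X \<Longrightarrow>
      norm (drift u X (s + h) - frozen_drift s z (u (s + h))) \<le> m h \<and>
      \<bar>running u X (s + h) - q s (z 0) (u (s + h))\<bar> \<le> m h"
proof -
  have sT: "s \<in> {0..T}" "0 \<le> s" "s \<le> T" using s by auto
  obtain K where K: "K \<ge> 0" "\<And>\<theta>. norm (z \<theta>) \<le> K"
    using path_space_bounded[OF z] by metis
  have growth0: "growth K \<ge> 0"
    using growth_ge[OF K(1)] K(1) by simp
  have speed0: "speed K \<ge> 0"
    unfolding speed_def using growth0 L_pos tau_pos by simp
  define \<omega> where "\<omega> = (\<lambda>h. integral {-\<tau>..0} (\<lambda>\<theta>. norm (frozen_shift \<tau> z h \<theta> - z \<theta>)))"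
  define \<beta> where "\<beta> = (\<lambda>h. norm (b (s + h) *v frozen_shift \<tau> z h (-\<tau>) - b s *v z (-\<tau>)))"
  define m1 where "m1 = (\<lambda>h. L * h + L * (speed K * h) + L\<^sup>2 * (\<tau> * (speed K * h) + \<omega> h) + \<beta> h)"
  define m2 where "m2 = (\<lambda>h. L * (speed K * h) + \<rho> h (growth K))"
  \<comment> \<open>The absolute values make \<open>m\<close> dominate both \<open>m1\<close> and
    \<open>m2\<close> without a discussion of signs.\<close>
  define m where "m = (\<lambda>h. \<bar>m1 h\<bar> + \<bar>m2 h\<bar>)"
  have "frozen_shift \<tau> z 0 = z"
    using z unfolding path_space_def by (auto simp: frozen_shift_def fun_eq_iff)
  then have "\<omega> 0 = 0" "\<beta> 0 = 0"
    unfolding \<omega>_def \<beta>_def by simp_all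
  then have m0: "m 0 = 0"
    unfolding m_def m1_def m2_def using rho_zero[OF growth0] by simp
  have \<omega>: "(\<omega> \<longlongrightarrow> 0) (at_right 0)"
    unfolding \<omega>_def using frozen_shift_integral_tendsto[OF z, of 1] by simp
  \<comment> \<open>The delayed coefficient converges by continuity of \<open>b\<close> and
    right-continuity of \<open>z\<close> at \<open>-\<tau>\<close>.\<close>
  have \<beta>: "(\<beta> \<longlongrightarrow> norm (b s *v z (-\<tau>) - b s *v z (-\<tau>))) (at_right 0)"
    unfolding \<beta>_def
  proof (intro tendsto_norm tendsto_diff tendsto_const
      bounded_bilinear.tendsto[OF bounded_bilinear_matrix_vector_mult])
    show "((\<lambda>h. frozen_shift \<tau> z h (-\<tau>)) \<longlongrightarrow> z (-\<tau>)) (at_right 0)"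
      using tau_pos by (intro frozen_shift_tendsto z) auto
    have "(b \<longlongrightarrow> b s) (at s within {0..T})"
      using b_continuous sT(1) unfolding continuous_on_def by blast
    moreover have "filterlim (\<lambda>h. s + h) (at s within {0..T}) (at_right 0)"
      unfolding filterlim_at
    proof
      have "\<forall>\<^sub>F h in at_right 0. h < T - s"
        using s by (intro order_tendstoD(2)[OF tendsto_ident_at]) auto
      then show "\<forall>\<^sub>F h in at_right 0. s + h \<in> {0..T} \<and> s + h \<noteq> s"
        using eventually_at_right_less[of "0::real"] by eventually_elim (use s in auto)
      have "((\<lambda>h. s + h) \<longlongrightarrow> s + 0) (at_right 0)"
        by (intro tendsto_intros)
      then show "((\<lambda>h. s + h) \<longlongrightarrow> s) (at_right 0)" by simp
    qed
    ultimately show "((\<lambda>h. b (s + h)) \<longlongrightarrow> b s) (at_right 0)"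
      by (rule filterlim_compose)
  qed
  have cont_\<rho>: "continuous_on ({0..} \<times> {0..}) (\<lambda>(h, r). \<rho> h r)"
    using rho unfolding local_modulus_def by blast
  have "continuous_on {0..} (\<lambda>h::real. (h, growth K))"
    by (intro continuous_intros)
  then have "continuous_on {0..} (\<lambda>h. case (h, growth K) of (h, r) \<Rightarrow> \<rho> h r)"
    by (rule continuous_on_compose2[OF cont_\<rho>]) (use growth0 in auto)
  then have "((\<lambda>h. \<rho> h (growth K)) \<longlongrightarrow> \<rho> 0 (growth K)) (at 0 within {0..})"
    unfolding continuous_on_def by auto
  then have \<rho>: "((\<lambda>h. \<rho> h (growth K)) \<longlongrightarrow> 0) (at_right 0)"
    unfolding rho_zero[OF growth0] by (rule tendsto_within_subset) auto
  have "(m \<longlongrightarrow> \<bar>L * 0 + L * (speed K * 0) + L\<^sup>2 * (\<tau> * (speed K * 0) + 0) + norm (b s *v z (-\<tau>) - b s *v z (-\<tau>))\<bar>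
      + \<bar>L * (speed K * 0) + 0\<bar>) (at_right 0)"
    unfolding m_def m1_def m2_def by (intro tendsto_intros \<omega> \<beta> \<rho>)
  then have m_lim: "(m \<longlongrightarrow> 0) (at_right 0)" by simp
  show ?thesis
  proof (rule that[OF m_lim m0])
    fix h u X
    assume h: "0 \<le> h" "h < \<tau>" "s + h \<le> T" and u: "u \<in> controls s T" and X: "trajectory s z u X"
    define \<sigma> where "\<sigma> = s + h"
    have \<sigma>: "\<sigma> \<in> {0..T}" using h sT unfolding \<sigma>_def by auto
    note reg = trajectory_regular[OF z X]
    have seg: "bdd_meas (\<lambda>\<theta>. X (\<sigma> + \<theta>)) {-\<tau>..0}"
      by (rule segment_bdd_meas[OF reg])
    have fs: "frozen_shift \<tau> z h \<in> path_space \<tau>"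
      by (rule frozen_shift_path_space[OF z h(1)])
    have diff: "norm (history \<tau> X \<sigma> \<theta> - frozen_shift \<tau> z h \<theta>) \<le> speed K * h" for \<theta>
      using history_frozen_shift_diff_le[OF z X u sT(2) _ _ K(2), of \<sigma> \<theta>] h speed0
      by (auto simp: \<sigma>_def split: if_splits)
    have "integral {-\<tau>..0} (\<lambda>\<theta>. norm (X (\<sigma> + \<theta>) - z \<theta>)) \<le> (0 - (-\<tau>)) * (speed K * h) + \<omega> h"
      unfolding \<omega>_def
    proof (rule integral_norm_le_add[OF bdd_meas_diff[OF seg path_space_bdd_meas[OF z]]
          path_space_diff_bdd_meas[OF fs z]])
      show "norm (X (\<sigma> + \<theta>) - z \<theta>) \<le> speed K * h + norm (frozen_shift \<tau> z h \<theta> - z \<theta>)"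
        if "\<theta> \<in> {-\<tau>..0}" for \<theta>
        using diff[of \<theta>] norm_triangle_ineq[of "X (\<sigma> + \<theta>) - frozen_shift \<tau> z h \<theta>"
            "frozen_shift \<tau> z h \<theta> - z \<theta>"] that
        by (simp add: history_def)
    qed (use tau_pos in simp)
    then have int: "integral {-\<tau>..0} (\<lambda>\<theta>. norm (X (\<sigma> + \<theta>) - z \<theta>)) \<le> \<tau> * (speed K * h) + \<omega> h"
      by simp
    have "X s = z 0"
      using X sT unfolding trajectory_def by simp
    then have dX: "norm (X \<sigma> - z 0) \<le> speed K * h"
      using trajectory_lipschitz[OF z X u sT(2,3) K(2), of s \<sigma>] h by (simp add: \<sigma>_def)
    have "norm (F \<sigma> (X \<sigma>, inner_H \<tau> a (\<lambda>\<theta>. X (\<sigma> + \<theta>))) (u \<sigma>) - F s (z 0, inner_H \<tau> a z) (u \<sigma>))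
        \<le> L * \<bar>\<sigma> - s\<bar> + L * norm (X \<sigma> - z 0) + L\<^sup>2 * integral {-\<tau>..0} (\<lambda>\<theta>. norm (X (\<sigma> + \<theta>) - z \<theta>))"
      by (rule F_state_diff_le[OF seg path_space_bdd_meas[OF z] \<sigma> sT(1)])
    also have "\<dots> \<le> L * h + L * (speed K * h) + L\<^sup>2 * (\<tau> * (speed K * h) + \<omega> h)"
      using L_pos dX int h(1) by (intro add_mono mult_left_mono) (auto simp: \<sigma>_def)
    finally have 1: "norm (F \<sigma> (X \<sigma>, inner_H \<tau> a (\<lambda>\<theta>. X (\<sigma> + \<theta>))) (u \<sigma>) - F s (z 0, inner_H \<tau> a z) (u \<sigma>))
        \<le> L * h + L * (speed K * h) + L\<^sup>2 * (\<tau> * (speed K * h) + \<omega> h)" .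
    \<comment> \<open>For \<open>h < \<tau>\<close> the delayed time still lies in the prescribed
      past.\<close>
    have "X (\<sigma> - \<tau>) = frozen_shift \<tau> z h (-\<tau>)"
      using X h tau_pos unfolding trajectory_def \<sigma>_def by (simp add: frozen_shift_def algebra_simps)
    then have 2: "norm (b \<sigma> *v X (\<sigma> - \<tau>) - b s *v z (-\<tau>)) = \<beta> h"
      unfolding \<beta>_def \<sigma>_def by simp
    have "norm (drift u X \<sigma> - frozen_drift s z (u \<sigma>)) \<le> m1 h"
      unfolding drift_def frozen_drift_def add_diff_add m1_def
      by (rule norm_triangle_mono[OF 1 eq_refl[OF 2]])
    moreover have "\<bar>running u X \<sigma> - q s (z 0) (u \<sigma>)\<bar> \<le> m2 h"
    proof -
      have mx: "0 \<le> max (norm (X \<sigma>)) (norm (z 0))" "max (norm (X \<sigma>)) (norm (z 0)) \<le> growth K"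
        using trajectory_bound[OF z X u sT(2,3) K(2), of \<sigma>] K(2)[of 0] growth_ge[OF K(1)]
        by (auto simp: le_max_iff_disj)
      \<comment> \<open>Monotonicity in the second argument replaces the state by a bound common to
        all controls.\<close>
      have "\<rho> h (max (norm (X \<sigma>)) (norm (z 0))) \<le> \<rho> h (growth K)"
        using rho h(1) mx unfolding local_modulus_def by (auto intro: mono_onD)
      moreover have "\<bar>running u X \<sigma> - q s (z 0) (u \<sigma>)\<bar>
          \<le> L * norm (X \<sigma> - z 0) + \<rho> \<bar>s - \<sigma>\<bar> (max (norm (X \<sigma>)) (norm (z 0)))"
        unfolding running_def by (rule q_lipschitz[OF \<sigma> sT(1)])
      moreover have "L * norm (X \<sigma> - z 0) \<le> L * (speed K * h)"
        using L_pos dX by (intro mult_left_mono) auto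
      moreover have "\<bar>s - \<sigma>\<bar> = h"
        using h(1) by (simp add: \<sigma>_def)
      ultimately show ?thesis
        unfolding m2_def by simp
    qed
    ultimately show "norm (drift u X (s + h) - frozen_drift s z (u (s + h))) \<le> m h \<and>
        \<bar>running u X (s + h) - q s (z 0) (u (s + h))\<bar> \<le> m h"
      unfolding m_def \<sigma>_def[symmetric] by linarith
  qed
qed

lemma frozen_coefficients_bdd_meas:
  assumes u: "u \<in> controls s T" and s: "s \<in> {0..T}" and z: "z \<in> path_space \<tau>"
  shows "bdd_meas (\<lambda>\<sigma>. frozen_drift s z (u \<sigma>)) {s..T}"
    and "bdd_meas (\<lambda>\<sigma>. q s (z 0) (u \<sigma>)) {s..T}"
proof -
  define M where "M = lebesgue_on {s..T}"
  have u': "u \<in> measurable M borel"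
    using u unfolding controls_def M_def .
  have s': "(\<lambda>\<sigma>. s) \<in> measurable M (restrict_space borel {0..T})"
    using s by (intro measurable_const) simp
  have "(\<lambda>\<sigma>. (\<lambda>(t, x, u). F t x u) (s, (z 0, inner_H \<tau> a z), u \<sigma>)) \<in> borel_measurable M"
    by (rule measurable_compose[OF _ F_measurable]) (intro measurable_Pair s' u' measurable_const; simp)
  then have "bdd_meas (\<lambda>\<sigma>. F s (z 0, inner_H \<tau> a z) (u \<sigma>)) {s..T}"
    using F_growth[OF s] by (intro bdd_measI[of _ _ "L * (1 + norm (z 0, inner_H \<tau> a z))"]) (auto simp: M_def)
  then show "bdd_meas (\<lambda>\<sigma>. frozen_drift s z (u \<sigma>)) {s..T}"
    unfolding frozen_drift_def by (intro bdd_meas_add bdd_meas_const)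
  have "(\<lambda>\<sigma>. (\<lambda>(t, x, u). q t x u) (s, z 0, u \<sigma>)) \<in> borel_measurable M"
    by (rule measurable_compose[OF _ q_measurable]) (intro measurable_Pair s' u' measurable_const; simp)
  then show "bdd_meas (\<lambda>\<sigma>. q s (z 0) (u \<sigma>)) {s..T}"
    using q_growth[OF s] by (intro bdd_measI[of _ _ "L * (1 + norm (z 0))"]) (auto simp: M_def)
qed

text \<open>A Dynkin formula with frozen coefficients. The sign \<open>c\<close> is \<open>1\<close>
  for the subsolution and \<open>-1\<close> for the supersolution property. The expansion, the drift
  and the running cost are each allowed the error \<open>e / 3 * h\<close>.\<close>

lemma test_function_dynkin:
  assumes \<psi>: "\<psi> \<in> test_functions T \<tau>" and s: "s \<in> {0..<T}" and z: "z \<in> path_space \<tau>" and e: "e > 0"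
  defines "P \<equiv> \<lambda>v. gradient (path_space \<tau>) (sup_norm \<tau>) (\<psi> s) z (jump_at_0 v)"
  defines "A \<equiv> time_deriv T \<psi> s z + S_op \<tau> (\<psi> s) z"
  assumes c: "\<bar>c\<bar> = 1"
  shows "\<forall>\<^sub>F h in at_right 0. \<forall>u X. u \<in> controls s T \<longrightarrow> trajectory s z u X \<longrightarrow>
      \<bar>\<psi> (s + h) (history \<tau> X (s + h)) - \<psi> s z + c * integral {s..s+h} (running u X)
        - integral {s..s+h} (\<lambda>\<sigma>. A + P (frozen_drift s z (u \<sigma>)) + c * q s (z 0) (u \<sigma>))\<bar> \<le> e * h"
proof -
  have sT: "s \<in> {0..T}" "0 \<le> s" "s \<le> T" using s by auto
  have P: "bounded_linear P"
    unfolding P_def by (rule test_function_expansion(1)[OF \<psi> s z e])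
  obtain B where B: "B > 0" "\<And>v. norm (P v) \<le> norm v * B"
    using bounded_linear.pos_bounded[OF P] by blast
  obtain m where m: "(m \<longlongrightarrow> 0) (at_right 0)" "m 0 = 0"
    "\<And>h u X. 0 \<le> h \<Longrightarrow> h < \<tau> \<Longrightarrow> s + h \<le> T \<Longrightarrow> u \<in> controls s T \<Longrightarrow> trajectory s z u X \<Longrightarrow>
      norm (drift u X (s + h) - frozen_drift s z (u (s + h))) \<le> m h \<and>
      \<bar>running u X (s + h) - q s (z 0) (u (s + h))\<bar> \<le> m h"
    using trajectory_modulus[OF z s] by blast
  \<comment> \<open>With \<open>B + 1\<close> in the denominator, a deviation \<open>e1\<close>
    stays below \<open>e / 3\<close> both as it is, for the running cost, and after \<open>P\<close>
    with bound \<open>B\<close>, for the drift.\<close>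
  define e1 where "e1 = e / (3 * (B + 1))"
  have e1: "e1 > 0" "e1 * B \<le> e / 3" "e1 \<le> e / 3"
    unfolding e1_def using e B(1) by (auto simp: field_simps)
  obtain d where d: "d > 0" "\<And>h. 0 < h \<Longrightarrow> h < d \<Longrightarrow> m h < e1"
    using order_tendstoD(2)[OF m(1) e1(1)] unfolding eventually_at_right_field by auto
  have m_le: "m h \<le> e1" if "0 \<le> h" "h < d" for h
    using d(2)[of h] that m(2) e1(1) by (cases "h = 0") auto
  have ev_h: "\<forall>\<^sub>F h in at_right 0. h < min d (min (T - s) \<tau>)"
    by (rule order_tendstoD(2)[OF tendsto_ident_at]) (use d(1) s tau_pos in auto)
  have ev: "\<forall>\<^sub>F h in at_right 0. \<forall>u X. u \<in> controls s T \<longrightarrow> trajectory s z u X \<longrightarrow>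
      \<bar>\<psi> (s + h) (history \<tau> X (s + h)) - \<psi> s z - (h * A + P (X (s + h) - z 0))\<bar> \<le> e / 3 * h"
    unfolding P_def A_def using e by (intro test_function_expansion(2)[OF \<psi> s z]) simp
  show ?thesis
    using eventually_at_right_less[of "0::real"] ev_h ev
  proof eventually_elim
    case (elim h)
    show ?case
    proof (intro allI impI)
      fix u X assume u: "u \<in> controls s T" and X: "trajectory s z u X"
      have h: "0 < h" "h < \<tau>" "s + h \<le> T" using elim by auto
      have sub: "{s..s+h} \<subseteq> {s..T}" using h by auto
      note reg = trajectory_regular[OF z X]
      note bm1 = bdd_meas_subset[OF drift_bdd_meas[OF reg u sT(2)] sub]
      note bm2 = bdd_meas_subset[OF frozen_coefficients_bdd_meas(1)[OF u sT(1) z] sub]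
      note bm3 = bdd_meas_subset[OF frozen_coefficients_bdd_meas(2)[OF u sT(1) z] sub]
      note bm4 = bdd_meas_subset[OF trajectory_running_bdd_meas[OF z X u sT(2,3)] sub]
      note int2 = bdd_meas_integrable[OF bm2 order_refl]
      note int3 = bdd_meas_integrable[OF bm3 order_refl]
      have est: "norm (drift u X \<sigma> - frozen_drift s z (u \<sigma>)) \<le> e1"
        "norm (running u X \<sigma> - q s (z 0) (u \<sigma>)) \<le> e1" if "\<sigma> \<in> {s..s+h}" for \<sigma>
        using m(3)[of "\<sigma> - s" u X] m_le[of "\<sigma> - s"] that elim h u X by auto
      have "norm (integral {s..s+h} (drift u X) - integral {s..s+h} (\<lambda>\<sigma>. frozen_drift s z (u \<sigma>))) \<le> e1 * (s + h - s)"
        using h est by (intro norm_integral_diff_le_const bm1 bm2) auto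
      then have "norm (integral {s..s+h} (drift u X) - integral {s..s+h} (\<lambda>\<sigma>. frozen_drift s z (u \<sigma>))) * B \<le> e1 * h * B"
        using B(1) by (intro mult_right_mono) auto
      also have "\<dots> \<le> e / 3 * h"
        using mult_right_mono[OF e1(2), of h] h by (simp add: mult_ac)
      finally have "\<bar>P (integral {s..s+h} (drift u X) - integral {s..s+h} (\<lambda>\<sigma>. frozen_drift s z (u \<sigma>)))\<bar> \<le> e / 3 * h"
        using B(2)[of "integral {s..s+h} (drift u X) - integral {s..s+h} (\<lambda>\<sigma>. frozen_drift s z (u \<sigma>))"]
        unfolding real_norm_def by linarith
      moreover have "X (s + h) - z 0 = integral {s..s+h} (drift u X)"
        using X h unfolding trajectory_def by simp
      moreover have "P (integral {s..s+h} (\<lambda>\<sigma>. frozen_drift s z (u \<sigma>))) = integral {s..s+h} (\<lambda>\<sigma>. P (frozen_drift s z (u \<sigma>)))"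
        using integral_linear[OF int2 P] by (simp add: o_def)
      ultimately have 1: "\<bar>P (X (s + h) - z 0) - integral {s..s+h} (\<lambda>\<sigma>. P (frozen_drift s z (u \<sigma>)))\<bar> \<le> e / 3 * h"
        using linear_diff[OF bounded_linear.linear[OF P]] by simp
      have "norm (integral {s..s+h} (running u X) - integral {s..s+h} (\<lambda>\<sigma>. q s (z 0) (u \<sigma>))) \<le> e1 * (s + h - s)"
        using h est by (intro norm_integral_diff_le_const bm4 bm3) auto
      also have "\<dots> \<le> e / 3 * h"
        using e1(3) h by simp
      finally have "\<bar>c\<bar> * \<bar>integral {s..s+h} (running u X) - integral {s..s+h} (\<lambda>\<sigma>. q s (z 0) (u \<sigma>))\<bar> \<le> e / 3 * h"
        using c by simp
      then have 2: "\<bar>c * integral {s..s+h} (running u X) - c * integral {s..s+h} (\<lambda>\<sigma>. q s (z 0) (u \<sigma>))\<bar> \<le> e / 3 * h"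
        by (simp only: abs_mult[symmetric] right_diff_distrib)
      have "((\<lambda>\<sigma>. A + P (frozen_drift s z (u \<sigma>)) + c * q s (z 0) (u \<sigma>)) has_integral
          h * A + integral {s..s+h} (\<lambda>\<sigma>. P (frozen_drift s z (u \<sigma>))) + c * integral {s..s+h} (\<lambda>\<sigma>. q s (z 0) (u \<sigma>))) {s..s+h}"
      proof (intro has_integral_add has_integral_mult_right integrable_integral int3)
        show "((\<lambda>\<sigma>. A) has_integral h * A) {s..s+h}"
          using has_integral_const_real[of A s "s+h"] h by simp
        show "(\<lambda>\<sigma>. P (frozen_drift s z (u \<sigma>))) integrable_on {s..s+h}"
          using integrable_linear[OF int2 P] by (simp add: o_def)
      qed
      then have 3: "integral {s..s+h} (\<lambda>\<sigma>. A + P (frozen_drift s z (u \<sigma>)) + c * q s (z 0) (u \<sigma>))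
          = h * A + integral {s..s+h} (\<lambda>\<sigma>. P (frozen_drift s z (u \<sigma>))) + c * integral {s..s+h} (\<lambda>\<sigma>. q s (z 0) (u \<sigma>))"
        by (rule integral_unique)
      have "\<bar>\<psi> (s + h) (history \<tau> X (s + h)) - \<psi> s z - (h * A + P (X (s + h) - z 0))\<bar> \<le> e / 3 * h"
        using elim u X by blast
      then show "\<bar>\<psi> (s + h) (history \<tau> X (s + h)) - \<psi> s z + c * integral {s..s+h} (running u X)
        - integral {s..s+h} (\<lambda>\<sigma>. A + P (frozen_drift s z (u \<sigma>)) + c * q s (z 0) (u \<sigma>))\<bar> \<le> e * h"
        using 1 2 unfolding 3 by linarith
    qed
  qed
qed

text \<open>A segment of a trajectory from \<open>z\<close> already carries the past of
  \<open>z\<close>, so concatenation leaves it unchanged. Segments can therefore be tested in the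
  touching condition.\<close>

lemma concat_path_history:
  assumes X: "trajectory s z u X" and t: "s \<le> t"
  shows "concat_path \<tau> s z t (history \<tau> X t) = history \<tau> X t"
proof
  fix \<theta>
  show "concat_path \<tau> s z t (history \<tau> X t) \<theta> = history \<tau> X t \<theta>"
  proof (cases "\<theta> \<in> {-\<tau>..0} \<and> \<theta> < s - t")
    case True
    then have "X (t + \<theta>) = z (t + \<theta> - s)"
      using X t unfolding trajectory_def by auto
    then show ?thesis
      using True by (simp add: concat_path_def history_def algebra_simps)
  next
    case False
    then show ?thesis
      by (simp only: concat_path_def history_def split: if_splits) auto
  qed
qed

text \<open>The recent part starts at an interior point of \<open>Q\<close> and moves with bounded
  speed, the older part is a piece of \<open>z\<close>. The time of stay is uniform in the control,
  as is required when the control is chosen after \<open>h\<close>.\<close>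

lemma eventually_history_paths_in:
  assumes z: "z \<in> paths_in \<tau> (closure Q)" and Q: "open Q" "z 0 \<in> Q" and s: "s \<in> {0..<T}"
  shows "\<forall>\<^sub>F h in at_right 0. \<forall>u X. u \<in> controls s T \<longrightarrow> trajectory s z u X \<longrightarrow>
    history \<tau> X (s + h) \<in> paths_in \<tau> (closure Q)"
proof -
  have zp: "z \<in> path_space \<tau>" and zQ: "\<And>\<theta>. \<theta> \<in> {-\<tau>..0} \<Longrightarrow> z \<theta> \<in> closure Q"
    using z unfolding paths_in_def by auto
  obtain K where K: "\<And>\<theta>. norm (z \<theta>) \<le> K"
    using path_space_bounded[OF zp] by metis
  obtain r where r: "r > 0" "ball (z 0) r \<subseteq> Q"
    using Q open_contains_ball by blast
  have sT: "0 \<le> s" "s \<le> T" using s by auto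
  have lim: "((\<lambda>h. \<bar>speed K\<bar> * h) \<longlongrightarrow> \<bar>speed K\<bar> * 0) (at_right 0)"
    by (intro tendsto_intros)
  have ev: "\<forall>\<^sub>F h in at_right 0. \<bar>speed K\<bar> * h < r"
    by (rule order_tendstoD(2)[OF lim]) (use r in simp)
  have ev_h: "\<forall>\<^sub>F h in at_right 0. h < T - s"
    by (rule order_tendstoD(2)[OF tendsto_ident_at]) (use s in auto)
  show ?thesis
    using eventually_at_right_less[of "0::real"] ev ev_h
  proof eventually_elim
    case (elim h)
    show ?case
    proof (intro allI impI)
      fix u X assume u: "u \<in> controls s T" and X: "trajectory s z u X"
      have "history \<tau> X (s + h) \<theta> \<in> closure Q" if \<theta>: "\<theta> \<in> {-\<tau>..0}" for \<theta>
      proof (cases "h + \<theta> < 0")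
        case True
        then have "X (s + h + \<theta>) = z (h + \<theta>)"
          using X \<theta> elim unfolding trajectory_def by auto
        then show ?thesis
          using zQ[of "h + \<theta>"] True \<theta> elim by (simp add: history_def)
      next
        case False
        have "X s = z 0"
          using X sT unfolding trajectory_def by simp
        then have "norm (X (s + h + \<theta>) - z 0) \<le> speed K * (h + \<theta>)"
          using trajectory_lipschitz[OF zp X u sT K, of s "s + h + \<theta>"] False \<theta> elim by simp
        also have "\<dots> \<le> \<bar>speed K\<bar> * h"
          using \<theta> False by (intro mult_mono) auto
        also have "\<dots> < r"
          using elim by simp
        finally have "X (s + h + \<theta>) \<in> Q"
          using r(2) by (auto simp: dist_norm norm_minus_commute subset_iff)
        then show ?thesis
          using closure_subset \<theta> by (auto simp: history_def)
      qed
      then show "history \<tau> X (s + h) \<in> paths_in \<tau> (closure Q)"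
        unfolding paths_in_def using elim history_trajectory_path_space[OF zp X, of "s + h"] by auto
    qed
  qed
qed

section \<open>The two viscosity inequalities\<close>

lemma value_subsolution: "viscosity_subsolution T \<tau> F a b q \<phi> V"
  unfolding viscosity_subsolution_def
proof (intro conjI allI ballI impI)
  show "V \<in> C0_space T (path_space \<tau>) (sup_norm \<tau>)"
    by (rule value_continuous)
  show "V T x \<le> \<phi> (x 0)" if "x \<in> path_space \<tau>" for x
    using value_terminal[OF that] by simp
next
  fix Q \<psi> s z
  assume \<psi>: "\<psi> \<in> test_functions T \<tau>" and s: "s \<in> {0..<T}" and zQ: "z \<in> paths_in \<tau> (closure Q)"
    and "bounded Q \<and> open Q \<and> z 0 \<in> Q \<and>
      ereal (V s z - \<psi> s z) = (SUP (t, x)\<in>{s..T} \<times> paths_in \<tau> (closure Q).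
        ereal (V t (concat_path \<tau> s z t x) - \<psi> t (concat_path \<tau> s z t x)))"
  then have Q: "open Q" "z 0 \<in> Q" and touch: "ereal (V s z - \<psi> s z) = (SUP (t, x)\<in>{s..T} \<times> paths_in \<tau> (closure Q).
        ereal (V t (concat_path \<tau> s z t x) - \<psi> t (concat_path \<tau> s z t x)))"
    by blast+
  have z: "z \<in> path_space \<tau>"
    using zQ unfolding paths_in_def by blast
  have sT: "0 \<le> s" "s \<le> T" using s by auto
  define A where "A = time_deriv T \<psi> s z + S_op \<tau> (\<psi> s) z"
  define P where "P = (\<lambda>v. gradient (path_space \<tau>) (sup_norm \<tau>) (\<psi> s) z (jump_at_0 v))"
  have "- A \<le> P (frozen_drift s z w) + q s (z 0) w" for w
  proof (rule field_le_epsilon)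
    fix e :: real assume e: "e > 0"
    define u :: "real \<Rightarrow> 'u" where "u = (\<lambda>_. w)"
    have u: "u \<in> controls s T"
      unfolding u_def by (rule const_control)
    obtain X where X: "trajectory s z u X"
      using trajectory_exists[OF z u sT] by blast
    have ev_h: "\<forall>\<^sub>F h in at_right 0. h < T - s"
      by (rule order_tendstoD(2)[OF tendsto_ident_at]) (use s in auto)
    \<comment> \<open>The inequality itself is free of \<open>h\<close>; holding eventually along a
      nontrivial filter, it is true.\<close>
    have "\<forall>\<^sub>F h in at_right (0::real). - A \<le> P (frozen_drift s z w) + q s (z 0) w + e"
      using eventually_at_right_less[of "0::real"] ev_h eventually_history_paths_in[OF zQ Q s]
        test_function_dynkin[OF \<psi> s z e abs_one, folded A_def]
    proof eventually_elim
      case (elim h)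
      have h: "0 < h" "s + h \<le> T" using elim by auto
      define y where "y = history \<tau> X (s + h)"
      have "y \<in> paths_in \<tau> (closure Q)"
        unfolding y_def using elim u X by blast
      then have "ereal (V (s + h) (concat_path \<tau> s z (s + h) y) - \<psi> (s + h) (concat_path \<tau> s z (s + h) y))
          \<le> ereal (V s z - \<psi> s z)"
        unfolding touch using h by (intro SUP_upper2[of "(s + h, y)"]) auto
      then have 1: "V (s + h) y - \<psi> (s + h) y \<le> V s z - \<psi> s z"
        unfolding y_def using concat_path_history[OF X, of "s + h"] h by simp
      have 2: "V s z \<le> integral {s..s+h} (running u X) + V (s + h) y"
        unfolding y_def using h by (intro dynamic_programming_le[OF z X u sT(1)]) auto
      have 3: "\<bar>\<psi> (s + h) y - \<psi> s z + 1 * integral {s..s+h} (running u X)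
          - integral {s..s+h} (\<lambda>\<sigma>. A + P (frozen_drift s z (u \<sigma>)) + 1 * q s (z 0) (u \<sigma>))\<bar> \<le> e * h"
        unfolding y_def P_def using elim u X by blast
      \<comment> \<open>The control is constant and the coefficients are frozen, so the integrand is
        constant.\<close>
      have "integral {s..s+h} (\<lambda>\<sigma>. A + P (frozen_drift s z (u \<sigma>)) + 1 * q s (z 0) (u \<sigma>))
          = h * (A + P (frozen_drift s z w) + q s (z 0) w)"
        using h unfolding u_def by simp
      then have "0 \<le> h * (A + P (frozen_drift s z w) + q s (z 0) w) + e * h"
        using 1 2 3 by linarith
      then have "0 \<le> h * (A + P (frozen_drift s z w) + q s (z 0) w + e)"
        by (simp add: algebra_simps)
      then show ?case
        using h(1) by (simp add: zero_le_mult_iff)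
    qed
    then show "- A \<le> P (frozen_drift s z w) + q s (z 0) w + e"
      by simp
  qed
  then have "- A \<le> (INF w. P (frozen_drift s z w) + q s (z 0) w)"
    by (intro cINF_greatest) auto
  then show "0 \<le> time_deriv T \<psi> s z + S_op \<tau> (\<psi> s) z
      + hamiltonian \<tau> F a b q s z (gradient (path_space \<tau>) (sup_norm \<tau>) (\<psi> s) z)"
    unfolding hamiltonian_def A_def P_def frozen_drift_def by simp
qed

lemma value_supersolution: "viscosity_supersolution T \<tau> F a b q \<phi> V"
  unfolding viscosity_supersolution_def
proof (intro conjI allI ballI impI)
  show "V \<in> C0_space T (path_space \<tau>) (sup_norm \<tau>)"
    by (rule value_continuous)
  show "V T x \<ge> \<phi> (x 0)" if "x \<in> path_space \<tau>" for x
    using value_terminal[OF that] by simp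
next
  fix Q \<psi> s z
  assume \<psi>: "\<psi> \<in> test_functions T \<tau>" and s: "s \<in> {0..<T}" and zQ: "z \<in> paths_in \<tau> (closure Q)"
    and "bounded Q \<and> open Q \<and> z 0 \<in> Q \<and>
      ereal (V s z + \<psi> s z) = (INF (t, x)\<in>{s..T} \<times> paths_in \<tau> (closure Q).
        ereal (V t (concat_path \<tau> s z t x) + \<psi> t (concat_path \<tau> s z t x)))"
  then have Q: "open Q" "z 0 \<in> Q" and touch: "ereal (V s z + \<psi> s z) = (INF (t, x)\<in>{s..T} \<times> paths_in \<tau> (closure Q).
        ereal (V t (concat_path \<tau> s z t x) + \<psi> t (concat_path \<tau> s z t x)))"
    by blast+
  have z: "z \<in> path_space \<tau>"
    using zQ unfolding paths_in_def by blast
  have sT: "s \<in> {0..T}" "0 \<le> s" "s \<le> T" using s by auto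
  define A where "A = time_deriv T \<psi> s z + S_op \<tau> (\<psi> s) z"
  define P where "P = (\<lambda>v. gradient (path_space \<tau>) (sup_norm \<tau>) (\<psi> s) z (jump_at_0 v))"
  define H where "H = (INF w. q s (z 0) w - P (frozen_drift s z w))"
  have P: "bounded_linear P"
    unfolding P_def by (rule test_function_expansion(1)[OF \<psi> s z zero_less_one])
  obtain B where B: "B > 0" "\<And>v. norm (P v) \<le> norm v * B"
    using bounded_linear.pos_bounded[OF P] by blast
  \<comment> \<open>The real infimum \<open>H\<close> lies below each of its members only if the
    range is bounded below; growth of the coefficients provides this.\<close>
  have "bdd_below (range (\<lambda>w. q s (z 0) w - P (frozen_drift s z w)))"
  proof (rule bdd_belowI2)
    fix w
    have "norm (frozen_drift s z w) \<le> L * (1 + norm (z 0, inner_H \<tau> a z)) + L * norm (z (-\<tau>))"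
      unfolding frozen_drift_def by (intro norm_triangle_mono F_growth b_bound sT)
    then have "\<bar>P (frozen_drift s z w)\<bar> \<le> (L * (1 + norm (z 0, inner_H \<tau> a z)) + L * norm (z (-\<tau>))) * B"
      using B(2)[of "frozen_drift s z w"] B(1) by (smt (verit) mult_right_mono real_norm_def)
    then show "- (L * (1 + norm (z 0))) - (L * (1 + norm (z 0, inner_H \<tau> a z)) + L * norm (z (-\<tau>))) * B
        \<le> q s (z 0) w - P (frozen_drift s z w)"
      using q_growth[OF sT(1), of "z 0" w] by linarith
  qed
  then have H_le: "H \<le> q s (z 0) w - P (frozen_drift s z w)" for w
    unfolding H_def by (rule cINF_lower) simp
  have "H \<le> A"
  proof (rule field_le_epsilon)
    fix e :: real assume e: "e > 0"
    have ev_h: "\<forall>\<^sub>F h in at_right 0. h < T - s"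
      by (rule order_tendstoD(2)[OF tendsto_ident_at]) (use s in auto)
    have e2: "e / 2 > 0" using e by simp
    have "\<forall>\<^sub>F h in at_right (0::real). H \<le> A + e"
      using eventually_at_right_less[of "0::real"] ev_h eventually_history_paths_in[OF zQ Q s]
        test_function_dynkin[OF \<psi> s z e2 abs_neg_one, folded A_def]
    proof eventually_elim
      case (elim h)
      have h: "0 < h" "s + h \<le> T" using elim by auto
      obtain u X where u: "u \<in> controls s T" and X: "trajectory s z u X"
        and 2: "integral {s..s+h} (running u X) + V (s + h) (history \<tau> X (s + h)) < V s z + e / 2 * h"
        \<comment> \<open>The optimality gap is proportional to \<open>h\<close>, so that it
          survives division by \<open>h\<close> only as \<open>e / 2\<close>; the Dynkin error
          supplies the other half.\<close>
        using dynamic_programming_ge[OF z sT(2), of "s + h" "e / 2 * h"] h e by auto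
      define y where "y = history \<tau> X (s + h)"
      have "y \<in> paths_in \<tau> (closure Q)"
        unfolding y_def using elim u X by blast
      then have "ereal (V s z + \<psi> s z)
          \<le> ereal (V (s + h) (concat_path \<tau> s z (s + h) y) + \<psi> (s + h) (concat_path \<tau> s z (s + h) y))"
        unfolding touch using h by (intro INF_lower2[of "(s + h, y)"]) auto
      then have 1: "V s z + \<psi> s z \<le> V (s + h) y + \<psi> (s + h) y"
        unfolding y_def using concat_path_history[OF X, of "s + h"] h by simp
      have 3: "\<bar>\<psi> (s + h) y - \<psi> s z + - 1 * integral {s..s+h} (running u X)
          - integral {s..s+h} (\<lambda>\<sigma>. A + P (frozen_drift s z (u \<sigma>)) + - 1 * q s (z 0) (u \<sigma>))\<bar> \<le> e / 2 * h"
        unfolding y_def P_def using elim u X by blast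
      have sub: "{s..s+h} \<subseteq> {s..T}" using h by auto
      have "integral {s..s+h} (\<lambda>\<sigma>. A + P (frozen_drift s z (u \<sigma>)) + - 1 * q s (z 0) (u \<sigma>))
          \<le> integral {s..s+h} (\<lambda>\<sigma>. A - H)"
      proof (rule integral_le)
        have "bdd_meas (\<lambda>\<sigma>. A + P (frozen_drift s z (u \<sigma>)) - q s (z 0) (u \<sigma>)) {s..T}"
          by (intro bdd_meas_add bdd_meas_diff bdd_meas_const
              bdd_meas_linear[OF _ P] frozen_coefficients_bdd_meas[OF u sT(1) z])
        then show "(\<lambda>\<sigma>. A + P (frozen_drift s z (u \<sigma>)) + - 1 * q s (z 0) (u \<sigma>)) integrable_on {s..s+h}"
          by (intro bdd_meas_integrable[OF _ sub]) simp
        show "A + P (frozen_drift s z (u \<sigma>)) + - 1 * q s (z 0) (u \<sigma>) \<le> A - H" for \<sigma>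
          using H_le[of "u \<sigma>"] by simp
      qed auto
      also have "\<dots> = h * (A - H)"
        using h by simp
      finally have "0 \<le> h * (A - H) + e * h"
        using 1 2 3 unfolding y_def[symmetric] by linarith
      then have "0 \<le> h * (A + e - H)"
        by (simp add: algebra_simps)
      then show ?case
        using h(1) by (simp add: zero_le_mult_iff)
    qed
    then show "H \<le> A + e"
      by simp
  qed
  then show "- time_deriv T \<psi> s z - S_op \<tau> (\<psi> s) z
      + hamiltonian \<tau> F a b q s z (- gradient (path_space \<tau>) (sup_norm \<tau>) (\<psi> s) z) \<le> 0"
    unfolding hamiltonian_def A_def H_def P_def frozen_drift_def by simp
qed

end

text \<open>On a bounded interval square integrability implies integrability, by
  \<open>norm (g s) \<le> 1 + (norm (g s))\<^sup>2\<close>, and indefinite integrals are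
  continuous.\<close>

lemma W12_space_continuous_on:
  fixes f :: "real \<Rightarrow> 'a::euclidean_space"
  assumes "f \<in> W12_space a b"
  shows "continuous_on {a..b} f"
proof -
  obtain g where g: "g \<in> L2_space {a..b}"
    and f: "\<And>s. s \<in> {a..b} \<Longrightarrow> f s = f a + (LINT r|lebesgue_on {a..s}. g r)"
    using assms unfolding W12_space_def by blast
  have meas: "g \<in> borel_measurable (lebesgue_on {a..b})"
    using g unfolding L2_space_def by blast
  have "integrable (lebesgue_on {a..b}) g"
  proof (rule Bochner_Integration.integrable_bound[OF _ meas AE_I2])
    have "integrable (lebesgue_on {a..b}) (\<lambda>_. 1 :: real)"
      by (rule bdd_meas_integrable_lebesgue) simp
    then show "integrable (lebesgue_on {a..b}) (\<lambda>s. 1 + (norm (g s))\<^sup>2)"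
      using g unfolding L2_space_def by (intro Bochner_Integration.integrable_add) blast+
    show "norm (g s) \<le> norm (1 + (norm (g s))\<^sup>2)" for s
      using zero_le_power2[of "norm (g s) - 1"] zero_le_power2[of "norm (g s)"]
      by (simp add: power2_eq_square algebra_simps abs_if)
  qed
  then have int: "integrable (lebesgue_on {a..s}) g" if "s \<in> {a..b}" for s
    by (rule integrable_subinterval) (use that in auto)
  have "continuous_on {a..b} (\<lambda>s. f a + integral {a..s} g)"
  proof (cases "a \<le> b")
    case True
    then have "g integrable_on {a..b}"
      using has_integral_integral_lebesgue_on[OF int[of b]] by auto
    then show ?thesis
      by (intro continuous_intros indefinite_integral_continuous_1)
  qed simp
  then show ?thesis
  proof (rule continuous_on_eq)
    fix s assume s: "s \<in> {a..b}"
    have "(LINT r|lebesgue_on {a..s}. g r) = integral {a..s} g"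
      by (rule lebesgue_integral_eq_integral[OF int[OF s]]) simp
    with f[OF s] show "f a + integral {a..s} g = f s"
      by (simp only:)
  qed
qed

theorem theorem4p4:
  fixes T \<tau> :: real
    and F :: "real \<Rightarrow> (real^'d) \<times> real \<Rightarrow> 'u::metric_space \<Rightarrow> real^'d"
    and a :: "real \<Rightarrow> real^'d"
    and b :: "real \<Rightarrow> real^'d^'d"
    and q :: "real \<Rightarrow> real^'d \<Rightarrow> 'u \<Rightarrow> real"
    and \<phi> :: "real^'d \<Rightarrow> real"
  assumes "T > 0" and "\<tau> > 0"
    and "condition_A1 T F"
    and "condition_A2 T \<tau> a b"
    and "condition_B1 T q \<phi>"
    and "condition_B2 T q \<phi>"
  shows "viscosity_solution T \<tau> F a b q \<phi> (value_function T \<tau> F a b q \<phi>)"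
proof -
  obtain L1 where L1: "L1 > 0" "\<And>t x u. t \<in> {0..T} \<Longrightarrow> norm (F t x u) \<le> L1 * (1 + norm x)"
    "\<And>t s x y u. t \<in> {0..T} \<Longrightarrow> s \<in> {0..T} \<Longrightarrow> norm (F t x u - F s y u) \<le> L1 * (\<bar>s - t\<bar> + norm (x - y))"
    using assms(3) unfolding condition_A1_def by metis
  have a: "continuous_on {-\<tau>..0} a"
    using assms(4) W12_space_continuous_on unfolding condition_A2_def by blast
  obtain L2 where L2: "L2 > 0" "\<And>\<theta>. \<theta> \<in> {-\<tau>..0} \<Longrightarrow> norm (a \<theta>) \<le> L2"
    using bdd_meas_bound[OF bdd_meas_continuous[OF a]] by blast
  have b: "continuous_on {0..T} b"
    using assms(4) W12_space_continuous_on unfolding condition_A2_def by blast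
  obtain B where B: "B > 0" "\<And>t. t \<in> {0..T} \<Longrightarrow> norm (b t) \<le> B"
    using bdd_meas_bound[OF bdd_meas_continuous[OF b]] by blast
  obtain C where C: "C > 0" "\<And>(A::real^'d^'d) y. norm (A *v y) \<le> norm A * norm y * C"
    using bounded_bilinear.pos_bounded[OF bounded_bilinear_matrix_vector_mult] by blast
  obtain L3 where L3: "L3 > 0" "\<And>t x u. t \<in> {0..T} \<Longrightarrow> \<bar>q t x u\<bar> + \<bar>\<phi> x\<bar> \<le> L3 * (1 + norm x)"
    using assms(5) unfolding condition_B1_def by metis
  obtain L4 \<rho> where L4: "L4 > 0" and \<rho>: "local_modulus \<rho>"
    and L4': "\<And>t s x y u. t \<in> {0..T} \<Longrightarrow> s \<in> {0..T} \<Longrightarrow>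
      \<bar>q t x u - q s y u\<bar> + \<bar>\<phi> x - \<phi> y\<bar> \<le> L4 * norm (x - y) + \<rho> \<bar>s - t\<bar> (max (norm x) (norm y))"
    using assms(6) unfolding condition_B2_def by blast
  \<comment> \<open>A sum of positive constants dominates each of them; \<open>B * C\<close> is the
    operator bound of \<open>b\<close>, with \<open>C\<close> the constant of the bilinear
    map.\<close>
  define L where "L = L1 + L2 + B * C + L3 + L4"
  have BC: "B * C > 0" using B(1) C(1) by simp
  have L: "L1 \<le> L" "L2 \<le> L" "B * C \<le> L" "L3 \<le> L" "L4 \<le> L" "L > 0"
    unfolding L_def using L1(1) L2(1) L3(1) L4 BC by auto
  have mono: "K * r \<le> L * r" if "K \<le> L" "r \<ge> 0" for K r
    using that by (rule mult_right_mono)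
  have T0: "0 \<in> {0..T}" using \<open>T > 0\<close> by simp
  interpret control_problem T \<tau> L F a b q \<phi> \<rho>
  proof
    show "T > 0" "\<tau> > 0" "L > 0" "continuous_on {-\<tau>..0} a" "continuous_on {0..T} b" "local_modulus \<rho>"
      by fact+
    show "(\<lambda>(t, x, u). F t x u) \<in> borel_measurable (restrict_space borel {0..T} \<Otimes>\<^sub>M borel \<Otimes>\<^sub>M borel)"
      using assms(3) unfolding condition_A1_def by blast
    show "(\<lambda>(t, x, u). q t x u) \<in> borel_measurable (restrict_space borel {0..T} \<Otimes>\<^sub>M borel \<Otimes>\<^sub>M borel)"
      using assms(5) unfolding condition_B1_def by blast
    show "norm (F t x u) \<le> L * (1 + norm x)" if "t \<in> {0..T}" for t x u
      using L1(2)[OF that, of x u] mono[OF L(1), of "1 + norm x"] by simp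
    show "norm (F t x u - F s y u) \<le> L * (\<bar>s - t\<bar> + norm (x - y))" if "t \<in> {0..T}" "s \<in> {0..T}" for t s x y u
      using L1(3)[OF that, of x u y] mono[OF L(1), of "\<bar>s - t\<bar> + norm (x - y)"] by simp
    show "norm (a \<theta>) \<le> L" if "\<theta> \<in> {-\<tau>..0}" for \<theta>
      using L2(2)[OF that] L(2) by simp
    show "norm (b t *v y) \<le> L * norm y" if "t \<in> {0..T}" for t y
    proof -
      have "norm (b t *v y) \<le> norm (b t) * norm y * C"
        by (rule C(2))
      also have "\<dots> \<le> B * norm y * C"
        using B(2)[OF that] C(1) by (intro mult_right_mono) auto
      also have "\<dots> \<le> L * norm y"
        using mono[OF L(3), of "norm y"] by (simp add: mult_ac)
      finally show ?thesis .
    qed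
    show "\<bar>q t x u\<bar> \<le> L * (1 + norm x)" if "t \<in> {0..T}" for t x u
      using L3(2)[OF that, of x u] mono[OF L(4), of "1 + norm x"] by simp
    \<comment> \<open>The bound of \<open>\<phi>\<close> is coupled with that of \<open>q\<close>;
      it is read off at time \<open>0\<close> and at the control value \<open>undefined\<close>,
      which is some point of the control space.\<close>
    show "\<bar>\<phi> x\<bar> \<le> L * (1 + norm x)" for x
      using L3(2)[OF T0, of x undefined] mono[OF L(4), of "1 + norm x"] by simp
    show "\<bar>q t x u - q s y u\<bar> \<le> L * norm (x - y) + \<rho> \<bar>s - t\<bar> (max (norm x) (norm y))"
      if "t \<in> {0..T}" "s \<in> {0..T}" for t s x y u
      using L4'[OF that, of x u y] mono[OF L(5), of "norm (x - y)"] by simp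
    show "\<bar>\<phi> x - \<phi> y\<bar> \<le> L * norm (x - y)" for x y
    proof -
      \<comment> \<open>The coupled estimate is used with equal times, where the modulus vanishes
        and a pure Lipschitz bound for \<open>\<phi>\<close> remains.\<close>
      have "\<rho> 0 (max (norm x) (norm y)) = 0"
        using \<rho> unfolding local_modulus_def by (simp add: le_max_iff_disj)
      then show ?thesis
        using L4'[OF T0 T0, of x undefined y] mono[OF L(5), of "norm (x - y)"] by simp
    qed
  qed
  show ?thesis
    unfolding viscosity_solution_def using value_subsolution value_supersolution by blast
qed

end
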